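(* Let $T>0$ and let $a,a_1,a_2,a_3,f:[0,1]\times\mathbb{R}\to\mathbb{R}$ and $r_0,r_1:\mathbb{R}\to\mathbb{R}$ be $T$-periodic in $t$ with $a(x,t)>0$ for all $(x,t)$ and $\int_0^Ta(0,t)r_0(t)\,dt\neq0$. (i) Let $k\ge1$ be an integer and assume $a\in C_T^{k+1}$, $a_1,a_2,a_3,f\in C_T^k$, $r_0,r_1\in C_T^k(\mathbb{R})$, and that one of the following four conditions holds: (C1) $c_1^l(0,1,t)\,c_2^l(1,0,\tau_1(0,1,t))<1$ for all $t\in\mathbb{R}$ and $l=0,1,\dots,k$; (C2) $c_1^l(0,1,t)\,c_2^l(1,0,\tau_1(0,1,t))>1$ for all $t\in\mathbb{R}$ and $l=0,1,\dots,k$; (C3) $c_2^l(1,0,t)\,c_1^l(0,1,\tau_2(1,0,t))<1$ for all $t\in\mathbb{R}$ and $l=0,1,\dots,k$; (C4) $c_2^l(1,0,t)\,c_1^l(0,1,\tau_2(1,0,t))>1$ for all $t\in\mathbb{R}$ and $l=0,1,\dots,k$. Then every weak solution of problem (P) belongs to $C_T^{k+1}$. (ii) Assume that $a$ does not depend on $t$, that $a,a_1,a_2,a_3,f\in C_T^\infty$ and $r_0,r_1\in C_T^\infty(\mathbb{R})$, and that either $\int_0^1\big[(b_{11}/a)(\eta,\tau_1(\eta,1,t))+(b_{22}/a)(\eta,\tau_2(\eta,0,\tau_1(0,1,t)))\big]d\eta\neq0$ for all $t\in\mathbb{R}$, or $\int_0^1\big[(b_{22}/a)(\eta,\tau_2(\eta,0,t))+(b_{11}/a)(\eta,\tau_1(\eta,1,\tau_2(0,1,t)))\big]d\eta\neq0$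 for all $t\in\mathbb{R}$. Then every weak solution of problem (P) belongs to $C_T^\infty$.
   Context: For an integer $l\ge0$, $C_T^l$ is the Banach space of functions $u:[0,1]\times\mathbb{R}\to\mathbb{R}$, $T$-periodic in $t$ and $l$ times continuously differentiable, with the usual $C^l$ sup-norm; $C_T=C_T^0$; $C_T^\infty$ the $T$-periodic-in-$t$ infinitely differentiable functions; $\mathcal{C}=C_T\times C_T$; $C_T^l(\mathbb{R})$, $C_T^\infty(\mathbb{R})$ the analogous spaces of $T$-periodic functions $\mathbb{R}\to\mathbb{R}$. Problem (P): $\partial_t^2w-a^2(x,t)\partial_x^2w+a_1(x,t)\partial_tw+a_2(x,t)\partial_xw+a_3(x,t)w=f(x,t)$ for $x\in(0,1)$, $w(x,t)=w(x,t+T)$, $\partial_xw(0,t)=r_0(t)w(0,t)$, $\partial_xw(1,t)=r_1(t)w(1,t)$. Set $b_{11}=\frac{a_1}{2}+\frac{a_2}{2a}+\frac{a\partial_xa-\partial_ta}{2a}$, $b_{12}=\frac{a_1}{2}-\frac{a_2}{2a}+\frac{a\partial_xa-\partial_ta}{2a}$, $b_{21}=\frac{a_1}{2}+\frac{a_2}{2a}+\frac{a\partial_xa+\partial_ta}{2a}$, $b_{22}=\frac{a_1}{2}-\frac{a_2}{2a}-\frac{a\partial_xa+\partial_ta}{2a}$. For $j=1,2$ the characteristic $\xi\in[0,1]\mapsto\tau_j(\xi,x,t)$ solves $\partial_\xi\tau_j(\xi,x,t)=(-1)^j/a(\xi,\tau_j(\xi,x,t))$, $\tau_j(x,x,t)=t$.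 For integers $l\ge0$ let $c_j^l(\xi,x,t)=\exp\int_x^\xi(-1)^j\big(\frac{b_{jj}}{a}-l\frac{\partial_ta}{a^2}\big)(\eta,\tau_j(\eta,x,t))\,d\eta$, $c_j=c_j^0$, and $d_j(\xi,x,t)=(-1)^jc_j(\xi,x,t)/a(\xi,\tau_j(\xi,x,t))$. With $C=\int_0^Ta(0,t)r_0(t)dt$, for $u=(u_1,u_2)\in\mathcal{C}$: $[Iu](t)=\int_0^t\frac{u_1(0,s)+u_2(0,s)}{2}ds$, $[Ju](x,t)=\int_0^x\frac{u_1(\xi,t)-u_2(\xi,t)}{2a(\xi,t)}d\xi$, $Nu=\frac1C\int_0^T\big(\frac{u_1(0,t)-u_2(0,t)}{2}-a(0,t)r_0(t)[Iu](t)\big)dt$, $[Gu](t)=[Iu](t)+Nu$, $[Fu](x,t)=[Gu](t)+[Ju](x,t)$. $u\in\mathcal{C}$ is a weak solution of the first-order system if, with $\tau_j(\xi)=\tau_j(\xi,x,t)$: $u_1(x,t)=c_1(0,x,t)\big[u_2(0,\tau_1(0))+2a(0,\tau_1(0))r_0(\tau_1(0))[Gu](\tau_1(0))\big]-\int_0^xd_1(\xi,x,t)b_{12}(\xi,\tau_1(\xi))u_2(\xi,\tau_1(\xi))d\xi+\int_0^xd_1(\xi,x,t)\big(f-a_3\,Fu\big)(\xi,\tau_1(\xi))d\xi$, $u_2(x,t)=c_2(1,x,t)\big[u_1(1,\tau_2(1))-2a(1,\tau_2(1))r_1(\tau_2(1))[Fu](1,\tau_2(1))\big]-\int_1^xd_2(\xi,x,t)b_{21}(\xi,\tau_2(\xi))u_1(\xi,\tau_2(\xi))d\xi+\int_1^xd_2(\xi,x,t)\big(f-a_3\,Fu\big)(\xi,\tau_2(\xi))d\xi$.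 A weak solution of (P) is $w(x,t)=[Iu](t)+[Ju](x,t)+Nu$ for such $u$. *)

theory Defs
  imports "HOL-Analysis.Analysis"
begin

text \<open>Functions u : [0,1] x R -> R are represented as curried functions
  real => real => real (first argument x, second argument t); only their values
  on the strip [0,1] x R matter.\<close>

definition strip :: "(real \<times> real) set" where
  "strip = {0..1} \<times> (UNIV :: real set)"

fun Ck :: "nat \<Rightarrow> (real \<Rightarrow> real \<Rightarrow> real) \<Rightarrow> bool" where
  "Ck 0 g = continuous_on strip (\<lambda>z. g (fst z) (snd z))"
| "Ck (Suc k) g = (\<exists>gx gt.
      (\<forall>x\<in>{0..1}. \<forall>t. ((\<lambda>z. g (fst z) (snd z)) has_derivative
          (\<lambda>h. gx x t * fst h + gt x t * snd h)) (at (x, t) within strip))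
      \<and> Ck k gx \<and> Ck k gt)"

definition periodicT :: "real \<Rightarrow> (real \<Rightarrow> real \<Rightarrow> real) \<Rightarrow> bool" where
  "periodicT T g \<longleftrightarrow> (\<forall>x\<in>{0..1}. \<forall>t. g x (t + T) = g x t)"

definition CT :: "nat \<Rightarrow> real \<Rightarrow> (real \<Rightarrow> real \<Rightarrow> real) \<Rightarrow> bool" where
  "CT l T g \<longleftrightarrow> periodicT T g \<and> Ck l g"

definition CTinf :: "real \<Rightarrow> (real \<Rightarrow> real \<Rightarrow> real) \<Rightarrow> bool" where
  "CTinf T g \<longleftrightarrow> periodicT T g \<and> (\<forall>l. Ck l g)"

fun Ck1 :: "nat \<Rightarrow> (real \<Rightarrow> real) \<Rightarrow> bool" where
  "Ck1 0 r = continuous_on UNIV r"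
| "Ck1 (Suc k) r = (\<exists>r'. (\<forall>t. (r has_real_derivative r' t) (at t)) \<and> Ck1 k r')"

definition periodic1 :: "real \<Rightarrow> (real \<Rightarrow> real) \<Rightarrow> bool" where
  "periodic1 T r \<longleftrightarrow> (\<forall>t. r (t + T) = r t)"

definition CT1 :: "nat \<Rightarrow> real \<Rightarrow> (real \<Rightarrow> real) \<Rightarrow> bool" where
  "CT1 l T r \<longleftrightarrow> periodic1 T r \<and> Ck1 l r"

definition CT1inf :: "real \<Rightarrow> (real \<Rightarrow> real) \<Rightarrow> bool" where
  "CT1inf T r \<longleftrightarrow> periodic1 T r \<and> (\<forall>l. Ck1 l r)"

definition oint :: "real \<Rightarrow> real \<Rightarrow> (real \<Rightarrow> real) \<Rightarrow> real" where
  "oint p q g = (if p \<le> q then integral {p..q} g else - integral {q..p} g)"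

definition dx :: "(real \<Rightarrow> real \<Rightarrow> real) \<Rightarrow> real \<Rightarrow> real \<Rightarrow> real" where
  "dx g x t = vector_derivative (\<lambda>y. g y t) (at x within {0..1})"

definition dt :: "(real \<Rightarrow> real \<Rightarrow> real) \<Rightarrow> real \<Rightarrow> real \<Rightarrow> real" where
  "dt g x t = deriv (\<lambda>s. g x s) t"

definition b11 :: "(real \<Rightarrow> real \<Rightarrow> real) \<Rightarrow> (real \<Rightarrow> real \<Rightarrow> real) \<Rightarrow> (real \<Rightarrow> real \<Rightarrow> real) \<Rightarrow> real \<Rightarrow> real \<Rightarrow> real" where
  "b11 a a1 a2 x t = a1 x t / 2 + a2 x t / (2 * a x t) + (a x t * dx a x t - dt a x t) / (2 * a x t)"

definition b12 :: "(real \<Rightarrow> real \<Rightarrow> real) \<Rightarrow> (real \<Rightarrow> real \<Rightarrow> real) \<Rightarrow> (real \<Rightarrow> real \<Rightarrow> real) \<Rightarrow> real \<Rightarrow> real \<Rightarrow> real" where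
  "b12 a a1 a2 x t = a1 x t / 2 - a2 x t / (2 * a x t) + (a x t * dx a x t - dt a x t) / (2 * a x t)"

definition b21 :: "(real \<Rightarrow> real \<Rightarrow> real) \<Rightarrow> (real \<Rightarrow> real \<Rightarrow> real) \<Rightarrow> (real \<Rightarrow> real \<Rightarrow> real) \<Rightarrow> real \<Rightarrow> real \<Rightarrow> real" where
  "b21 a a1 a2 x t = a1 x t / 2 + a2 x t / (2 * a x t) + (a x t * dx a x t + dt a x t) / (2 * a x t)"

definition b22 :: "(real \<Rightarrow> real \<Rightarrow> real) \<Rightarrow> (real \<Rightarrow> real \<Rightarrow> real) \<Rightarrow> (real \<Rightarrow> real \<Rightarrow> real) \<Rightarrow> real \<Rightarrow> real \<Rightarrow> real" where
  "b22 a a1 a2 x t = a1 x t / 2 - a2 x t / (2 * a x t) - (a x t * dx a x t + dt a x t) / (2 * a x t)"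

definition bjj :: "(real \<Rightarrow> real \<Rightarrow> real) \<Rightarrow> (real \<Rightarrow> real \<Rightarrow> real) \<Rightarrow> (real \<Rightarrow> real \<Rightarrow> real) \<Rightarrow> nat \<Rightarrow> real \<Rightarrow> real \<Rightarrow> real" where
  "bjj a a1 a2 j = (if j = 1 then b11 a a1 a2 else b22 a a1 a2)"

definition tau :: "(real \<Rightarrow> real \<Rightarrow> real) \<Rightarrow> nat \<Rightarrow> real \<Rightarrow> real \<Rightarrow> real \<Rightarrow> real" where
  "tau a j \<xi> x t = (THE s. \<exists>\<tau>.
      (\<forall>\<eta>\<in>{0..1}. (\<tau> has_real_derivative ((-1) ^ j / a \<eta> (\<tau> \<eta>))) (at \<eta> within {0..1}))
      \<and> \<tau> x = t \<and> \<tau> \<xi> = s)"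

definition cl :: "(real \<Rightarrow> real \<Rightarrow> real) \<Rightarrow> (real \<Rightarrow> real \<Rightarrow> real) \<Rightarrow> (real \<Rightarrow> real \<Rightarrow> real) \<Rightarrow> nat \<Rightarrow> nat \<Rightarrow> real \<Rightarrow> real \<Rightarrow> real \<Rightarrow> real" where
  "cl a a1 a2 j l \<xi> x t = exp (oint x \<xi> (\<lambda>\<eta>. (-1) ^ j *
      (bjj a a1 a2 j \<eta> (tau a j \<eta> x t) / a \<eta> (tau a j \<eta> x t)
       - real l * dt a \<eta> (tau a j \<eta> x t) / (a \<eta> (tau a j \<eta> x t))\<^sup>2)))"

definition dj :: "(real \<Rightarrow> real \<Rightarrow> real) \<Rightarrow> (real \<Rightarrow> real \<Rightarrow> real) \<Rightarrow> (real \<Rightarrow> real \<Rightarrow> real) \<Rightarrow> nat \<Rightarrow> real \<Rightarrow> real \<Rightarrow> real \<Rightarrow> real" where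
  "dj a a1 a2 j \<xi> x t = (-1) ^ j * cl a a1 a2 j 0 \<xi> x t / a \<xi> (tau a j \<xi> x t)"

definition Iop :: "(real \<Rightarrow> real \<Rightarrow> real) \<Rightarrow> (real \<Rightarrow> real \<Rightarrow> real) \<Rightarrow> real \<Rightarrow> real" where
  "Iop u1 u2 t = oint 0 t (\<lambda>s. (u1 0 s + u2 0 s) / 2)"

definition Jop :: "(real \<Rightarrow> real \<Rightarrow> real) \<Rightarrow> (real \<Rightarrow> real \<Rightarrow> real) \<Rightarrow> (real \<Rightarrow> real \<Rightarrow> real) \<Rightarrow> real \<Rightarrow> real \<Rightarrow> real" where
  "Jop a u1 u2 x t = oint 0 x (\<lambda>\<xi>. (u1 \<xi> t - u2 \<xi> t) / (2 * a \<xi> t))"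

definition Cconst :: "real \<Rightarrow> (real \<Rightarrow> real \<Rightarrow> real) \<Rightarrow> (real \<Rightarrow> real) \<Rightarrow> real" where
  "Cconst T a r0 = integral {0..T} (\<lambda>t. a 0 t * r0 t)"

definition Nop :: "real \<Rightarrow> (real \<Rightarrow> real \<Rightarrow> real) \<Rightarrow> (real \<Rightarrow> real) \<Rightarrow> (real \<Rightarrow> real \<Rightarrow> real) \<Rightarrow> (real \<Rightarrow> real \<Rightarrow> real) \<Rightarrow> real" where
  "Nop T a r0 u1 u2 = (1 / Cconst T a r0) *
     integral {0..T} (\<lambda>t. (u1 0 t - u2 0 t) / 2 - a 0 t * r0 t * Iop u1 u2 t)"

definition Gop :: "real \<Rightarrow> (real \<Rightarrow> real \<Rightarrow> real) \<Rightarrow> (real \<Rightarrow> real) \<Rightarrow> (real \<Rightarrow> real \<Rightarrow> real) \<Rightarrow> (real \<Rightarrow> real \<Rightarrow> real) \<Rightarrow> real \<Rightarrow> real" where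
  "Gop T a r0 u1 u2 t = Iop u1 u2 t + Nop T a r0 u1 u2"

definition Fop :: "real \<Rightarrow> (real \<Rightarrow> real \<Rightarrow> real) \<Rightarrow> (real \<Rightarrow> real) \<Rightarrow> (real \<Rightarrow> real \<Rightarrow> real) \<Rightarrow> (real \<Rightarrow> real \<Rightarrow> real) \<Rightarrow> real \<Rightarrow> real \<Rightarrow> real" where
  "Fop T a r0 u1 u2 x t = Gop T a r0 u1 u2 t + Jop a u1 u2 x t"

definition weak_sys ::
  "real \<Rightarrow> (real \<Rightarrow> real \<Rightarrow> real) \<Rightarrow> (real \<Rightarrow> real \<Rightarrow> real) \<Rightarrow> (real \<Rightarrow> real \<Rightarrow> real)
   \<Rightarrow> (real \<Rightarrow> real \<Rightarrow> real) \<Rightarrow> (real \<Rightarrow> real \<Rightarrow> real) \<Rightarrow> (real \<Rightarrow> real) \<Rightarrow> (real \<Rightarrow> real)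
   \<Rightarrow> (real \<Rightarrow> real \<Rightarrow> real) \<Rightarrow> (real \<Rightarrow> real \<Rightarrow> real) \<Rightarrow> bool" where
  "weak_sys T a a1 a2 a3 f r0 r1 u1 u2 \<longleftrightarrow>
     CT 0 T u1 \<and> CT 0 T u2 \<and>
     (\<forall>x\<in>{0..1}. \<forall>t.
        u1 x t =
          cl a a1 a2 1 0 0 x t *
            (u2 0 (tau a 1 0 x t) + 2 * a 0 (tau a 1 0 x t) * r0 (tau a 1 0 x t)
                * Gop T a r0 u1 u2 (tau a 1 0 x t))
          - oint 0 x (\<lambda>\<xi>. dj a a1 a2 1 \<xi> x t * b12 a a1 a2 \<xi> (tau a 1 \<xi> x t)
                * u2 \<xi> (tau a 1 \<xi> x t))
          + oint 0 x (\<lambda>\<xi>. dj a a1 a2 1 \<xi> x t *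
                (f \<xi> (tau a 1 \<xi> x t) - a3 \<xi> (tau a 1 \<xi> x t)
                   * Fop T a r0 u1 u2 \<xi> (tau a 1 \<xi> x t)))
      \<and> u2 x t =
          cl a a1 a2 2 0 1 x t *
            (u1 1 (tau a 2 1 x t) - 2 * a 1 (tau a 2 1 x t) * r1 (tau a 2 1 x t)
                * Fop T a r0 u1 u2 1 (tau a 2 1 x t))
          - oint 1 x (\<lambda>\<xi>. dj a a1 a2 2 \<xi> x t * b21 a a1 a2 \<xi> (tau a 2 \<xi> x t)
                * u1 \<xi> (tau a 2 \<xi> x t))
          + oint 1 x (\<lambda>\<xi>. dj a a1 a2 2 \<xi> x t *
                (f \<xi> (tau a 2 \<xi> x t) - a3 \<xi> (tau a 2 \<xi> x t)
                   * Fop T a r0 u1 u2 \<xi> (tau a 2 \<xi> x t))))"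

definition wsol :: "real \<Rightarrow> (real \<Rightarrow> real \<Rightarrow> real) \<Rightarrow> (real \<Rightarrow> real) \<Rightarrow> (real \<Rightarrow> real \<Rightarrow> real) \<Rightarrow> (real \<Rightarrow> real \<Rightarrow> real) \<Rightarrow> real \<Rightarrow> real \<Rightarrow> real" where
  "wsol T a r0 u1 u2 x t = Iop u1 u2 t + Jop a u1 u2 x t + Nop T a r0 u1 u2"

end

theory Submission
  imports Defs
begin

text \<open>The component \<open>u\<^sub>j\<close> satisfies an ordinary differential equation along the
  characteristics \<open>dt/dx = (-1)\<^sup>j/a\<close>.  In the equation for \<open>u\<^sub>1\<close> the other component enters through
  its integral along a characteristic of the first family; since \<open>u\<^sub>2\<close> is differentiable along
  the second, transversal family, this integral is continuously differentiable in \<open>t\<close>.  Following a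
  wave once around the strip, \<open>\<phi> = u\<^sub>1(1,\<sqdot>)\<close> or \<open>\<phi> = u\<^sub>2(0,\<sqdot>)\<close> therefore solves
  \<open>\<phi> = \<kappa> (\<phi> \<circ> \<sigma>) + \<rho>\<close> with a circle diffeomorphism \<open>\<sigma>\<close> and continuously differentiable \<open>\<kappa>\<close> and \<open>\<rho>\<close>.
  Here \<open>\<kappa>\<close> is the product \<open>c\<^sub>1\<^sup>0 c\<^sub>2\<^sup>0\<close> of the hypotheses and \<open>\<kappa> \<sigma>'\<close> is \<open>c\<^sub>1\<^sup>1 c\<^sub>2\<^sup>1\<close>, so both
  the equation and its formal derivative are contracting, or both are expanding, and \<open>\<phi>\<close> is
  continuously differentiable.  The derivative \<open>\<partial>\<^sub>t u\<close> solves a system of the same form in which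
  \<open>c\<^sub>j\<^sup>l\<close> is replaced by \<open>c\<^sub>j\<^sup>l\<^sup>+\<^sup>1\<close>, which gives all further derivatives.  The nonlocal term \<open>Fu\<close>
  is always one derivative better than \<open>u\<close>: it is an integral in the direction of \<open>x\<close>, which is
  transversal to both families.  If \<open>a\<close> does not depend on \<open>t\<close>, then \<open>c\<^sub>j\<^sup>l = c\<^sub>j\<^sup>0\<close>, the logarithm of the
  product has a constant sign by continuity, and the second integral condition is the first
  one at a shifted time.\<close>

section \<open>Periodic functions on the strip\<close>

text \<open>The obstacle is that \<open>u1\<close> and \<open>u2\<close> are at first only
  continuous, so neither the first-order system nor its t-derivative can be written with partial
  derivatives. The system is therefore stated with \<open>Dir\<close>, the derivative along integral
  curves. Once a function also has a continuous t-derivative, the two together give total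
  differentiability and hence the derivative in any other direction; thus only t-derivatives have to
  be fought for. Three slope fields share one theory: the two characteristic families and the zero
  field, whose integral curves are the lines t = const. The gain for the nonlocal term is then
  literally the lemma that handles the coupling of \<open>u1\<close> and \<open>u2\<close>. All
  integrals start at x = 0, also for the second family, whose data come from x = 1; this is why
  inverse boundary maps occur. Two inductions are nested: at each order the nonlocal terms are
  frozen as data of a local boundary problem, and the regularity of that problem is an induction of
  its own.\<close>

lemma continuous_on_strip_compose:
  assumes "Ck 0 g" "continuous_on A p" "continuous_on A q" "\<And>z. z \<in> A \<Longrightarrow> p z \<in> {0..1}"
  shows "continuous_on A (\<lambda>z. g (p z) (q z))"
proof -
  have "continuous_on A (\<lambda>z. (p z, q z))" by (intro continuous_intros assms)
  moreover have "(\<lambda>z. (p z, q z)) ` A \<subseteq> strip" using assms(4) by (auto simp: strip_def)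
  ultimately show ?thesis
    using continuous_on_compose2[of strip "\<lambda>z. g (fst z) (snd z)" A "\<lambda>z. (p z, q z)"] assms(1)
    by simp
qed

lemma CT0_iff: "CT 0 T g \<longleftrightarrow> periodicT T g \<and> continuous_on strip (\<lambda>z. g (fst z) (snd z))"
  by (simp add: CT_def)

lemma CT0_continuous: "CT 0 T g \<Longrightarrow> continuous_on strip (\<lambda>z. g (fst z) (snd z))"
  by (simp add: CT_def)

lemma CT0_periodic: "CT 0 T g \<Longrightarrow> x \<in> {0..1} \<Longrightarrow> g x (t + T) = g x t"
  by (auto simp: CT_def periodicT_def)

lemma CT0_compose:
  "CT 0 T g \<Longrightarrow> continuous_on A p \<Longrightarrow> continuous_on A q \<Longrightarrow> (\<And>z. z \<in> A \<Longrightarrow> p z \<in> {0..1})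
    \<Longrightarrow> continuous_on A (\<lambda>z. g (p z) (q z))"
  by (rule continuous_on_strip_compose) (auto simp: CT_def)

lemma CT0I:
  assumes "\<And>x t. x \<in> {0..1} \<Longrightarrow> g x (t + T) = g x t"
    and "continuous_on strip (\<lambda>z. g (fst z) (snd z))"
  shows "CT 0 T g"
  using assms by (auto simp: CT_def periodicT_def)

lemma CT0_const: "CT 0 T (\<lambda>x t. c)"
  by (auto simp: CT0_iff periodicT_def)

lemma CT0_add: "CT 0 T g \<Longrightarrow> CT 0 T h \<Longrightarrow> CT 0 T (\<lambda>x t. g x t + h x t)"
  by (rule CT0I, simp add: CT0_periodic, intro continuous_intros CT0_continuous; assumption)

lemma CT0_diff: "CT 0 T g \<Longrightarrow> CT 0 T h \<Longrightarrow> CT 0 T (\<lambda>x t. g x t - h x t)"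
  by (rule CT0I, simp add: CT0_periodic, intro continuous_intros CT0_continuous; assumption)

lemma CT0_mult: "CT 0 T g \<Longrightarrow> CT 0 T h \<Longrightarrow> CT 0 T (\<lambda>x t. g x t * h x t)"
  by (rule CT0I, simp add: CT0_periodic, intro continuous_intros CT0_continuous; assumption)

lemma CT0_minus: "CT 0 T g \<Longrightarrow> CT 0 T (\<lambda>x t. - g x t)"
  by (rule CT0I, simp add: CT0_periodic, intro continuous_intros CT0_continuous; assumption)

lemma CT0_exp: "CT 0 T g \<Longrightarrow> CT 0 T (\<lambda>x t. exp (g x t))"
  by (rule CT0I, simp add: CT0_periodic, intro continuous_intros CT0_continuous; assumption)

lemma CT0_divide:
  "CT 0 T g \<Longrightarrow> CT 0 T h \<Longrightarrow> (\<And>x t. x \<in> {0..1} \<Longrightarrow> h x t \<noteq> 0) \<Longrightarrow> CT 0 T (\<lambda>x t. g x t / h x t)"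
  by (rule CT0I, simp add: CT0_periodic, intro continuous_on_divide CT0_continuous)
    (auto simp: strip_def)

lemmas CT0_intros = CT0_const CT0_add CT0_diff CT0_mult CT0_minus CT0_exp CT0_divide

lemma CT0_cong:
  assumes "CT 0 T g" "\<And>x t. x \<in> {0..1} \<Longrightarrow> h x t = g x t"
  shows "CT 0 T h"
proof -
  have "continuous_on strip (\<lambda>z. h (fst z) (snd z)) \<longleftrightarrow> continuous_on strip (\<lambda>z. g (fst z) (snd z))"
    by (rule continuous_on_cong) (auto simp: strip_def assms(2))
  then show ?thesis using assms by (auto simp: CT0_iff periodicT_def)
qed

lemma CT0_slice: "CT 0 T g \<Longrightarrow> x \<in> {0..1} \<Longrightarrow> continuous_on A (\<lambda>t. g x t)"
  by (rule CT0_compose) (auto intro: continuous_on_const continuous_on_id)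

text \<open>Boundary values are kept as functions on the strip that are constant in x, so that
  circle functions share the calculus of strip functions.\<close>

lemma CT0_trace: "CT 0 T g \<Longrightarrow> c \<in> {0..1} \<Longrightarrow> CT 0 T (\<lambda>x t. g c t)"
  by (rule CT0I, simp add: CT0_periodic, rule CT0_compose)
    (auto intro: continuous_on_const continuous_on_snd continuous_on_id)

lemma periodic_of_int:
  fixes g :: "real \<Rightarrow> 'a"
  assumes "\<And>t. g (t + T) = g t"
  shows "g (t + of_int n * T) = g t"
proof -
  have *: "g (t + of_nat m * T) = g t" for m t
  proof (induction m)
    case (Suc m)
    have "g (t + of_nat (Suc m) * T) = g ((t + of_nat m * T) + T)" by (simp add: algebra_simps)
    also have "... = g (t + of_nat m * T)" by (rule assms)
    finally show ?case using Suc by simp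
  qed simp
  show ?thesis
  proof (cases "n \<ge> 0")
    case True
    then have "of_nat (nat n) = (of_int n :: real)" by simp
    then show ?thesis using *[of t "nat n"] by simp
  next
    case False
    then have "of_nat (nat (- n)) = - (of_int n :: real)" by simp
    then show ?thesis using *[of "t + of_int n * T" "nat (- n)"] by simp
  qed
qed

lemma shift_to_period:
  fixes T :: real assumes "T > 0"
  obtains n :: int where "t + of_int n * T \<in> {0..T}"
proof
  have "t / T - of_int \<lfloor>t / T\<rfloor> \<ge> 0" "t / T - of_int \<lfloor>t / T\<rfloor> \<le> 1" by linarith+
  then have "(t / T - of_int \<lfloor>t / T\<rfloor>) * T \<ge> 0" "(t / T - of_int \<lfloor>t / T\<rfloor>) * T \<le> 1 * T"
    using assms by (auto intro: mult_right_mono)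
  moreover have "(t / T - of_int \<lfloor>t / T\<rfloor>) * T = t + of_int (- \<lfloor>t / T\<rfloor>) * T"
    using assms by (simp add: field_simps)
  ultimately show "t + of_int (- \<lfloor>t / T\<rfloor>) * T \<in> {0..T}" by simp
qed

lemma CT0_bounded:
  assumes "T > 0" "CT 0 T g"
  obtains M where "M \<ge> 0" "\<And>x t. x \<in> {0..1} \<Longrightarrow> \<bar>g x t\<bar> \<le> M"
proof -
  have "continuous_on ({0..1} \<times> {0..T}) (\<lambda>z. g (fst z) (snd z))"
    using CT0_continuous[OF assms(2)] by (rule continuous_on_subset) (auto simp: strip_def)
  then have "compact ((\<lambda>z. g (fst z) (snd z)) ` ({0..1} \<times> {0..T}))"
    by (intro compact_continuous_image compact_Times) auto
  then obtain M where M: "\<And>z. z \<in> {0..1} \<times> {0..T} \<Longrightarrow> \<bar>g (fst z) (snd z)\<bar> \<le> M"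
    by (meson bounded_real compact_imp_bounded image_eqI)
  have "\<bar>g x t\<bar> \<le> \<bar>M\<bar>" if "x \<in> {0..1}" for x t
  proof -
    obtain n where n: "t + of_int n * T \<in> {0..T}" using shift_to_period[OF assms(1)] .
    have "g x (t + of_int n * T) = g x t"
      by (rule periodic_of_int) (rule CT0_periodic[OF assms(2) that])
    then show ?thesis using M[of "(x, t + of_int n * T)"] n that by auto
  qed
  then show thesis using that[of "\<bar>M\<bar>"] by auto
qed

lemma CT0_uniformly_continuous:
  assumes "T > 0" "CT 0 T g" "e > 0"
  obtains d where "d > 0" "\<And>x t s. x \<in> {0..1} \<Longrightarrow> \<bar>s - t\<bar> < d \<Longrightarrow> \<bar>g x s - g x t\<bar> < e"
proof -
  \<comment> \<open>A margin of one unit on either side keeps both shifted times in the compact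
    rectangle, since \<open>\<bar>s - t\<bar> < 1\<close>.\<close>
  let ?K = "{0..1} \<times> {-1..T+1} :: (real \<times> real) set"
  have "continuous_on ?K (\<lambda>z. g (fst z) (snd z))"
    using CT0_continuous[OF assms(2)] by (rule continuous_on_subset) (auto simp: strip_def)
  then have "uniformly_continuous_on ?K (\<lambda>z. g (fst z) (snd z))"
    by (intro compact_uniformly_continuous compact_Times) auto
  then obtain d where d: "d > 0"
    "\<And>z w. z \<in> ?K \<Longrightarrow> w \<in> ?K \<Longrightarrow> dist w z < d \<Longrightarrow> dist (g (fst w) (snd w)) (g (fst z) (snd z)) < e"
    using \<open>e > 0\<close> unfolding uniformly_continuous_on_def by metis
  have "\<bar>g x s - g x t\<bar> < e" if x: "x \<in> {0..1}" and st: "\<bar>s - t\<bar> < min d 1" for x t s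
  proof -
    obtain n where n: "t + of_int n * T \<in> {0..T}" using shift_to_period[OF assms(1)] .
    have per: "g x (r + of_int n * T) = g x r" for r
      by (rule periodic_of_int) (rule CT0_periodic[OF assms(2) x])
    have "dist (x, s + of_int n * T) (x, t + of_int n * T) < d"
      using st by (simp add: dist_prod_def dist_real_def)
    moreover have "(x, t + of_int n * T) \<in> ?K" using n x by auto
    moreover have "(x, s + of_int n * T) \<in> ?K" using n x st by auto
    ultimately have "dist (g x (s + of_int n * T)) (g x (t + of_int n * T)) < e"
      using d(2)[of "(x, t + of_int n * T)" "(x, s + of_int n * T)"] by (simp only: fst_conv snd_conv)
    then show ?thesis by (simp add: per dist_real_def)
  qed
  then show thesis using that[of "min d 1"] d(1) by auto
qed

section \<open>Functions with a continuous t-derivative\<close>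

definition tC1 :: "real \<Rightarrow> (real \<Rightarrow> real \<Rightarrow> real) \<Rightarrow> bool" where
  "tC1 T g \<longleftrightarrow> CT 0 T g \<and> CT 0 T (dt g)
    \<and> (\<forall>x\<in>{0..1}. \<forall>t. ((\<lambda>s. g x s) has_real_derivative dt g x t) (at t))"

lemma tC1_CT0: "tC1 T g \<Longrightarrow> CT 0 T g" and tC1_CT0_dt: "tC1 T g \<Longrightarrow> CT 0 T (dt g)"
  and tC1_deriv: "tC1 T g \<Longrightarrow> x \<in> {0..1} \<Longrightarrow> ((\<lambda>s. g x s) has_real_derivative dt g x t) (at t)"
  by (auto simp: tC1_def)

lemma tC1I:
  assumes "CT 0 T g" "CT 0 T g'"
    and "\<And>x t. x \<in> {0..1} \<Longrightarrow> ((\<lambda>s. g x s) has_real_derivative g' x t) (at t)"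
  shows "tC1 T g" and "x \<in> {0..1} \<Longrightarrow> dt g x t = g' x t"
proof -
  have *: "dt g x t = g' x t" if "x \<in> {0..1}" for x t
    unfolding dt_def by (rule DERIV_imp_deriv) (rule assms(3)[OF that])
  show "tC1 T g" unfolding tC1_def
    using assms * CT0_cong[OF assms(2), of "dt g"] by auto
  show "dt g x t = g' x t" if "x \<in> {0..1}" using * that .
qed

lemma tC1_cong:
  assumes "tC1 T g" "\<And>x t. x \<in> {0..1} \<Longrightarrow> h x t = g x t"
  shows "tC1 T h" and "x \<in> {0..1} \<Longrightarrow> dt h x t = dt g x t"
proof -
  have *: "((\<lambda>s. h x s) has_real_derivative dt g x t) (at t)" if "x \<in> {0..1}" for x t
  proof -
    have "h x = g x" using assms(2)[OF that] by auto
    then show ?thesis using tC1_deriv[OF assms(1) that] by simp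
  qed
  note r = tC1I[OF CT0_cong[OF tC1_CT0[OF assms(1)] assms(2)] tC1_CT0_dt[OF assms(1)] *]
  show "tC1 T h" by (rule r(1)) auto
  show "x \<in> {0..1} \<Longrightarrow> dt h x t = dt g x t" by (rule r(2)) auto
qed

lemma tC1_const: "tC1 T (\<lambda>x t. c)"
  by (rule tC1I[where g' = "\<lambda>_ _. 0"]) (auto intro: CT0_intros)

lemma tC1_add:
  assumes "tC1 T g" "tC1 T h"
  shows "tC1 T (\<lambda>x t. g x t + h x t)"
    and "x \<in> {0..1} \<Longrightarrow> dt (\<lambda>x t. g x t + h x t) x t = dt g x t + dt h x t"
proof -
  note r = tC1I[where g = "\<lambda>x t. g x t + h x t" and g' = "\<lambda>x t. dt g x t + dt h x t" and T = T]
  have d: "((\<lambda>s. g x s + h x s) has_real_derivative dt g x t + dt h x t) (at t)"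
    if "x \<in> {0..1}" for x t
    using that assms by (auto intro!: derivative_intros tC1_deriv)
  show "tC1 T (\<lambda>x t. g x t + h x t)"
    by (rule r(1)[OF _ _ d]) (intro CT0_intros tC1_CT0[OF assms(1)] tC1_CT0[OF assms(2)]
        tC1_CT0_dt[OF assms(1)] tC1_CT0_dt[OF assms(2)])+
  show "dt (\<lambda>x t. g x t + h x t) x t = dt g x t + dt h x t" if "x \<in> {0..1}"
    using that unfolding dt_def by (intro DERIV_imp_deriv d[unfolded dt_def])
qed

lemma tC1_mult:
  assumes "tC1 T g" "tC1 T h"
  shows "tC1 T (\<lambda>x t. g x t * h x t)"
    and "x \<in> {0..1} \<Longrightarrow> dt (\<lambda>x t. g x t * h x t) x t = dt g x t * h x t + g x t * dt h x t"
proof -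
  have d: "((\<lambda>s. g x s * h x s) has_real_derivative dt g x t * h x t + g x t * dt h x t) (at t)"
    if "x \<in> {0..1}" for x t
    using that assms by (auto intro!: derivative_eq_intros tC1_deriv)
  show "tC1 T (\<lambda>x t. g x t * h x t)"
    by (rule tC1I(1)[OF _ _ d]) (intro CT0_intros tC1_CT0[OF assms(1)] tC1_CT0[OF assms(2)]
        tC1_CT0_dt[OF assms(1)] tC1_CT0_dt[OF assms(2)])+
  show "dt (\<lambda>x t. g x t * h x t) x t = dt g x t * h x t + g x t * dt h x t" if "x \<in> {0..1}"
    using that unfolding dt_def by (intro DERIV_imp_deriv d[unfolded dt_def])
qed

lemma tC1_cmult:
  assumes "tC1 T g"
  shows "tC1 T (\<lambda>x t. c * g x t)" and "x \<in> {0..1} \<Longrightarrow> dt (\<lambda>x t. c * g x t) x t = c * dt g x t"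
proof -
  have [simp]: "dt (\<lambda>x t. c) x t = 0" for x t by (simp add: dt_def)
  show "tC1 T (\<lambda>x t. c * g x t)" "x \<in> {0..1} \<Longrightarrow> dt (\<lambda>x t. c * g x t) x t = c * dt g x t"
    using tC1_mult[OF tC1_const[of T c] assms] by auto
qed

lemma tC1_exp:
  assumes "tC1 T g"
  shows "tC1 T (\<lambda>x t. exp (g x t))"
proof (rule tC1I(1))
  show "CT 0 T (\<lambda>x t. exp (g x t))" "CT 0 T (\<lambda>x t. exp (g x t) * dt g x t)"
    by (intro CT0_intros tC1_CT0[OF assms] tC1_CT0_dt[OF assms])+
  show "((\<lambda>s. exp (g x s)) has_real_derivative exp (g x t) * dt g x t) (at t)"
    if "x \<in> {0..1}" for x t
    using tC1_deriv[OF assms that] by (auto intro!: derivative_eq_intros)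
qed

lemma tC1_divide:
  assumes "tC1 T g" "tC1 T h" "\<And>x t. x \<in> {0..1} \<Longrightarrow> h x t \<noteq> 0"
  shows "tC1 T (\<lambda>x t. g x t / h x t)"
proof (rule tC1I(1))
  show "CT 0 T (\<lambda>x t. g x t / h x t)"
    "CT 0 T (\<lambda>x t. (dt g x t * h x t - g x t * dt h x t) / (h x t * h x t))"
    using assms(3) by (intro CT0_intros tC1_CT0[OF assms(1)] tC1_CT0[OF assms(2)]
        tC1_CT0_dt[OF assms(1)] tC1_CT0_dt[OF assms(2)]; simp)+
  show "((\<lambda>s. g x s / h x s) has_real_derivative
      (dt g x t * h x t - g x t * dt h x t) / (h x t * h x t)) (at t)"
    if "x \<in> {0..1}" for x t
    using tC1_deriv[OF assms(1) that] tC1_deriv[OF assms(2) that] assms(3)[OF that]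
    by (intro DERIV_divide)
qed

lemma tC1_trace:
  assumes "tC1 T g" "c \<in> {0..1}"
  shows "tC1 T (\<lambda>x t. g c t)"
  by (rule tC1I(1)[OF CT0_trace[OF tC1_CT0[OF assms(1)] assms(2)]
        CT0_trace[OF tC1_CT0_dt[OF assms(1)] assms(2)] tC1_deriv[OF assms]])

section \<open>Integral curves of a time-periodic slope field\<close>

definition sol :: "(real \<Rightarrow> real \<Rightarrow> real) \<Rightarrow> (real \<Rightarrow> real) \<Rightarrow> bool" where
  "sol b \<tau> \<longleftrightarrow> (\<forall>x\<in>{0..1}. (\<tau> has_real_derivative b x (\<tau> x)) (at x within {0..1}))"

text \<open>Literally the form of \<open>tau\<close>, for a general slope, so that
  \<open>tau_eq_fl\<close> is plain unfolding. The zero slope is covered as well.\<close>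

definition fl :: "(real \<Rightarrow> real \<Rightarrow> real) \<Rightarrow> real \<Rightarrow> real \<Rightarrow> real \<Rightarrow> real" where
  "fl b \<xi> x t = (THE s. \<exists>\<tau>. sol b \<tau> \<and> \<tau> x = t \<and> \<tau> \<xi> = s)"

lemma has_real_derivative_transform:
  assumes "x \<in> S" "\<And>y. y \<in> S \<Longrightarrow> g y = f y" "(f has_real_derivative D) (at x within S)"
  shows "(g has_real_derivative D) (at x within S)"
  using has_derivative_transform[OF assms(1,2)] assms(3) by (simp add: has_field_derivative_def)

lemma sol_continuous: "sol b \<tau> \<Longrightarrow> continuous_on {0..1} \<tau>"
  unfolding sol_def continuous_on_eq_continuous_within by (blast intro: DERIV_continuous)

text \<open>Multiplication by the integrating factor \<open>exp (- E x)\<close> leaves a function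
  with zero derivative on \<open>{0..1}\<close>.\<close>

lemma linear_ode_solution:
  fixes D B :: "real \<Rightarrow> real"
  assumes "\<And>x. x \<in> {0..1} \<Longrightarrow> (D has_real_derivative B x * D x) (at x within {0..1})"
    and B: "continuous_on {0..1} B" and x: "x \<in> {0..1}"
  shows "D x = D 0 * exp (integral {0..x} B)"
proof -
  define E where "E = (\<lambda>x. integral {0..x} B)"
  have E: "(E has_real_derivative B x) (at x within {0..1})" if "x \<in> {0..1}" for x
    unfolding E_def by (rule integral_has_real_derivative[OF B that])
  have "((\<lambda>x. D x * exp (- E x)) has_real_derivative 0) (at x within {0..1})" if "x \<in> {0..1}" for x
  proof -
    have "((\<lambda>x. exp (- E x)) has_real_derivative exp (- E x) * - B x) (at x within {0..1})"
      using DERIV_chain'[OF DERIV_minus[OF E[OF that]] DERIV_exp] by (simp add: mult.commute)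
    from DERIV_mult[OF assms(1)[OF that] this] show ?thesis by (simp add: algebra_simps)
  qed
  then have "\<exists>c. \<forall>x\<in>{0..1}. D x * exp (- E x) = c"
    by (intro has_field_derivative_zero_constant) auto
  then have "D x * exp (- E x) = D 0 * exp (- E 0)" using x by auto
  moreover have "E 0 = 0" by (simp add: E_def)
  ultimately show ?thesis by (simp add: E_def exp_minus field_simps)
qed

text \<open>The divided difference of \<open>b x\<close> between \<open>s\<close> and
  \<open>s'\<close>, written as a mean of the t-derivative so that it is continuous also where
  \<open>s = s'\<close>.\<close>

definition quot :: "(real \<Rightarrow> real \<Rightarrow> real) \<Rightarrow> real \<Rightarrow> real \<Rightarrow> real \<Rightarrow> real" where
  "quot b x s s' = integral {0..1} (\<lambda>r. dt b x (s + r * (s' - s)))"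

lemma integral_exp_affine_le:
  fixes L M x :: real
  assumes "L > 0" "x \<ge> 0"
  shows "integral {0..x} (\<lambda>\<eta>. c * exp (2 * L * \<eta>)) = c * (exp (2 * L * x) - 1) / (2 * L)"
proof -
  have "((\<lambda>\<eta>. c * exp (2 * L * \<eta>)) has_integral
      (c * exp (2 * L * x) / (2 * L) - c * exp (2 * L * 0) / (2 * L))) {0..x}"
  proof (rule fundamental_theorem_of_calculus[OF assms(2)])
    fix y
    have "((\<lambda>\<eta>. c * exp (2 * L * \<eta>) / (2 * L)) has_real_derivative c * exp (2 * L * y)) (at y within {0..x})"
      using assms by (auto intro!: derivative_eq_intros)
    then show "((\<lambda>\<eta>. c * exp (2 * L * \<eta>) / (2 * L)) has_vector_derivative c * exp (2 * L * y)) (at y within {0..x})"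
      by (simp add: has_real_derivative_iff_has_vector_derivative)
  qed
  then show ?thesis using assms by (auto simp: has_integral_iff field_simps)
qed

section \<open>Comparison of integral curves\<close>

locale slope_field =
  fixes T :: real and b :: "real \<Rightarrow> real \<Rightarrow> real"
  assumes T_pos: "T > 0" and b_tC1: "tC1 T b"
begin

lemmas b_CT0 = tC1_CT0[OF b_tC1] and bt_CT0 = tC1_CT0_dt[OF b_tC1] and b_deriv = tC1_deriv[OF b_tC1]

lemma quot_eq:
  assumes "x \<in> {0..1}"
  shows "quot b x s s' * (s' - s) = b x s' - b x s"
proof -
  have "((\<lambda>r. dt b x (s + r * (s' - s)) * (s' - s)) has_integral
      b x (s + 1 * (s' - s)) - b x (s + 0 * (s' - s))) {0..1}"
  proof (rule fundamental_theorem_of_calculus)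
    fix r :: real
    have "((\<lambda>r. b x (s + r * (s' - s))) has_real_derivative dt b x (s + r * (s' - s)) * (s' - s))
        (at r within {0..1})"
      by (rule DERIV_chain2[OF b_deriv[OF assms]]) (auto intro!: derivative_eq_intros)
    then show "((\<lambda>r. b x (s + r * (s' - s))) has_vector_derivative dt b x (s + r * (s' - s)) * (s' - s))
        (at r within {0..1})"
      by (simp add: has_real_derivative_iff_has_vector_derivative)
  qed simp
  then have "integral {0..1} (\<lambda>r. dt b x (s + r * (s' - s)) * (s' - s)) = b x s' - b x s"
    by (auto simp: has_integral_iff)
  then show ?thesis by (simp add: quot_def)
qed

lemma quot_continuous:
  fixes p q r :: "'a::topological_space \<Rightarrow> real"
  assumes "continuous_on U p" "continuous_on U q" "continuous_on U r" "\<And>u. u \<in> U \<Longrightarrow> p u \<in> {0..1}"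
  shows "continuous_on U (\<lambda>u. quot b (p u) (q u) (r u))"
proof -
  have "continuous_on (U \<times> {0..1}) (\<lambda>z. dt b (p (fst z)) (q (fst z) + snd z * (r (fst z) - q (fst z))))"
    using assms
    by (intro CT0_compose[OF bt_CT0] continuous_intros continuous_on_compose2[OF assms(1)]
        continuous_on_compose2[OF assms(2)] continuous_on_compose2[OF assms(3)]) auto
  then have "continuous_on (U \<times> cbox 0 1) (\<lambda>(u, y). dt b (p u) (q u + y * (r u - q u)))"
    by (simp add: case_prod_unfold)
  from integral_continuous_on_param[OF this] show ?thesis by (simp add: quot_def)
qed

lemma quot_same: "quot b x s s = dt b x s"
  by (simp add: quot_def)

text \<open>By \<open>quot_eq\<close> the difference of two solutions solves a linear equation with
  coefficient \<open>quot\<close>. The resulting exact formula yields uniqueness, Lipschitz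
  dependence on the data and, in \<open>fl_deriv\<close>, differentiability in the initial
  time.\<close>

lemma sol_difference:
  assumes "sol b \<tau>" "sol b \<sigma>" "\<xi> \<in> {0..1}"
  shows "\<sigma> \<xi> - \<tau> \<xi> = (\<sigma> 0 - \<tau> 0) * exp (integral {0..\<xi>} (\<lambda>\<eta>. quot b \<eta> (\<tau> \<eta>) (\<sigma> \<eta>)))"
proof (rule linear_ode_solution[where D = "\<lambda>\<xi>. \<sigma> \<xi> - \<tau> \<xi>"])
  show "continuous_on {0..1} (\<lambda>\<eta>. quot b \<eta> (\<tau> \<eta>) (\<sigma> \<eta>))"
    using assms by (intro quot_continuous) (auto intro: sol_continuous)
  show "((\<lambda>\<xi>. \<sigma> \<xi> - \<tau> \<xi>) has_real_derivative quot b x (\<tau> x) (\<sigma> x) * (\<sigma> x - \<tau> x)) (at x within {0..1})"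
    if "x \<in> {0..1}" for x
    using assms that unfolding quot_eq[OF that] sol_def by (intro derivative_intros) auto
qed fact

lemma sol_difference':
  assumes "sol b \<tau>" "sol b \<sigma>" "\<xi> \<in> {0..1}" "x \<in> {0..1}"
  shows "\<sigma> \<xi> - \<tau> \<xi> = (\<sigma> x - \<tau> x) * exp (integral {0..\<xi>} (\<lambda>\<eta>. quot b \<eta> (\<tau> \<eta>) (\<sigma> \<eta>))
    - integral {0..x} (\<lambda>\<eta>. quot b \<eta> (\<tau> \<eta>) (\<sigma> \<eta>)))"
  unfolding sol_difference[OF assms(1-3)] sol_difference[OF assms(1,2,4)]
  by (simp add: exp_diff)

lemma sol_unique:
  assumes "sol b \<tau>" "sol b \<sigma>" "x \<in> {0..1}" "\<tau> x = \<sigma> x" "\<xi> \<in> {0..1}"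
  shows "\<tau> \<xi> = \<sigma> \<xi>"
  using sol_difference'[OF assms(1,2,5,3)] assms(4) by simp

definition "Mb = (SOME M. M \<ge> 0 \<and> (\<forall>x\<in>{0..1}. \<forall>t. \<bar>b x t\<bar> \<le> M))"
text \<open>Chosen strictly positive because the weight and the tolerances of the Picard iteration
  divide by it.\<close>

definition "Lb = (SOME M. M > 0 \<and> (\<forall>x\<in>{0..1}. \<forall>t. \<bar>dt b x t\<bar> \<le> M))"

lemma Mb: "Mb \<ge> 0" "x \<in> {0..1} \<Longrightarrow> \<bar>b x t\<bar> \<le> Mb"
proof -
  have "\<exists>M. M \<ge> 0 \<and> (\<forall>x\<in>{0..1}. \<forall>t. \<bar>b x t\<bar> \<le> M)" using CT0_bounded[OF T_pos b_CT0] by metis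
  from someI_ex[OF this] show "Mb \<ge> 0" "x \<in> {0..1} \<Longrightarrow> \<bar>b x t\<bar> \<le> Mb" unfolding Mb_def by blast+
qed

lemma Lb: "Lb > 0" "x \<in> {0..1} \<Longrightarrow> \<bar>dt b x t\<bar> \<le> Lb"
proof -
  obtain M where "M \<ge> 0" "\<And>x t. x \<in> {0..1} \<Longrightarrow> \<bar>dt b x t\<bar> \<le> M"
    using CT0_bounded[OF T_pos bt_CT0] by metis
  then have "M + 1 > 0 \<and> (\<forall>x\<in>{0..1}. \<forall>t. \<bar>dt b x t\<bar> \<le> M + 1)"
    by (intro conjI ballI allI order_trans[of "\<bar>dt b x t\<bar>" M "M + 1" for x t]) auto
  from someI[of "\<lambda>M. M > 0 \<and> (\<forall>x\<in>{0..1}. \<forall>t. \<bar>dt b x t\<bar> \<le> M)", OF this]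
  show "Lb > 0" "x \<in> {0..1} \<Longrightarrow> \<bar>dt b x t\<bar> \<le> Lb" unfolding Lb_def by blast+
qed

lemma quot_bound:
  assumes "x \<in> {0..1}" shows "\<bar>quot b x s s'\<bar> \<le> Lb"
proof -
  have "norm (integral {0..1} (\<lambda>r. dt b x (s + r * (s' - s)))) \<le> Lb * (1 - 0)"
    using Lb(2)[OF assms] CT0_slice[OF bt_CT0 assms, of UNIV]
    by (intro integral_bound continuous_on_compose2[OF CT0_slice[OF bt_CT0 assms, of UNIV]])
      (auto intro!: continuous_intros)
  then show ?thesis by (simp add: quot_def)
qed

lemma b_lipschitz: "x \<in> {0..1} \<Longrightarrow> \<bar>b x s' - b x s\<bar> \<le> Lb * \<bar>s' - s\<bar>"
  unfolding quot_eq[symmetric] abs_mult by (intro mult_right_mono quot_bound) auto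

lemma b_compose_continuous:
  assumes "continuous_on A Y" "A \<subseteq> {0..1}" shows "continuous_on A (\<lambda>\<eta>. b \<eta> (Y \<eta>))"
  using assms by (intro CT0_compose[OF b_CT0]) (auto intro: continuous_on_id)

section \<open>Existence of integral curves by Picard iteration\<close>

primrec picard :: "real \<Rightarrow> nat \<Rightarrow> real \<Rightarrow> real" where
  "picard s 0 x = s"
| "picard s (Suc n) x = s + integral {0..x} (\<lambda>\<eta>. b \<eta> (picard s n \<eta>))"

lemma picard_continuous: "continuous_on {0..1} (picard s n)"
proof (induction n)
  case (Suc n)
  have "continuous_on {0..1} (\<lambda>x. integral {0..x} (\<lambda>\<eta>. b \<eta> (picard s n \<eta>)))"
    using b_compose_continuous[OF Suc]
    by (intro indefinite_integral_continuous_1 integrable_continuous_real) auto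
  then show ?case by (auto intro!: continuous_intros)
qed (auto intro: continuous_on_const)

lemma b_integrable:
  assumes "continuous_on {0..1} Y" "x \<in> {0..1}" shows "(\<lambda>\<eta>. b \<eta> (Y \<eta>)) integrable_on {0..x}"
  using assms by (intro integrable_continuous_real b_compose_continuous)
    (auto intro: continuous_on_subset)

lemma integral_b_diff_le:
  assumes Y: "continuous_on {0..1} Y" and Z: "continuous_on {0..1} Z" and x: "x \<in> {0..1}"
    and w: "continuous_on {0..1} w" "\<And>\<eta>. \<eta> \<in> {0..1} \<Longrightarrow> \<bar>Y \<eta> - Z \<eta>\<bar> \<le> w \<eta>"
  shows "\<bar>integral {0..x} (\<lambda>\<eta>. b \<eta> (Y \<eta>)) - integral {0..x} (\<lambda>\<eta>. b \<eta> (Z \<eta>))\<bar>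
    \<le> integral {0..x} (\<lambda>\<eta>. Lb * w \<eta>)"
proof -
  have "integral {0..x} (\<lambda>\<eta>. b \<eta> (Y \<eta>)) - integral {0..x} (\<lambda>\<eta>. b \<eta> (Z \<eta>))
      = integral {0..x} (\<lambda>\<eta>. b \<eta> (Y \<eta>) - b \<eta> (Z \<eta>))"
    using b_integrable[OF Y x] b_integrable[OF Z x] by (simp add: Henstock_Kurzweil_Integration.integral_diff)
  moreover have "norm (integral {0..x} (\<lambda>\<eta>. b \<eta> (Y \<eta>) - b \<eta> (Z \<eta>))) \<le> integral {0..x} (\<lambda>\<eta>. Lb * w \<eta>)"
  proof (rule integral_norm_bound_integral)
    show "(\<lambda>\<eta>. b \<eta> (Y \<eta>) - b \<eta> (Z \<eta>)) integrable_on {0..x}"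
      by (intro integrable_diff b_integrable Y Z x)
    have "continuous_on {0..x} w" using w(1) by (rule continuous_on_subset) (use x in auto)
    then show "(\<lambda>\<eta>. Lb * w \<eta>) integrable_on {0..x}"
      by (intro integrable_continuous_real continuous_intros)
    fix \<eta> assume "\<eta> \<in> {0..x}"
    then have \<eta>: "\<eta> \<in> {0..1}" using x by auto
    have "\<bar>b \<eta> (Y \<eta>) - b \<eta> (Z \<eta>)\<bar> \<le> Lb * \<bar>Y \<eta> - Z \<eta>\<bar>" by (rule b_lipschitz[OF \<eta>])
    also have "... \<le> Lb * w \<eta>" using w(2)[OF \<eta>] Lb(1) by (intro mult_left_mono) auto
    finally show "norm (b \<eta> (Y \<eta>) - b \<eta> (Z \<eta>)) \<le> Lb * w \<eta>" by simp
  qed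
  ultimately show ?thesis by simp
qed

text \<open>With the weight \<open>exp (2 * Lb * x)\<close>, applying the Lipschitz bound
  \<open>Lb\<close> and integrating gains the factor 1/2, so the iteration converges on all of
  \<open>{0..1}\<close> at once.\<close>

lemma picard_step:
  assumes "x \<in> {0..1}"
  shows "\<bar>picard s (Suc n) x - picard s n x\<bar> \<le> Mb * (1/2)^n * exp (2 * Lb * x)"
  using assms
proof (induction n arbitrary: x)
  case 0
  have "continuous_on {0..x} (\<lambda>\<eta>. b \<eta> s)"
    by (rule b_compose_continuous) (use 0 in \<open>auto intro: continuous_on_const\<close>)
  then have "norm (integral {0..x} (\<lambda>\<eta>. b \<eta> s)) \<le> Mb * (x - 0)"
    by (rule integral_bound[rotated]) (use 0 Mb(2) in auto)
  also have "... \<le> Mb * 1" using 0 Mb(1) by (intro mult_left_mono) auto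
  also have "... \<le> Mb * exp (2 * Lb * x)" using 0 Mb(1) Lb(1) by (intro mult_left_mono) auto
  finally show ?case by simp
next
  case (Suc n)
  have w: "continuous_on {0..1} (\<lambda>\<eta>. Mb * (1/2)^n * exp (2 * Lb * \<eta>))"
    by (intro continuous_intros)
  have "\<bar>(s + integral {0..x} (\<lambda>\<eta>. b \<eta> (picard s (Suc n) \<eta>))) - (s + integral {0..x} (\<lambda>\<eta>. b \<eta> (picard s n \<eta>)))\<bar>
      \<le> integral {0..x} (\<lambda>\<eta>. Lb * (Mb * (1/2)^n * exp (2 * Lb * \<eta>)))"
    unfolding add_diff_cancel_left
    by (rule integral_b_diff_le[OF picard_continuous picard_continuous Suc.prems w Suc.IH])
  then have "\<bar>picard s (Suc (Suc n)) x - picard s (Suc n) x\<bar>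
      \<le> integral {0..x} (\<lambda>\<eta>. Lb * (Mb * (1/2)^n * exp (2 * Lb * \<eta>)))"
    unfolding picard.simps(2)[of s "Suc n" x] picard.simps(2)[of s n x] .
  also have "integral {0..x} (\<lambda>\<eta>. Lb * (Mb * (1/2)^n * exp (2 * Lb * \<eta>))) = Lb * Mb * (1/2)^n * (exp (2 * Lb * x) - 1) / (2 * Lb)"
    using integral_exp_affine_le[OF Lb(1), of x "Lb * Mb * (1/2)^n"] Suc.prems
    by (simp only: mult.assoc atLeastAtMost_iff simp_thms)
  also have "... = Mb * (1/2)^(Suc n) * (exp (2 * Lb * x) - 1)" using Lb(1) by (simp add: field_simps)
  also have "... \<le> Mb * (1/2)^(Suc n) * exp (2 * Lb * x)" using Mb(1) by (intro mult_left_mono) auto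
  finally show ?case .
qed

text \<open>The iterates are partial sums of their increments, which \<open>picard_step\<close>
  dominates by a geometric series; the Lipschitz bound carries the integral equation to the uniform
  limit.\<close>

lemma sol_exists_0: "\<exists>\<tau>. sol b \<tau> \<and> \<tau> 0 = s"
proof -
  define f where "f = (\<lambda>n x. picard s (Suc n) x - picard s n x)"
  define Y where "Y = (\<lambda>x. s + (\<Sum>n. f n x))"
  have "uniform_limit {0..1} (\<lambda>n x. \<Sum>i<n. f i x) (\<lambda>x. \<Sum>i. f i x) sequentially"
  proof (rule Weierstrass_m_test)
    show "norm (f n x) \<le> Mb * exp (2 * Lb) * (1/2)^n" if "x \<in> {0..1}" for n x
    proof -
      have "Mb * (1/2)^n * exp (2 * Lb * x) \<le> Mb * (1/2)^n * exp (2 * Lb)"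
        using that Mb(1) Lb(1) by (intro mult_left_mono) auto
      then show ?thesis using picard_step[OF that, of s n] by (simp add: f_def mult_ac)
    qed
    show "summable (\<lambda>n. Mb * exp (2 * Lb) * (1/2)^n)"
      by (intro summable_mult summable_geometric) auto
  qed
  moreover have "(\<Sum>i<n. f i x) = picard s n x - s" for n x
    unfolding f_def by (subst sum_lessThan_telescope) simp
  ultimately have "uniform_limit {0..1} (\<lambda>n x. s + (picard s n x - s)) Y sequentially"
    unfolding Y_def by (intro uniform_limit_intros) simp_all
  then have lim: "uniform_limit {0..1} (picard s) Y sequentially" by simp
  have Y: "continuous_on {0..1} Y"
    by (rule uniform_limit_theorem[OF _ lim]) (auto simp: picard_continuous)
  have eq: "Y x = s + integral {0..x} (\<lambda>\<eta>. b \<eta> (Y \<eta>))" if x: "x \<in> {0..1}" for x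
  proof (rule LIMSEQ_unique)
    show "(\<lambda>n. picard s (Suc n) x) \<longlonglongrightarrow> Y x"
      using tendsto_uniform_limitI[OF lim x] by (rule LIMSEQ_Suc)
    show "(\<lambda>n. picard s (Suc n) x) \<longlonglongrightarrow> s + integral {0..x} (\<lambda>\<eta>. b \<eta> (Y \<eta>))"
    proof (rule metric_LIMSEQ_I)
      fix e :: real assume "e > 0"
      then have "e / (2 * Lb) > 0" using Lb(1) by simp
      from uniform_limitD[OF lim this] obtain N where
        N: "\<And>n x. n \<ge> N \<Longrightarrow> x \<in> {0..1} \<Longrightarrow> dist (picard s n x) (Y x) < e / (2 * Lb)"
        unfolding eventually_sequentially by blast
      have "dist (picard s (Suc n) x) (s + integral {0..x} (\<lambda>\<eta>. b \<eta> (Y \<eta>))) < e" if "n \<ge> N" for n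
      proof -
        have "\<bar>integral {0..x} (\<lambda>\<eta>. b \<eta> (picard s n \<eta>)) - integral {0..x} (\<lambda>\<eta>. b \<eta> (Y \<eta>))\<bar>
            \<le> integral {0..x} (\<lambda>\<eta>. Lb * (e / (2 * Lb)))"
          using N[OF that] by (intro integral_b_diff_le picard_continuous Y x)
            (auto simp: dist_real_def intro: less_imp_le continuous_on_const)
        also have "... = x * (e / 2)" using Lb(1) x by simp
        also have "... \<le> 1 * (e / 2)" using x \<open>e > 0\<close> by (intro mult_right_mono) auto
        also have "... < e" using \<open>e > 0\<close> by simp
        finally show ?thesis by (simp add: dist_real_def)
      qed
      then show "\<exists>N. \<forall>n\<ge>N. dist (picard s (Suc n) x) (s + integral {0..x} (\<lambda>\<eta>. b \<eta> (Y \<eta>))) < e" by blast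
    qed
  qed
  have "sol b Y" unfolding sol_def
  proof
    fix x :: real assume x: "x \<in> {0..1}"
    have "((\<lambda>x. s + integral {0..x} (\<lambda>\<eta>. b \<eta> (Y \<eta>))) has_real_derivative 0 + b x (Y x)) (at x within {0..1})"
      by (intro derivative_intros integral_has_real_derivative b_compose_continuous Y x) auto
    then show "(Y has_real_derivative b x (Y x)) (at x within {0..1})"
      using has_real_derivative_transform[OF x eq] by simp
  qed
  moreover have "Y 0 = s" using eq[of 0] by simp
  ultimately show ?thesis by blast
qed

lemma sol_lipschitz:
  assumes "sol b \<tau>" "\<xi> \<in> {0..1}" "x \<in> {0..1}"
  shows "\<bar>\<tau> \<xi> - \<tau> x\<bar> \<le> Mb * \<bar>\<xi> - x\<bar>"
proof -
  have "norm (\<tau> \<xi> - \<tau> x) \<le> Mb * norm (\<xi> - x)"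
    by (rule field_differentiable_bound[where S = "{0..1}" and f' = "\<lambda>x. b x (\<tau> x)"])
      (use assms in \<open>auto simp: sol_def intro!: Mb(2)\<close>)
  then show ?thesis by simp
qed

text \<open>The exponent in \<open>sol_difference'\<close> is a difference of two integrals of
  \<open>quot\<close> over parts of \<open>{0..1}\<close>, each at most \<open>Lb\<close> in
  absolute value; hence the constant \<open>exp (2 * Lb)\<close>.\<close>

lemma sol_gronwall:
  assumes "sol b \<tau>" "sol b \<sigma>" "\<xi> \<in> {0..1}" "x \<in> {0..1}"
  shows "\<bar>\<sigma> \<xi> - \<tau> \<xi>\<bar> \<le> exp (2 * Lb) * \<bar>\<sigma> x - \<tau> x\<bar>"
proof -
  let ?q = "\<lambda>\<eta>. quot b \<eta> (\<tau> \<eta>) (\<sigma> \<eta>)"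
  have *: "\<bar>integral {0..y} ?q\<bar> \<le> Lb" if "y \<in> {0..1}" for y
  proof -
    have "continuous_on {0..1} ?q"
      by (rule quot_continuous) (auto intro: sol_continuous[OF assms(1)] sol_continuous[OF assms(2)] continuous_on_id)
    then have "continuous_on {0..y} ?q" by (rule continuous_on_subset) (use that in auto)
    then have "norm (integral {0..y} ?q) \<le> Lb * (y - 0)"
      using that by (intro integral_bound) (auto intro: quot_bound)
    also have "... \<le> Lb * 1" using that Lb(1) by (intro mult_left_mono) auto
    finally show ?thesis by simp
  qed
  have "exp (integral {0..\<xi>} ?q - integral {0..x} ?q) \<le> exp (2 * Lb)"
    using *[OF assms(3)] *[OF assms(4)] by (subst exp_le_cancel_iff) linarith
  then have "\<bar>\<sigma> x - \<tau> x\<bar> * exp (integral {0..\<xi>} ?q - integral {0..x} ?q) \<le> \<bar>\<sigma> x - \<tau> x\<bar> * exp (2 * Lb)"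
    by (intro mult_left_mono) auto
  then show ?thesis unfolding sol_difference'[OF assms] by (simp add: abs_mult mult.commute)
qed

text \<open>Solutions are known from x = 0 only. The value at \<open>x\<close> of the curve starting
  in \<open>s\<close> is continuous in \<open>s\<close> and differs from \<open>s\<close> by at most
  \<open>Mb\<close>, so the intermediate value theorem on \<open>{t - Mb..t + Mb}\<close> finds a
  curve through \<open>t\<close>.\<close>

lemma sol_exists:
  assumes x: "x \<in> {0..1}"
  obtains \<tau> where "sol b \<tau>" "\<tau> x = t"
proof -
  obtain X where X: "\<And>s. sol b (X s)" "\<And>s. X s 0 = s" using sol_exists_0 by metis
  have 0: "(0::real) \<in> {0..1}" by simp
  have "continuous_on {t - Mb..t + Mb} (\<lambda>s. X s x)"
  proof (rule continuous_on_subset[OF lipschitz_on_continuous_on])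
    show "(exp (2 * Lb))-lipschitz_on UNIV (\<lambda>s. X s x)"
      using sol_gronwall[OF X(1) X(1) x 0] by (intro lipschitz_onI) (auto simp: X dist_real_def)
  qed auto
  moreover have B: "\<bar>X s x - s\<bar> \<le> Mb" for s
  proof -
    have "\<bar>X s x - X s 0\<bar> \<le> Mb * \<bar>x - 0\<bar>" by (rule sol_lipschitz[OF X(1) x 0])
    also have "... \<le> Mb * 1" using x Mb(1) by (intro mult_left_mono) auto
    finally show ?thesis by (simp add: X)
  qed
  moreover have "X (t - Mb) x \<le> t" "t \<le> X (t + Mb) x" using B[of "t - Mb"] B[of "t + Mb"] by linarith+
  ultimately obtain s where "X s x = t"
    using IVT'[of "\<lambda>s. X s x" "t - Mb" t "t + Mb"] Mb(1) by auto
  then show thesis using that X(1) by blast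
qed

section \<open>The flow and its joint continuity\<close>

lemma fl_eq:
  assumes "sol b \<tau>" "x \<in> {0..1}" "\<xi> \<in> {0..1}"
  shows "fl b \<xi> x (\<tau> x) = \<tau> \<xi>"
  unfolding fl_def
proof (rule the_equality)
  show "\<exists>\<sigma>. sol b \<sigma> \<and> \<sigma> x = \<tau> x \<and> \<sigma> \<xi> = \<tau> \<xi>" using assms(1) by (intro exI[of _ \<tau>]) simp
  fix s assume "\<exists>\<sigma>. sol b \<sigma> \<and> \<sigma> x = \<tau> x \<and> \<sigma> \<xi> = s"
  then obtain \<sigma> where \<sigma>: "sol b \<sigma>" "\<sigma> x = \<tau> x" "\<sigma> \<xi> = s" by (elim exE conjE)
  show "s = \<tau> \<xi>" using sol_unique[OF \<sigma>(1) assms(1,2) \<sigma>(2) assms(3)] \<sigma>(3) by simp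
qed

lemma fl_sol:
  assumes "x \<in> {0..1}"
  shows "sol b (\<lambda>\<xi>. fl b \<xi> x t)"
proof -
  obtain \<tau> where \<tau>: "sol b \<tau>" "\<tau> x = t" using sol_exists[OF assms] .
  have "fl b \<xi> x t = \<tau> \<xi>" if "\<xi> \<in> {0..1}" for \<xi> using fl_eq[OF \<tau>(1) assms that] \<tau> by simp
  note eq = this
  show ?thesis unfolding sol_def
  proof
    fix y :: real assume y: "y \<in> {0..1}"
    have "(\<tau> has_real_derivative b y (\<tau> y)) (at y within {0..1})"
      using \<tau>(1) y unfolding sol_def by (rule bspec)
    from has_real_derivative_transform[OF y eq this]
    show "((\<lambda>\<xi>. fl b \<xi> x t) has_real_derivative b y (fl b y x t)) (at y within {0..1})"
      unfolding eq[OF y] .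
  qed
qed

lemma fl_same:
  assumes "x \<in> {0..1}" shows "fl b x x t = t"
proof -
  obtain \<tau> where "sol b \<tau>" "\<tau> x = t" using sol_exists[OF assms] .
  then show ?thesis using fl_eq[of \<tau> x x] assms by simp
qed

lemma fl_fl:
  assumes "x \<in> {0..1}" "y \<in> {0..1}" "\<xi> \<in> {0..1}"
  shows "fl b \<xi> y (fl b y x t) = fl b \<xi> x t"
  by (rule fl_eq[OF fl_sol[OF assms(1)] assms(2,3)])

lemma sol_shift: "sol b \<tau> \<Longrightarrow> sol b (\<lambda>\<xi>. \<tau> \<xi> + T)"
  unfolding sol_def using CT0_periodic[OF b_CT0] by (auto intro!: derivative_eq_intros)

lemma fl_shift:
  assumes "x \<in> {0..1}" "\<xi> \<in> {0..1}"
  shows "fl b \<xi> x (t + T) = fl b \<xi> x t + T"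
  using fl_eq[OF sol_shift[OF fl_sol[OF assms(1), of t]] assms] fl_same[OF assms(1)] by simp

lemma fl_lipschitz:
  assumes "x \<in> {0..1}" "\<xi> \<in> {0..1}" "x' \<in> {0..1}" "\<xi>' \<in> {0..1}"
  shows "\<bar>fl b \<xi>' x' t' - fl b \<xi> x t\<bar> \<le> Mb * \<bar>\<xi>' - \<xi>\<bar> + exp (2 * Lb) * (Mb * \<bar>x' - x\<bar> + \<bar>t' - t\<bar>)"
proof -
  have "\<bar>fl b \<xi>' x' t' - fl b \<xi> x' t'\<bar> \<le> Mb * \<bar>\<xi>' - \<xi>\<bar>"
    by (rule sol_lipschitz[OF fl_sol]) (use assms in auto)
  \<comment> \<open>A change of \<open>x\<close> is read as a change of curve: both curves are
    compared at the common abscissa \<open>x'\<close>.\<close>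
  moreover have "\<bar>fl b \<xi> x' t' - fl b \<xi> x t\<bar> \<le> exp (2 * Lb) * \<bar>fl b x' x' t' - fl b x' x t\<bar>"
    by (rule sol_gronwall[OF fl_sol fl_sol]) (use assms in auto)
  moreover have "exp (2 * Lb) * \<bar>fl b x' x' t' - fl b x' x t\<bar> \<le> exp (2 * Lb) * (Mb * \<bar>x' - x\<bar> + \<bar>t' - t\<bar>)"
  proof (rule mult_left_mono)
    have "\<bar>fl b x' x t - fl b x x t\<bar> \<le> Mb * \<bar>x' - x\<bar>" by (rule sol_lipschitz[OF fl_sol]) (use assms in auto)
    then show "\<bar>fl b x' x' t' - fl b x' x t\<bar> \<le> Mb * \<bar>x' - x\<bar> + \<bar>t' - t\<bar>"
      unfolding fl_same[OF assms(1)] fl_same[OF assms(3)] by linarith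
  qed simp
  ultimately show ?thesis by linarith
qed

lemma fl_continuous:
  fixes p q r :: "'a::topological_space \<Rightarrow> real"
  assumes "continuous_on A p" "continuous_on A q" "continuous_on A r"
    "\<And>z. z \<in> A \<Longrightarrow> p z \<in> {0..1}" "\<And>z. z \<in> A \<Longrightarrow> q z \<in> {0..1}"
  shows "continuous_on A (\<lambda>z. fl b (p z) (q z) (r z))"
  unfolding continuous_on_def
proof
  fix z assume z: "z \<in> A"
  have *: "(p \<longlongrightarrow> p z) (at z within A)" "(q \<longlongrightarrow> q z) (at z within A)" "(r \<longlongrightarrow> r z) (at z within A)"
    using assms(1-3) z by (auto simp: continuous_on_def)
  have "((\<lambda>w. fl b (p w) (q w) (r w) - fl b (p z) (q z) (r z)) \<longlongrightarrow> 0) (at z within A)"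
  proof (rule Lim_null_comparison)
    show "\<forall>\<^sub>F w in at z within A. norm (fl b (p w) (q w) (r w) - fl b (p z) (q z) (r z))
        \<le> Mb * \<bar>p w - p z\<bar> + exp (2 * Lb) * (Mb * \<bar>q w - q z\<bar> + \<bar>r w - r z\<bar>)"
      unfolding eventually_at_filter real_norm_def
      by (rule always_eventually) (use assms(4,5) z in \<open>blast intro: fl_lipschitz\<close>)
    have "((\<lambda>w. Mb * \<bar>p w - p z\<bar> + exp (2 * Lb) * (Mb * \<bar>q w - q z\<bar> + \<bar>r w - r z\<bar>)) \<longlongrightarrow>
        Mb * \<bar>p z - p z\<bar> + exp (2 * Lb) * (Mb * \<bar>q z - q z\<bar> + \<bar>r z - r z\<bar>)) (at z within A)"
      by (intro tendsto_intros *)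
    then show "((\<lambda>w. Mb * \<bar>p w - p z\<bar> + exp (2 * Lb) * (Mb * \<bar>q w - q z\<bar> + \<bar>r w - r z\<bar>)) \<longlongrightarrow> 0) (at z within A)"
      by simp
  qed
  then show "((\<lambda>w. fl b (p w) (q w) (r w)) \<longlongrightarrow> fl b (p z) (q z) (r z)) (at z within A)"
    by (simp add: LIM_zero_iff)
qed

end

text \<open>The substitution \<open>\<eta> = p z * r\<close> moves the variable limit into the
  integrand and leaves the fixed interval \<open>{0..1}\<close>, where integrals depending on a
  parameter are continuous.\<close>

lemma integral_upper_limit_continuous:
  fixes h :: "real \<Rightarrow> 'a::topological_space \<Rightarrow> real"
  assumes h: "continuous_on ({0..1} \<times> A) (\<lambda>(\<eta>, z). h \<eta> z)" and p: "continuous_on A p"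
    and p01: "\<And>z. z \<in> A \<Longrightarrow> p z \<in> {0..1}"
  shows "continuous_on A (\<lambda>z. integral {0..p z} (\<lambda>\<eta>. h \<eta> z))"
proof -
  have h': "continuous_on B (\<lambda>w. h (f w) (g w))"
    if "continuous_on B f" "continuous_on B g" "\<And>w. w \<in> B \<Longrightarrow> f w \<in> {0..1}" "\<And>w. w \<in> B \<Longrightarrow> g w \<in> A"
    for B :: "'b::topological_space set" and f g
  proof -
    have "(\<lambda>w. (f w, g w)) ` B \<subseteq> {0..1} \<times> A" using that(3,4) by auto
    from continuous_on_compose2[OF h continuous_on_Pair[OF that(1,2)] this] show ?thesis by simp
  qed
  have pr: "p z * r \<in> {0..1}" if "z \<in> A" "r \<in> {0..1}" for z r
    using p01[OF that(1)] that(2) mult_mono[of "p z" 1 r 1] by auto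
  have eq: "integral {0..p z} (\<lambda>\<eta>. h \<eta> z) = integral {0..1} (\<lambda>r. p z * h (p z * r) z)" if z: "z \<in> A" for z
  proof -
    have c: "continuous_on {0..1} (\<lambda>\<eta>. h \<eta> z)"
      using z by (intro h') (auto intro: continuous_on_id continuous_on_const)
    define H where "H = (\<lambda>y. integral {0..y} (\<lambda>\<eta>. h \<eta> z))"
    have "((\<lambda>r. p z * h (p z * r) z) has_integral H (p z * 1) - H (p z * 0)) {0..1}"
    proof (rule fundamental_theorem_of_calculus)
      fix r :: real assume r: "r \<in> {0..1}"
      have "(H has_real_derivative h (p z * r) z) (at (p z * r) within {0..1})"
        unfolding H_def by (rule integral_has_real_derivative[OF c pr[OF z r]])
      then have "(H has_real_derivative h (p z * r) z) (at (p z * r) within (\<lambda>r. p z * r) ` {0..1})"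
        by (rule DERIV_subset) (use pr[OF z] in auto)
      then have "((H \<circ> (\<lambda>r. p z * r)) has_real_derivative h (p z * r) z * p z) (at r within {0..1})"
        by (rule DERIV_image_chain) (auto intro!: derivative_eq_intros)
      then show "((\<lambda>r. H (p z * r)) has_vector_derivative p z * h (p z * r) z) (at r within {0..1})"
        by (simp add: has_real_derivative_iff_has_vector_derivative o_def mult.commute)
    qed simp
    then show ?thesis by (simp add: H_def has_integral_iff)
  qed
  have "continuous_on (A \<times> cbox 0 1) (\<lambda>(z, r). p z * h (p z * r) z)"
    unfolding case_prod_unfold using pr
    by (intro continuous_intros h' continuous_on_compose2[OF p continuous_on_fst]) auto
  from integral_continuous_on_param[OF this]
  have "continuous_on A (\<lambda>z. integral {0..1} (\<lambda>r. p z * h (p z * r) z))" by simp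
  then show ?thesis by (subst continuous_on_cong[OF refl eq])
qed

section \<open>Integrals and derivatives along integral curves\<close>

definition along :: "(real \<Rightarrow> real \<Rightarrow> real) \<Rightarrow> (real \<Rightarrow> real \<Rightarrow> real) \<Rightarrow> real \<Rightarrow> real \<Rightarrow> real" where
  "along b g x t = integral {0..x} (\<lambda>\<eta>. g \<eta> (fl b \<eta> x t))"

text \<open>The derivative of the flow from 0 to \<open>x\<close> with respect to the initial time,
  expressed by the end point \<open>(x, t)\<close>; its reciprocal is the t-derivative of
  \<open>fl b 0 x t\<close>.\<close>

definition rho :: "(real \<Rightarrow> real \<Rightarrow> real) \<Rightarrow> real \<Rightarrow> real \<Rightarrow> real" where
  "rho b x t = exp (along b (dt b) x t)"

text \<open>For differentiable \<open>u\<close> this means \<open>m = ux + b * ut\<close>; the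
  formulation by curves makes sense for functions without partial derivatives too.\<close>

definition Dir :: "(real \<Rightarrow> real \<Rightarrow> real) \<Rightarrow> (real \<Rightarrow> real \<Rightarrow> real) \<Rightarrow> (real \<Rightarrow> real \<Rightarrow> real) \<Rightarrow> bool" where
  "Dir b u m \<longleftrightarrow> (\<forall>\<tau>. sol b \<tau> \<longrightarrow>
     (\<forall>x\<in>{0..1}. ((\<lambda>\<xi>. u \<xi> (\<tau> \<xi>)) has_real_derivative m x (\<tau> x)) (at x within {0..1})))"

lemma DirD: "Dir b u m \<Longrightarrow> sol b \<tau> \<Longrightarrow> x \<in> {0..1}
    \<Longrightarrow> ((\<lambda>\<xi>. u \<xi> (\<tau> \<xi>)) has_real_derivative m x (\<tau> x)) (at x within {0..1})"
  by (auto simp: Dir_def)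

lemma DirI: "(\<And>\<tau> x. sol b \<tau> \<Longrightarrow> x \<in> {0..1}
    \<Longrightarrow> ((\<lambda>\<xi>. u \<xi> (\<tau> \<xi>)) has_real_derivative m x (\<tau> x)) (at x within {0..1})) \<Longrightarrow> Dir b u m"
  by (auto simp: Dir_def)

lemma Dir_cong:
  assumes "Dir b u m" "\<And>x t. x \<in> {0..1} \<Longrightarrow> u' x t = u x t" "\<And>x t. x \<in> {0..1} \<Longrightarrow> m' x t = m x t"
  shows "Dir b u' m'"
proof (rule DirI)
  fix \<tau> x assume *: "sol b \<tau>" "x \<in> {0..1::real}"
  show "((\<lambda>\<xi>. u' \<xi> (\<tau> \<xi>)) has_real_derivative m' x (\<tau> x)) (at x within {0..1})"
    unfolding assms(3)[OF *(2)]
    by (rule has_real_derivative_transform[OF *(2) _ DirD[OF assms(1) *]]) (rule assms(2))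
qed

lemma Dir_add: "Dir b u m \<Longrightarrow> Dir b v n \<Longrightarrow> Dir b (\<lambda>x t. u x t + v x t) (\<lambda>x t. m x t + n x t)"
  unfolding Dir_def by (auto intro!: derivative_intros)

lemma Dir_diff: "Dir b u m \<Longrightarrow> Dir b v n \<Longrightarrow> Dir b (\<lambda>x t. u x t - v x t) (\<lambda>x t. m x t - n x t)"
  unfolding Dir_def by (auto intro!: derivative_intros)

lemma Dir_mult:
  "Dir b u m \<Longrightarrow> Dir b v n \<Longrightarrow> Dir b (\<lambda>x t. u x t * v x t) (\<lambda>x t. m x t * v x t + u x t * n x t)"
  unfolding Dir_def by (auto intro!: derivative_eq_intros)

lemma Dir_cmult: "Dir b u m \<Longrightarrow> Dir b (\<lambda>x t. c * u x t) (\<lambda>x t. c * m x t)"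
  unfolding Dir_def by (auto intro!: derivative_eq_intros)

lemma Dir_exp: "Dir b u m \<Longrightarrow> Dir b (\<lambda>x t. exp (u x t)) (\<lambda>x t. exp (u x t) * m x t)"
  unfolding Dir_def by (auto intro!: derivative_eq_intros)

lemma Dir_divide:
  assumes "Dir b u m" "Dir b v n" "\<And>x t. x \<in> {0..1} \<Longrightarrow> v x t \<noteq> 0"
  shows "Dir b (\<lambda>x t. u x t / v x t) (\<lambda>x t. (m x t * v x t - u x t * n x t) / (v x t * v x t))"
  using assms unfolding Dir_def by (auto intro!: DERIV_divide)

section \<open>Dependence on the initial time\<close>

context slope_field begin

lemma quot_fl_integral_continuous:
  assumes x: "x \<in> {0..1}" and y: "y \<in> {0..1}"
  shows "continuous_on UNIV (\<lambda>t'. integral {0..y} (\<lambda>\<eta>. quot b \<eta> (fl b \<eta> x t) (fl b \<eta> x t')))"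
  using x y
  by (intro integral_upper_limit_continuous)
    (auto simp: case_prod_unfold intro!: quot_continuous fl_continuous continuous_on_fst
      continuous_on_snd continuous_on_const continuous_on_id)

text \<open>Caratheodory's form of differentiability: by \<open>sol_difference'\<close> the
  difference quotient is the continuous function \<open>g\<close>, and at \<open>t' = t\<close> the
  coefficient \<open>quot\<close> becomes \<open>dt b\<close>.\<close>

lemma fl_deriv:
  assumes x: "x \<in> {0..1}" and \<xi>: "\<xi> \<in> {0..1}"
  shows "((\<lambda>t. fl b \<xi> x t) has_real_derivative rho b \<xi> (fl b \<xi> x t) / rho b x t) (at t)"
proof -
  define g where "g = (\<lambda>t'. exp (integral {0..\<xi>} (\<lambda>\<eta>. quot b \<eta> (fl b \<eta> x t) (fl b \<eta> x t'))
    - integral {0..x} (\<lambda>\<eta>. quot b \<eta> (fl b \<eta> x t) (fl b \<eta> x t'))))"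
  have 1: "fl b \<xi> x t' - fl b \<xi> x t = g t' * (t' - t)" for t'
    using sol_difference'[OF fl_sol[OF x, of t] fl_sol[OF x, of t'] \<xi> x]
    by (simp add: g_def fl_same[OF x] mult.commute)
  have "continuous_on UNIV g"
    unfolding g_def using quot_fl_integral_continuous[OF x \<xi>] quot_fl_integral_continuous[OF x x]
    by (intro continuous_intros)
  then have 2: "isCont g t" by (simp add: continuous_on_eq_continuous_at)
  have "fl b \<eta> \<xi> (fl b \<xi> x t) = fl b \<eta> x t" if "\<eta> \<in> {0..\<xi>}" for \<eta>
    using that \<xi> x by (intro fl_fl) auto
  then have "integral {0..\<xi>} (\<lambda>\<eta>. dt b \<eta> (fl b \<eta> \<xi> (fl b \<xi> x t))) = integral {0..\<xi>} (\<lambda>\<eta>. dt b \<eta> (fl b \<eta> x t))"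
    by (intro Henstock_Kurzweil_Integration.integral_cong) simp
  then have 3: "g t = rho b \<xi> (fl b \<xi> x t) / rho b x t"
    by (simp add: g_def quot_same rho_def along_def exp_diff)
  show ?thesis unfolding CARAT_DERIV using 1 2 3 by blast
qed

lemma along_compose_continuous:
  assumes g: "CT 0 T g" and pq: "continuous_on A p" "continuous_on A q" "\<And>z. z \<in> A \<Longrightarrow> p z \<in> {0..1}"
  shows "continuous_on A (\<lambda>z. along b g (p z) (q z))"
  unfolding along_def
proof (rule integral_upper_limit_continuous)
  show "continuous_on ({0..1} \<times> A) (\<lambda>(\<eta>, z). g \<eta> (fl b \<eta> (p z) (q z)))"
    unfolding case_prod_unfold using pq(3)
    by (intro CT0_compose[OF g] fl_continuous continuous_on_compose2[OF pq(1) continuous_on_snd]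
        continuous_on_compose2[OF pq(2) continuous_on_snd]) (auto intro!: continuous_intros)
qed (use pq in auto)

lemma along_CT0:
  assumes g: "CT 0 T g"
  shows "CT 0 T (along b g)"
proof (rule CT0I)
  show "along b g x (t + T) = along b g x t" if "x \<in> {0..1}" for x t
    unfolding along_def using that
    by (intro Henstock_Kurzweil_Integration.integral_cong) (auto simp: fl_shift CT0_periodic[OF g])
  show "continuous_on strip (\<lambda>z. along b g (fst z) (snd z))"
    by (rule along_compose_continuous[OF g]) (auto simp: strip_def intro!: continuous_intros)
qed

lemma along_0 [simp]: "along b g 0 t = 0"
  by (simp add: along_def)

lemma along_curve:
  assumes "sol b \<tau>" "x \<in> {0..1}"
  shows "along b g x (\<tau> x) = integral {0..x} (\<lambda>\<eta>. g \<eta> (\<tau> \<eta>))"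
  unfolding along_def using assms
  by (intro Henstock_Kurzweil_Integration.integral_cong) (auto simp: fl_eq)

lemma curve_continuous: "CT 0 T g \<Longrightarrow> sol b \<tau> \<Longrightarrow> continuous_on {0..1} (\<lambda>\<eta>. g \<eta> (\<tau> \<eta>))"
  by (rule CT0_compose) (auto intro: sol_continuous continuous_on_id)

lemma Dir_along:
  assumes g: "CT 0 T g"
  shows "Dir b (along b g) g"
proof (rule DirI)
  fix \<tau> x assume *: "sol b \<tau>" "x \<in> {0..1::real}"
  show "((\<lambda>\<xi>. along b g \<xi> (\<tau> \<xi>)) has_real_derivative g x (\<tau> x)) (at x within {0..1})"
    by (rule has_real_derivative_transform[OF *(2) _
          integral_has_real_derivative[OF curve_continuous[OF g *(1)] *(2)]])
      (rule along_curve[OF *(1)])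
qed

text \<open>The difference is constant along each curve and vanishes at x = 0. Identities between
  integrals are proved below by this principle: compare derivatives along curves and traces at x =
  0.\<close>

lemma Dir_unique:
  assumes "Dir b u m" "Dir b v m" "\<And>t. u 0 t = v 0 t" "x \<in> {0..1}"
  shows "u x t = v x t"
proof -
  define D where "D = (\<lambda>\<xi>. u \<xi> (fl b \<xi> x t) - v \<xi> (fl b \<xi> x t))"
  have "(D has_real_derivative 0) (at \<xi> within {0..1})" if "\<xi> \<in> {0..1}" for \<xi>
    using DERIV_diff[OF DirD[OF assms(1) fl_sol[OF assms(4), of t] that]
        DirD[OF assms(2) fl_sol[OF assms(4), of t] that]]
    unfolding D_def by simp
  then have "\<exists>c. \<forall>\<xi>\<in>{0..1}. D \<xi> = c" by (intro has_field_derivative_zero_constant) auto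
  then have "D x = D 0" using assms(4) by auto
  then show ?thesis using assms(3,4) by (simp add: D_def fl_same)
qed

lemma Dir_const_along: "Dir b (\<lambda>x t. h (fl b 0 x t)) (\<lambda>x t. 0)"
proof (rule DirI)
  fix \<tau> x assume *: "sol b \<tau>" "x \<in> {0..1::real}"
  show "((\<lambda>\<xi>. h (fl b 0 \<xi> (\<tau> \<xi>))) has_real_derivative 0) (at x within {0..1})"
    by (rule has_real_derivative_transform[OF *(2), of _ "\<lambda>_. h (\<tau> 0)"]) (auto simp: fl_eq[OF *(1)])
qed

lemma Dir_representation:
  assumes u: "Dir b u m" and m: "CT 0 T m" and x: "x \<in> {0..1}"
  shows "u x t = u 0 (fl b 0 x t) + along b m x t"
proof (rule Dir_unique[OF u _ _ x])
  show "Dir b (\<lambda>x t. u 0 (fl b 0 x t) + along b m x t) m"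
    using Dir_add[OF Dir_const_along Dir_along[OF m], of "u 0"] by simp
qed (simp add: fl_same)

lemma rho_pos: "rho b x t > 0" and rho_neq_0 [simp]: "rho b x t \<noteq> 0"
  by (simp_all add: rho_def)

lemma rho_0 [simp]: "rho b 0 t = 1"
  by (simp add: rho_def)

lemma rho_CT0: "CT 0 T (rho b)"
  using CT0_exp[OF along_CT0[OF bt_CT0]] by (simp add: rho_def[abs_def])

lemma Dir_rho: "Dir b (rho b) (\<lambda>x t. rho b x t * dt b x t)"
  using Dir_exp[OF Dir_along[OF bt_CT0]] by (simp add: rho_def[abs_def])

text \<open>Differentiation under the integral sign;
  \<open>rho b \<eta> (fl b \<eta> x t) / rho b x t\<close> enters as the t-derivative of the point
  of the curve over \<open>\<eta>\<close>.\<close>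

lemma along_tC1:
  assumes g: "tC1 T g"
  shows "tC1 T (along b g)"
    and "x \<in> {0..1} \<Longrightarrow> dt (along b g) x t = along b (\<lambda>x t. rho b x t * dt g x t) x t / rho b x t"
proof -
  have c: "CT 0 T (\<lambda>x t. rho b x t * dt g x t)" by (intro CT0_intros rho_CT0 tC1_CT0_dt[OF g])
  have d: "((\<lambda>s. along b g x s) has_real_derivative
      along b (\<lambda>x t. rho b x t * dt g x t) x t / rho b x t) (at t)" if x: "x \<in> {0..1}" for x t
  proof -
    let ?fx = "\<lambda>s \<eta>. dt g \<eta> (fl b \<eta> x s) * (rho b \<eta> (fl b \<eta> x s) / rho b x s)"
    have 1: "((\<lambda>s. g \<eta> (fl b \<eta> x s)) has_real_derivative ?fx s \<eta>) (at s)" if "\<eta> \<in> {0..x}" for s \<eta>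
      using that x by (intro DERIV_chain2[OF tC1_deriv[OF g]] fl_deriv) auto
    have 2: "(\<lambda>\<eta>. g \<eta> (fl b \<eta> x s)) integrable_on {0..x}" for s
    proof (rule integrable_continuous_real)
      have "continuous_on {0..1} (\<lambda>\<eta>. g \<eta> (fl b \<eta> x s))"
        by (rule curve_continuous[OF tC1_CT0[OF g] fl_sol[OF x]])
      then show "continuous_on {0..x} (\<lambda>\<eta>. g \<eta> (fl b \<eta> x s))" by (rule continuous_on_subset) (use x in auto)
    qed
    have 3: "continuous_on (UNIV \<times> {0..x}) (\<lambda>(s, \<eta>). ?fx s \<eta>)"
      unfolding case_prod_unfold using x
      by (intro continuous_intros CT0_compose[OF tC1_CT0_dt[OF g]] CT0_compose[OF rho_CT0] fl_continuous)
        auto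
    have "((\<lambda>s. integral (cbox 0 x) (\<lambda>\<eta>. g \<eta> (fl b \<eta> x s))) has_real_derivative
        integral (cbox 0 x) (?fx t)) (at t within UNIV)"
      by (rule leibniz_rule_field_derivative[where fx = ?fx]) (use 1 2 3 in auto)
    moreover have "integral {0..x} (?fx t) = integral {0..x} (\<lambda>\<eta>. rho b \<eta> (fl b \<eta> x t) * dt g \<eta> (fl b \<eta> x t) / rho b x t)"
      by (intro Henstock_Kurzweil_Integration.integral_cong) (simp add: mult.commute)
    ultimately show ?thesis by (simp add: along_def)
  qed
  have q: "CT 0 T (\<lambda>x t. along b (\<lambda>x t. rho b x t * dt g x t) x t / rho b x t)"
    by (intro CT0_intros rho_CT0 along_CT0 c) simp
  show "tC1 T (along b g)"
    by (rule tC1I(1)[OF along_CT0[OF tC1_CT0[OF g]] q d])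
  show "x \<in> {0..1} \<Longrightarrow> dt (along b g) x t = along b (\<lambda>x t. rho b x t * dt g x t) x t / rho b x t"
    by (rule tC1I(2)[OF along_CT0[OF tC1_CT0[OF g]] q d])
qed

lemma compose_fl_CT0:
  assumes h: "CT 0 T h"
  shows "CT 0 T (\<lambda>x t. h 0 (fl b 0 x t))"
proof (rule CT0I)
  show "h 0 (fl b 0 x (t + T)) = h 0 (fl b 0 x t)" if "x \<in> {0..1}" for x t
    using that by (simp add: fl_shift CT0_periodic[OF h])
  show "continuous_on strip (\<lambda>z. h 0 (fl b 0 (fst z) (snd z)))"
    by (intro CT0_compose[OF h] fl_continuous continuous_intros) (auto simp: strip_def)
qed

lemma compose_fl_tC1:
  assumes h: "tC1 T h"
  shows "tC1 T (\<lambda>x t. h 0 (fl b 0 x t))"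
    and "x \<in> {0..1} \<Longrightarrow> dt (\<lambda>x t. h 0 (fl b 0 x t)) x t = dt h 0 (fl b 0 x t) / rho b x t"
proof -
  have d: "((\<lambda>s. h 0 (fl b 0 x s)) has_real_derivative dt h 0 (fl b 0 x t) / rho b x t) (at t)"
    if "x \<in> {0..1}" for x t
    using DERIV_chain2[OF tC1_deriv[OF h] fl_deriv[OF that, of 0 t]] by simp
  have q: "CT 0 T (\<lambda>x t. dt h 0 (fl b 0 x t) / rho b x t)"
    by (intro CT0_intros rho_CT0 compose_fl_CT0 tC1_CT0_dt[OF h]) simp
  show "tC1 T (\<lambda>x t. h 0 (fl b 0 x t))"
    by (rule tC1I(1)[OF compose_fl_CT0[OF tC1_CT0[OF h]] q d])
  show "x \<in> {0..1} \<Longrightarrow> dt (\<lambda>x t. h 0 (fl b 0 x t)) x t = dt h 0 (fl b 0 x t) / rho b x t"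
    by (rule tC1I(2)[OF compose_fl_CT0[OF tC1_CT0[OF h]] q d])
qed

text \<open>Formally this is the t-derivative of \<open>ux + b * ut = n\<close>, where
  \<open>b\<close> contributes the commutator term \<open>dt b * ut\<close>. As \<open>u\<close> may
  lack second derivatives, the representation by trace and integral is differentiated instead, and
  the quotient rule for the denominator \<open>rho\<close> produces the commutator.\<close>

lemma Dir_dt:
  assumes u: "tC1 T u" and n: "tC1 T n" and D: "Dir b u n"
  shows "Dir b (dt u) (\<lambda>x t. dt n x t - dt b x t * dt u x t)"
proof -
  have c: "CT 0 T (\<lambda>x t. rho b x t * dt n x t)" by (intro CT0_intros rho_CT0 tC1_CT0_dt[OF n])
  have eq: "dt u x t = (dt u 0 (fl b 0 x t) + along b (\<lambda>x t. rho b x t * dt n x t) x t) / rho b x t"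
    if x: "x \<in> {0..1}" for x t
  proof -
    have "dt u x t = dt (\<lambda>x t. u 0 (fl b 0 x t) + along b n x t) x t"
      by (rule tC1_cong(2)[OF tC1_add(1)[OF compose_fl_tC1(1)[OF u] along_tC1(1)[OF n]]
            Dir_representation[OF D tC1_CT0[OF n]] x])
    also have "... = dt u 0 (fl b 0 x t) / rho b x t
        + along b (\<lambda>x t. rho b x t * dt n x t) x t / rho b x t"
      using x by (simp add: tC1_add(2)[OF compose_fl_tC1(1)[OF u] along_tC1(1)[OF n]]
          compose_fl_tC1(2)[OF u] along_tC1(2)[OF n])
    finally show ?thesis by (simp add: add_divide_distrib)
  qed
  have "Dir b (\<lambda>x t. dt u 0 (fl b 0 x t) + along b (\<lambda>x t. rho b x t * dt n x t) x t)
      (\<lambda>x t. rho b x t * dt n x t)"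
    using Dir_add[OF Dir_const_along Dir_along[OF c], of "dt u 0"] by simp
  from Dir_divide[OF this Dir_rho rho_neq_0] show ?thesis
  proof (rule Dir_cong)
    fix x t :: real assume x: "x \<in> {0..1}"
    show "dt n x t - dt b x t * dt u x t = (rho b x t * dt n x t * rho b x t -
        (dt u 0 (fl b 0 x t) + along b (\<lambda>x t. rho b x t * dt n x t) x t) * (rho b x t * dt b x t)) /
        (rho b x t * rho b x t)"
      unfolding eq[OF x] by (simp add: field_simps)
  qed (rule eq)
qed

text \<open>In the coordinates \<open>(\<xi>, y)\<close>, with \<open>y\<close> the height above the
  integral curve through \<open>(x, t)\<close>, the partial derivative in \<open>\<xi>\<close>
  exists at the point and that in \<open>y\<close> is \<open>dt u\<close>, which is continuous. This
  suffices for total differentiability; the x-derivative is then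
  \<open>m - b * dt u\<close>.\<close>

lemma tC1_Dir_has_derivative:
  assumes u: "tC1 T u" and D: "Dir b u m" and x: "x \<in> {0..1}"
  shows "((\<lambda>z. u (fst z) (snd z)) has_derivative
    (\<lambda>h. (m x t - b x t * dt u x t) * fst h + dt u x t * snd h)) (at (x, t) within strip)"
proof -
  define \<tau> where "\<tau> = (\<lambda>\<xi>. fl b \<xi> x t)"
  have \<tau>: "sol b \<tau>" unfolding \<tau>_def by (rule fl_sol[OF x])
  have \<tau>x: "\<tau> x = t" unfolding \<tau>_def by (rule fl_same[OF x])
  have V: "((\<lambda>(\<xi>, y). u \<xi> (\<tau> \<xi> + y)) has_derivative
      (\<lambda>(h, k). m x t * h + blinfun_apply (blinfun_scaleR_left (dt u x (\<tau> x + 0))) k)) (at (x, 0) within {0..1} \<times> UNIV)"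
  proof (rule has_derivative_partialsI[where fx = "\<lambda>h. m x t * h"
        and fy = "\<lambda>\<xi> y. blinfun_scaleR_left (dt u \<xi> (\<tau> \<xi> + y))"])
    show "((\<lambda>\<xi>. u \<xi> (\<tau> \<xi> + 0)) has_derivative (\<lambda>h. m x t * h)) (at x within {0..1})"
      using DirD[OF D \<tau> x] by (simp add: \<tau>x has_field_derivative_def)
    show "((\<lambda>y. u \<xi> (\<tau> \<xi> + y)) has_derivative blinfun_apply (blinfun_scaleR_left (dt u \<xi> (\<tau> \<xi> + y))))
        (at y within UNIV)" if "\<xi> \<in> {0..1}" for \<xi> y
    proof -
      have "((\<lambda>y. u \<xi> (\<tau> \<xi> + y)) has_real_derivative dt u \<xi> (\<tau> \<xi> + y) * 1) (at y)"
        by (rule DERIV_chain2[OF tC1_deriv[OF u that]]) (auto intro!: derivative_eq_intros)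
      then show ?thesis by (simp add: has_field_derivative_def blinfun_scaleR_left.rep_eq mult.commute[of _ "dt u \<xi> (\<tau> \<xi> + y)"] mult_commute_abs)
    qed
    have "continuous_on ({0..1} \<times> UNIV) (\<lambda>(\<xi>, y). dt u \<xi> (\<tau> \<xi> + y))"
      unfolding case_prod_unfold
      by (intro CT0_compose[OF tC1_CT0_dt[OF u]] continuous_intros
          continuous_on_compose2[OF sol_continuous[OF \<tau>] continuous_on_fst]) auto
    then have "continuous_on ({0..1} \<times> UNIV) (\<lambda>(\<xi>, y). blinfun_scaleR_left (dt u \<xi> (\<tau> \<xi> + y)) :: real \<Rightarrow>\<^sub>L real)"
      unfolding case_prod_unfold by (intro continuous_intros)
    moreover have "(x, 0) \<in> {0..1} \<times> (UNIV :: real set)" using x by auto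
    ultimately show "continuous (at (x, 0) within {0..1} \<times> UNIV)
        (\<lambda>(\<xi>, y). blinfun_scaleR_left (dt u \<xi> (\<tau> \<xi> + y)) :: real \<Rightarrow>\<^sub>L real)"
      unfolding continuous_on_eq_continuous_within by (rule bspec)
  qed (use x in auto)
  have sh: "((\<lambda>z. (fst z, snd z - \<tau> (fst z))) has_derivative (\<lambda>h. (fst h, snd h - b x t * fst h))) (at (x, t) within strip)"
  proof -
    have "((\<lambda>z. \<tau> (fst z)) has_derivative (\<lambda>h. b x t * fst h)) (at (x, t) within strip)"
    proof -
      have "(\<tau> has_derivative (\<lambda>h. b x t * h)) (at (fst (x, t)) within {0..1})"
        using \<tau> x \<tau>x by (auto simp: sol_def has_field_derivative_def)
      moreover have "fst ` strip \<subseteq> {0..1}" by (auto simp: strip_def)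
      ultimately have "(\<tau> has_derivative (\<lambda>h. b x t * h)) (at (fst (x, t)) within fst ` strip)"
        by (rule has_derivative_subset)
      from has_derivative_in_compose[OF has_derivative_fst[OF has_derivative_ident] this]
      show ?thesis by simp
    qed
    then show ?thesis by (auto intro!: derivative_eq_intros)
  qed
  have "((\<lambda>z. (\<lambda>(\<xi>, y). u \<xi> (\<tau> \<xi> + y)) (fst z, snd z - \<tau> (fst z))) has_derivative
      (\<lambda>h. (\<lambda>(h, k). m x t * h + blinfun_apply (blinfun_scaleR_left (dt u x (\<tau> x + 0))) k) (fst h, snd h - b x t * fst h)))
      (at (x, t) within strip)"
  proof (rule has_derivative_in_compose[OF sh])
    show "((\<lambda>(\<xi>, y). u \<xi> (\<tau> \<xi> + y)) has_derivative
      (\<lambda>(h, k). m x t * h + blinfun_apply (blinfun_scaleR_left (dt u x (\<tau> x + 0))) k))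
      (at (fst (x, t), snd (x, t) - \<tau> (fst (x, t))) within (\<lambda>z. (fst z, snd z - \<tau> (fst z))) ` strip)"
      using V by (simp add: \<tau>x) (rule has_derivative_subset, assumption, auto simp: strip_def)
  qed
  then show ?thesis
    by (simp add: \<tau>x blinfun_scaleR_left.rep_eq algebra_simps)
qed

end

text \<open>Together with \<open>tC1_Dir_has_derivative\<close> this converts a derivative along one
  family into a derivative along another.\<close>

lemma has_derivative_Dir:
  assumes "\<And>x t. x \<in> {0..1} \<Longrightarrow> ((\<lambda>z. u (fst z) (snd z)) has_derivative
    (\<lambda>h. ux x t * fst h + ut x t * snd h)) (at (x, t) within strip)"
  shows "Dir b u (\<lambda>x t. ux x t + b x t * ut x t)"
proof (rule DirI)
  fix \<tau> x assume \<tau>: "sol b \<tau>" and x: "x \<in> {0..1::real}"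
  have "((\<lambda>\<xi>. (\<xi>, \<tau> \<xi>)) has_derivative (\<lambda>h. (h, b x (\<tau> x) * h))) (at x within {0..1})"
    using \<tau> x by (auto simp: sol_def has_field_derivative_def intro!: derivative_intros)
  moreover have "((\<lambda>z. u (fst z) (snd z)) has_derivative
    (\<lambda>h. ux x (\<tau> x) * fst h + ut x (\<tau> x) * snd h)) (at (x, \<tau> x) within (\<lambda>\<xi>. (\<xi>, \<tau> \<xi>)) ` {0..1})"
    by (rule has_derivative_subset[OF assms[OF x]]) (auto simp: strip_def)
  ultimately have "((\<lambda>\<xi>. u (fst (\<xi>, \<tau> \<xi>)) (snd (\<xi>, \<tau> \<xi>))) has_derivative
      (\<lambda>h. ux x (\<tau> x) * fst (h, b x (\<tau> x) * h) + ut x (\<tau> x) * snd (h, b x (\<tau> x) * h))) (at x within {0..1})"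
    by (rule has_derivative_in_compose)
  moreover have "(\<lambda>h. ux x (\<tau> x) * fst (h, b x (\<tau> x) * h) + ut x (\<tau> x) * snd (h, b x (\<tau> x) * h))
      = (*) (ux x (\<tau> x) + b x (\<tau> x) * ut x (\<tau> x))"
    by (auto simp: algebra_simps)
  ultimately show "((\<lambda>\<xi>. u \<xi> (\<tau> \<xi>)) has_real_derivative ux x (\<tau> x) + b x (\<tau> x) * ut x (\<tau> x)) (at x within {0..1})"
    by (simp add: has_field_derivative_def)
qed

section \<open>Antiderivatives and averages in \<open>t\<close>\<close>

lemma oint_has_real_derivative:
  assumes "continuous_on UNIV g"
  shows "((\<lambda>t. oint 0 t g) has_real_derivative g t) (at t)"
proof -
  \<comment> \<open>A fixed lower limit below both 0 and \<open>t\<close> removes the case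
    distinction of \<open>oint\<close> near \<open>t\<close>.\<close>
  define a where "a = - \<bar>t\<bar> - 1"
  have c: "continuous_on {p..q} g" for p q using assms by (rule continuous_on_subset) simp
  have i: "g integrable_on {p..q}" for p q by (rule integrable_continuous_real[OF c])
  have eq: "oint 0 y g = integral {a..y} g - integral {a..0} g" if "y \<in> {a<..<\<bar>t\<bar> + 1}" for y
  proof (cases "0 \<le> y")
    case True
    have "integral {a..0} g + integral {0..y} g = integral {a..y} g"
      by (rule Henstock_Kurzweil_Integration.integral_combine) (use True i in \<open>auto simp: a_def\<close>)
    then show ?thesis using True by (simp add: oint_def)
  next
    case False
    have "integral {a..y} g + integral {y..0} g = integral {a..0} g"
      by (rule Henstock_Kurzweil_Integration.integral_combine) (use False i that in \<open>auto simp: a_def\<close>)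
    then show ?thesis using False by (simp add: oint_def)
  qed
  have t: "t \<in> {a<..<\<bar>t\<bar> + 1}" by (auto simp: a_def)
  have "((\<lambda>y. integral {a..y} g) has_real_derivative g t) (at t within {a..\<bar>t\<bar> + 1})"
    by (rule integral_has_real_derivative[OF c]) (use t in auto)
  then have "((\<lambda>y. integral {a..y} g) has_real_derivative g t) (at t)"
    using t by (simp add: at_within_interior[of t "{a..\<bar>t\<bar> + 1}"])
  then have "((\<lambda>y. integral {a..y} g - integral {a..0} g) has_real_derivative g t) (at t)"
    by (auto intro!: derivative_eq_intros)
  then show ?thesis
    by (rule DERIV_cong_ev[THEN iffD1, rotated -1])
      (use eq t in \<open>auto simp: eventually_nhds intro!: exI[of _ "{a<..<\<bar>t\<bar> + 1}"]\<close>)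
qed

text \<open>The mean of \<open>g x\<close> over \<open>[t, t + h]\<close>, rescaled to a fixed
  interval of integration.\<close>

definition steklov :: "real \<Rightarrow> (real \<Rightarrow> real \<Rightarrow> real) \<Rightarrow> real \<Rightarrow> real \<Rightarrow> real" where
  "steklov h g x t = integral {0..1} (\<lambda>r. g x (t + h * r))"

lemma steklov_CT0:
  assumes g: "CT 0 T g"
  shows "CT 0 T (steklov h g)"
proof (rule CT0I)
  show "steklov h g x (t + T) = steklov h g x t" if "x \<in> {0..1}" for x t
  proof -
    have "g x (t + T + h * r) = g x (t + h * r)" for r
      using CT0_periodic[OF g that, of "t + h * r"] by (simp add: algebra_simps)
    then show ?thesis by (simp add: steklov_def)
  qed
  have "continuous_on (strip \<times> cbox 0 1) (\<lambda>(z, r). g (fst z) (snd z + h * r))"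
    unfolding case_prod_unfold
    by (intro CT0_compose[OF g] continuous_intros) (auto simp: strip_def)
  from integral_continuous_on_param[OF this]
  show "continuous_on strip (\<lambda>z. steklov h g (fst z) (snd z))" by (simp add: steklov_def)
qed

lemma steklov_eq:
  assumes g: "CT 0 T g" and x: "x \<in> {0..1}" and h: "h > 0"
  shows "steklov h g x t = (oint 0 (t + h) (g x) - oint 0 t (g x)) / h"
proof -
  have "((\<lambda>r. g x (t + h * r)) has_integral oint 0 (t + h * 1) (g x) / h - oint 0 (t + h * 0) (g x) / h) {0..1}"
  proof (rule fundamental_theorem_of_calculus)
    fix r :: real
    have "((\<lambda>r. t + h * r) has_real_derivative h) (at r within {0..1})"
      by (auto intro!: derivative_eq_intros)
    from DERIV_chain2[OF oint_has_real_derivative[OF CT0_slice[OF g x]] this]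
    have "((\<lambda>r. oint 0 (t + h * r) (g x)) has_real_derivative g x (t + h * r) * h) (at r within {0..1})" .
    from DERIV_cdivide[OF this, of h]
    show "((\<lambda>r. oint 0 (t + h * r) (g x) / h) has_vector_derivative g x (t + h * r)) (at r within {0..1})"
      using h by (simp add: has_real_derivative_iff_has_vector_derivative)
  qed simp
  then show ?thesis by (simp add: steklov_def has_integral_iff diff_divide_distrib)
qed

lemma steklov_tC1:
  assumes g: "CT 0 T g" and h: "h > 0"
  shows "tC1 T (steklov h g)"
proof (rule tC1I(1)[OF steklov_CT0[OF g]])
  show "CT 0 T (\<lambda>x t. (g x (t + h) - g x t) / h)"
  proof (rule CT0I)
    show "(g x (t + T + h) - g x (t + T)) / h = (g x (t + h) - g x t) / h" if "x \<in> {0..1}" for x t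
      using CT0_periodic[OF g that, of "t + h"] CT0_periodic[OF g that, of t] by (simp add: algebra_simps)
    show "continuous_on strip (\<lambda>z. (g (fst z) (snd z + h) - g (fst z) (snd z)) / h)"
      using h by (intro continuous_on_divide continuous_on_diff CT0_compose[OF g] continuous_on_add
          continuous_on_fst continuous_on_snd continuous_on_const continuous_on_id) (auto simp: strip_def)
  qed
  fix x t :: real assume x: "x \<in> {0..1}"
  note o = oint_has_real_derivative[OF CT0_slice[OF g x]]
  have "((\<lambda>s. s + h) has_real_derivative 1) (at t)" by (auto intro!: derivative_eq_intros)
  from DERIV_cdivide[OF DERIV_diff[OF DERIV_chain2[OF o this] o], of h]
  show "((\<lambda>s. steklov h g x s) has_real_derivative (g x (t + h) - g x t) / h) (at t)"
    by (simp add: steklov_eq[OF g x h])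
qed

lemma steklov_approx:
  assumes "T > 0" and g: "CT 0 T g" and "e > 0"
  obtains d where "d > 0"
    "\<And>h x t. 0 < h \<Longrightarrow> h < d \<Longrightarrow> x \<in> {0..1} \<Longrightarrow> \<bar>steklov h g x t - g x t\<bar> \<le> e"
proof -
  obtain d where d: "d > 0" "\<And>x t s. x \<in> {0..1} \<Longrightarrow> \<bar>s - t\<bar> < d \<Longrightarrow> \<bar>g x s - g x t\<bar> < e"
    using CT0_uniformly_continuous[OF assms] by blast
  have "\<bar>steklov h g x t - g x t\<bar> \<le> e" if h: "0 < h" "h < d" and x: "x \<in> {0..1}" for h x t
  proof -
    have c: "continuous_on {0..1} (\<lambda>r. g x (t + h * r))"
      by (rule continuous_on_compose2[OF CT0_slice[OF g x, of UNIV]]) (auto intro!: continuous_intros)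
    have "steklov h g x t - g x t = integral {0..1} (\<lambda>r. g x (t + h * r) - g x t)"
      unfolding Henstock_Kurzweil_Integration.integral_diff[OF integrable_continuous_real[OF c] integrable_const_ivl]
      by (simp add: steklov_def)
    moreover have "norm (integral {0..1} (\<lambda>r. g x (t + h * r) - g x t)) \<le> e * (1 - 0)"
    proof (rule integral_bound)
      show "continuous_on {0..1} (\<lambda>r. g x (t + h * r) - g x t)"
        using c by (intro continuous_on_diff continuous_on_const)
      fix r :: real assume r: "r \<in> {0..1}"
      have "h * r \<le> h * 1" using r h by (intro mult_left_mono) auto
      moreover have "0 \<le> h * r" using r h by simp
      ultimately have "\<bar>(t + h * r) - t\<bar> < d" using h(2) by linarith
      from d(2)[OF x this] show "norm (g x (t + h * r) - g x t) \<le> e" by simp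
    qed simp
    ultimately show ?thesis by simp
  qed
  then show thesis using that d(1) by blast
qed

context slope_field begin

lemma along_bound:
  assumes g: "CT 0 T g" and x: "x \<in> {0..1}" and B: "\<And>x t. x \<in> {0..1} \<Longrightarrow> \<bar>g x t\<bar> \<le> B"
  shows "\<bar>along b g x t\<bar> \<le> B"
proof -
  have "continuous_on {0..1} (\<lambda>\<eta>. g \<eta> (fl b \<eta> x t))" by (rule curve_continuous[OF g fl_sol[OF x]])
  then have "continuous_on {0..x} (\<lambda>\<eta>. g \<eta> (fl b \<eta> x t))" by (rule continuous_on_subset) (use x in auto)
  then have "norm (integral {0..x} (\<lambda>\<eta>. g \<eta> (fl b \<eta> x t))) \<le> B * (x - 0)"
    by (rule integral_bound[rotated]) (use x B in auto)
  also have "... \<le> B * 1" using x B[of 0 0] by (intro mult_left_mono) auto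
  finally show ?thesis by (simp add: along_def)
qed

lemma along_diff:
  assumes g: "CT 0 T g" and h: "CT 0 T h" and x: "x \<in> {0..1}"
  shows "along b (\<lambda>x t. g x t - h x t) x t = along b g x t - along b h x t"
  by (rule Dir_unique[OF Dir_along[OF CT0_diff[OF g h]] Dir_diff[OF Dir_along[OF g] Dir_along[OF h]] _ x]) simp

text \<open>Averaging \<open>v\<close> itself in \<open>t\<close> would not turn \<open>m\<close>
  into its average, since the slope may depend on \<open>t\<close>. Hence the trace of
  \<open>v\<close> at x = 0 and the function \<open>m\<close> are averaged separately and
  \<open>v'\<close> is rebuilt from them by integration; each part contributes an error of at most
  \<open>e / 2\<close>.\<close>

lemma Dir_approx:
  assumes v: "CT 0 T v" and m: "CT 0 T m" and D: "Dir b v m" and e: "e > 0"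
  obtains v' m' where "tC1 T v'" "CT 0 T m'" "Dir b v' m'"
    "\<And>x t. x \<in> {0..1} \<Longrightarrow> \<bar>v' x t - v x t\<bar> \<le> e" "\<And>x t. x \<in> {0..1} \<Longrightarrow> \<bar>m' x t - m x t\<bar> \<le> e"
proof -
  have e2: "e / 2 > 0" using e by simp
  obtain d1 where d1: "d1 > 0"
    "\<And>h x t. 0 < h \<Longrightarrow> h < d1 \<Longrightarrow> x \<in> {0..1} \<Longrightarrow> \<bar>steklov h v x t - v x t\<bar> \<le> e / 2"
    using steklov_approx[OF T_pos v e2] by blast
  obtain d2 where d2: "d2 > 0"
    "\<And>h x t. 0 < h \<Longrightarrow> h < d2 \<Longrightarrow> x \<in> {0..1} \<Longrightarrow> \<bar>steklov h m x t - m x t\<bar> \<le> e / 2"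
    using steklov_approx[OF T_pos m e2] by blast
  define h where "h = min d1 d2 / 2"
  have h: "0 < h" "h < d1" "h < d2" using d1(1) d2(1) by (auto simp: h_def)
  define m' where "m' = steklov h m"
  define v' where "v' = (\<lambda>x t. steklov h v 0 (fl b 0 x t) + along b m' x t)"
  have m': "tC1 T m'" unfolding m'_def by (rule steklov_tC1[OF m h(1)])
  show thesis
  proof (rule that)
    show "tC1 T v'" unfolding v'_def
      by (rule tC1_add(1)[OF compose_fl_tC1(1)[OF steklov_tC1[OF v h(1)]] along_tC1(1)[OF m']])
    show "CT 0 T m'" by (rule tC1_CT0[OF m'])
    show "Dir b v' m'" unfolding v'_def
      using Dir_add[OF Dir_const_along Dir_along[OF tC1_CT0[OF m']], of "steklov h v 0"] by simp
    fix x t :: real assume x: "x \<in> {0..1}"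
    show "\<bar>m' x t - m x t\<bar> \<le> e" using d2(2)[OF h(1,3) x, of t] e by (simp add: m'_def)
    have "\<bar>along b (\<lambda>x t. m' x t - m x t) x t\<bar> \<le> e / 2"
      by (rule along_bound[OF CT0_diff[OF tC1_CT0[OF m'] m] x])
        (use d2(2)[OF h(1,3)] in \<open>simp add: m'_def\<close>)
    then have "\<bar>along b m' x t - along b m x t\<bar> \<le> e / 2"
      by (simp add: along_diff[OF tC1_CT0[OF m'] m x])
    moreover have "\<bar>steklov h v 0 (fl b 0 x t) - v 0 (fl b 0 x t)\<bar> \<le> e / 2"
      by (rule d1(2)[OF h(1,2)]) simp
    ultimately show "\<bar>v' x t - v x t\<bar> \<le> e"
      unfolding Dir_representation[OF D m x] v'_def by linarith
  qed
qed

text \<open>The derivative is supplied in integrated form because this form survives uniform limits;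
  continuity of \<open>z\<close> turns it back into a derivative.\<close>

lemma tC1_from_integral:
  assumes u: "CT 0 T u" and z: "CT 0 T z"
    and eq: "\<And>x s t. x \<in> {0..1} \<Longrightarrow> s \<le> t \<Longrightarrow> u x t - u x s = integral {s..t} (z x)"
  shows "tC1 T u" and "x \<in> {0..1} \<Longrightarrow> dt u x t = z x t"
proof -
  have *: "((\<lambda>s. u x s) has_real_derivative z x t) (at t)" if x: "x \<in> {0..1}" for x t
  proof -
    have "((\<lambda>s. integral {t-1..s} (z x)) has_real_derivative z x t) (at t within {t-1..t+1})"
      by (rule integral_has_real_derivative[OF CT0_slice[OF z x]]) auto
    moreover have "t \<in> interior {t-1..t+1}" by simp
    ultimately have "((\<lambda>s. integral {t-1..s} (z x)) has_real_derivative z x t) (at t)"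
      by (simp only: at_within_interior)
    from DERIV_add[OF DERIV_const this]
    have "((\<lambda>s. u x (t-1) + integral {t-1..s} (z x)) has_real_derivative z x t) (at t)" by simp
    then show ?thesis
    proof (rule has_field_derivative_transform_within_open[where S = "{t-1<..}"])
      show "u x (t-1) + integral {t-1..s} (z x) = u x s" if "s \<in> {t-1<..}" for s
        using eq[OF x, of "t-1" s] that by simp
    qed auto
  qed
  show "tC1 T u" by (rule tC1I(1)[OF u z *])
  show "x \<in> {0..1} \<Longrightarrow> dt u x t = z x t" by (rule tC1I(2)[OF u z *])
qed

section \<open>Integrals of functions differentiable in a transversal direction\<close>

definition dtalong where
  "dtalong \<kappa> \<kappa>' v m x t = \<kappa> x t * v x t - (\<kappa> 0 (fl b 0 x t) * v 0 (fl b 0 x t)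
     + along b (\<lambda>x t. rho b x t * (\<kappa> x t * m x t + (\<kappa>' x t + \<kappa> x t * dt b x t) * v x t)) x t) / rho b x t"

lemma dtalong_CT0:
  assumes "CT 0 T \<kappa>" "CT 0 T \<kappa>'" "CT 0 T v" "CT 0 T m"
  shows "CT 0 T (dtalong \<kappa> \<kappa>' v m)"
  unfolding dtalong_def[abs_def] using assms compose_fl_CT0[OF assms(1)] compose_fl_CT0[OF assms(3)]
  by (intro CT0_intros along_CT0 rho_CT0 bt_CT0) auto

text \<open>The derivatives of \<open>v\<close> along \<open>b\<close> and along \<open>c\<close>
  differ by \<open>(b - c) * dt v\<close>, and \<open>\<kappa>\<close> is the reciprocal of
  \<open>b - c\<close>. So \<open>dt v\<close> is \<open>\<kappa>\<close> times that difference, in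
  which the derivative along \<open>c\<close> is the given \<open>m\<close>.\<close>

lemma dtalong_smooth:
  assumes c: "slope_field T c" and v: "tC1 T v" and m: "CT 0 T m" and D: "Dir c v m"
    and \<kappa>: "CT 0 T \<kappa>" "CT 0 T \<kappa>'" "Dir b \<kappa> \<kappa>'"
    and \<kappa>bc: "\<And>x t. x \<in> {0..1} \<Longrightarrow> \<kappa> x t * (b x t - c x t) = 1"
    and x: "x \<in> {0..1}"
  shows "dt (along b v) x t = dtalong \<kappa> \<kappa>' v m x t"
proof -
  interpret C: slope_field T c by (rule c)
  define w where "w = (\<lambda>x t. rho b x t * (\<kappa> x t * m x t + (\<kappa>' x t + \<kappa> x t * dt b x t) * v x t))"
  have v0: "CT 0 T v" by (rule tC1_CT0[OF v])
  have w: "CT 0 T w" unfolding w_def by (intro CT0_intros rho_CT0 bt_CT0 \<kappa> m v0)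
  have Dv: "Dir b v (\<lambda>x t. (m x t - c x t * dt v x t) + b x t * dt v x t)"
    by (rule has_derivative_Dir) (rule C.tC1_Dir_has_derivative[OF v D])
  \<comment> \<open>Integration by parts in the form of \<open>Dir_unique\<close>: both sides vanish
    at x = 0 and have the derivative \<open>rho b x t * dt v x t\<close> along
    \<open>b\<close>.\<close>
  have "along b (\<lambda>x t. rho b x t * dt v x t) x t
      = rho b x t * (\<kappa> x t * v x t) - \<kappa> 0 (fl b 0 x t) * v 0 (fl b 0 x t) - along b w x t"
  proof (rule Dir_unique[OF _ _ _ x, where u = "along b (\<lambda>x t. rho b x t * dt v x t)"
        and v = "\<lambda>x t. rho b x t * (\<kappa> x t * v x t) - \<kappa> 0 (fl b 0 x t) * v 0 (fl b 0 x t) - along b w x t"])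
    show "Dir b (along b (\<lambda>x t. rho b x t * dt v x t)) (\<lambda>x t. rho b x t * dt v x t)"
      by (rule Dir_along) (intro CT0_intros rho_CT0 tC1_CT0_dt[OF v])
    have "Dir b (\<lambda>x t. rho b x t * (\<kappa> x t * v x t) - \<kappa> 0 (fl b 0 x t) * v 0 (fl b 0 x t) - along b w x t)
        (\<lambda>x t. rho b x t * dt b x t * (\<kappa> x t * v x t) + rho b x t * (\<kappa>' x t * v x t
          + \<kappa> x t * ((m x t - c x t * dt v x t) + b x t * dt v x t)) - 0 - w x t)"
      by (rule Dir_diff[OF Dir_diff[OF Dir_mult[OF Dir_rho Dir_mult[OF \<kappa>(3) Dv]]
            Dir_const_along[of "\<lambda>s. \<kappa> 0 s * v 0 s"]] Dir_along[OF w]])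
    then show "Dir b (\<lambda>x t. rho b x t * (\<kappa> x t * v x t) - \<kappa> 0 (fl b 0 x t) * v 0 (fl b 0 x t) - along b w x t)
        (\<lambda>x t. rho b x t * dt v x t)"
    proof (rule Dir_cong)
      fix x t :: real assume x: "x \<in> {0..1}"
      have "rho b x t * dt b x t * (\<kappa> x t * v x t) + rho b x t * (\<kappa>' x t * v x t
          + \<kappa> x t * ((m x t - c x t * dt v x t) + b x t * dt v x t)) - 0 - w x t
          = rho b x t * dt v x t * (\<kappa> x t * (b x t - c x t))"
        by (simp add: w_def algebra_simps)
      then show "rho b x t * dt v x t = rho b x t * dt b x t * (\<kappa> x t * v x t) + rho b x t * (\<kappa>' x t * v x t
          + \<kappa> x t * ((m x t - c x t * dt v x t) + b x t * dt v x t)) - 0 - w x t"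
        by (simp add: \<kappa>bc[OF x])
    qed simp
    show "along b (\<lambda>x t. rho b x t * dt v x t) 0 t = rho b 0 t * (\<kappa> 0 t * v 0 t)
        - \<kappa> 0 (fl b 0 0 t) * v 0 (fl b 0 0 t) - along b w 0 t" for t
      by (simp add: fl_same)
  qed
  then show ?thesis unfolding along_tC1(2)[OF v x] dtalong_def w_def[symmetric]
    by (simp add: field_simps)
qed

text \<open>Integrating a function that is differentiable in a direction transversal to the
  characteristics gains one derivative in \<open>t\<close>.  For smooth \<open>v\<close> the derivative
  \<open>dtalong\<close> comes from writing \<open>\<partial>\<^sub>t v\<close> as a combination of the two directional
  derivatives and integrating by parts; it contains no derivative of \<open>v\<close> other than the
  transversal one, so Steklov averages give the general case.\<close>

lemma along_transversal_tC1:
  assumes c: "slope_field T c" and v: "CT 0 T v" and m: "CT 0 T m" and D: "Dir c v m"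
    and \<kappa>: "CT 0 T \<kappa>" "CT 0 T \<kappa>'" "Dir b \<kappa> \<kappa>'"
    and \<kappa>bc: "\<And>x t. x \<in> {0..1} \<Longrightarrow> \<kappa> x t * (b x t - c x t) = 1"
  shows "tC1 T (along b v)" and "x \<in> {0..1} \<Longrightarrow> dt (along b v) x t = dtalong \<kappa> \<kappa>' v m x t"
proof -
  interpret C: slope_field T c by (rule c)
  note z = dtalong_CT0[OF \<kappa>(1,2) v m]
  define p where "p = (\<lambda>x t. rho b x t * \<kappa> x t)"
  define q where "q = (\<lambda>x t. rho b x t * (\<kappa>' x t + \<kappa> x t * dt b x t))"
  have p: "CT 0 T p" and q: "CT 0 T q" unfolding p_def q_def by (intro CT0_intros rho_CT0 bt_CT0 \<kappa>)+
  obtain A where A: "A \<ge> 0" "\<And>x t. x \<in> {0..1} \<Longrightarrow> \<bar>\<kappa> x t\<bar> \<le> A" using CT0_bounded[OF T_pos \<kappa>(1)] by blast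
  obtain P where P: "P \<ge> 0" "\<And>x t. x \<in> {0..1} \<Longrightarrow> \<bar>p x t\<bar> \<le> P" using CT0_bounded[OF T_pos p] by blast
  obtain Q where Q: "Q \<ge> 0" "\<And>x t. x \<in> {0..1} \<Longrightarrow> \<bar>q x t\<bar> \<le> Q" using CT0_bounded[OF T_pos q] by blast
  have "CT 0 T (\<lambda>x t. 1 / rho b x t)" by (intro CT0_intros rho_CT0) simp
  then obtain R where R: "R \<ge> 0" "\<And>x t. x \<in> {0..1} \<Longrightarrow> \<bar>1 / rho b x t\<bar> \<le> R"
    using CT0_bounded[OF T_pos] by blast
  \<comment> \<open>Lipschitz constant of \<open>dtalong\<close> in \<open>(v, m)\<close> for the
    sup-norm: one \<open>A\<close> from the term at \<open>(x, t)\<close>, one from the trace at x =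
    0, \<open>P + Q\<close> from the integral and \<open>R\<close> from the division by
    \<open>rho\<close>.\<close>
  define K where "K = A + (A + (P + Q)) * R"
  have K: "K \<ge> 0" unfolding K_def using A(1) P(1) Q(1) R(1) by auto
  have diff: "\<bar>dtalong \<kappa> \<kappa>' v' m' x t - dtalong \<kappa> \<kappa>' v m x t\<bar> \<le> K * e"
    if v': "CT 0 T v'" and m': "CT 0 T m'" and x: "x \<in> {0..1}" and e: "e \<ge> 0"
      and ve: "\<And>x t. x \<in> {0..1} \<Longrightarrow> \<bar>v' x t - v x t\<bar> \<le> e"
      and me: "\<And>x t. x \<in> {0..1} \<Longrightarrow> \<bar>m' x t - m x t\<bar> \<le> e" for v' m' x t e
  proof -
    let ?g = "\<lambda>m v x t. p x t * m x t + q x t * v x t"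
    have g: "CT 0 T (?g m v)" "CT 0 T (?g m' v')" by (intro CT0_intros p q m v m' v')+
    have "\<bar>along b (\<lambda>x t. ?g m' v' x t - ?g m v x t) x t\<bar> \<le> P * e + Q * e"
    proof (rule along_bound[OF CT0_diff[OF g(2,1)] x])
      fix x t :: real assume x: "x \<in> {0..1}"
      have "?g m' v' x t - ?g m v x t = p x t * (m' x t - m x t) + q x t * (v' x t - v x t)"
        by (simp add: algebra_simps)
      moreover have "\<bar>p x t * (m' x t - m x t)\<bar> \<le> P * e" "\<bar>q x t * (v' x t - v x t)\<bar> \<le> Q * e"
        unfolding abs_mult using P Q ve[OF x] me[OF x] x by (auto intro!: mult_mono)
      ultimately show "\<bar>?g m' v' x t - ?g m v x t\<bar> \<le> P * e + Q * e" by linarith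
    qed
    then have 1: "\<bar>along b (?g m' v') x t - along b (?g m v) x t\<bar> \<le> P * e + Q * e"
      by (simp add: along_diff[OF g(2,1) x])
    have 2: "\<bar>\<kappa> x t * (v' x t - v x t)\<bar> \<le> A * e" if "x \<in> {0..1}" for x t
      unfolding abs_mult using A that ve[OF that] by (auto intro!: mult_mono)
    have 3: "\<bar>\<kappa> 0 (fl b 0 x t) * (v' 0 (fl b 0 x t) - v 0 (fl b 0 x t))
        + (along b (?g m' v') x t - along b (?g m v) x t)\<bar> \<le> A * e + (P * e + Q * e)"
      using 1 2[of 0 "fl b 0 x t"] by simp
    have "\<bar>(\<kappa> 0 (fl b 0 x t) * (v' 0 (fl b 0 x t) - v 0 (fl b 0 x t))
        + (along b (?g m' v') x t - along b (?g m v) x t)) * (1 / rho b x t)\<bar> \<le> (A * e + (P * e + Q * e)) * R"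
      unfolding abs_mult[of _ "1 / rho b x t"] using 3 R x e A P Q by (intro mult_mono) auto
    moreover have "dtalong \<kappa> \<kappa>' v' m' x t - dtalong \<kappa> \<kappa>' v m x t = \<kappa> x t * (v' x t - v x t)
      - (\<kappa> 0 (fl b 0 x t) * (v' 0 (fl b 0 x t) - v 0 (fl b 0 x t))
        + (along b (?g m' v') x t - along b (?g m v) x t)) * (1 / rho b x t)"
    proof -
      have "(\<lambda>x t. rho b x t * (\<kappa> x t * m x t + (\<kappa>' x t + \<kappa> x t * dt b x t) * v x t)) = ?g m v" for m v
        by (simp add: p_def q_def fun_eq_iff algebra_simps)
      note eqs = this
      show ?thesis unfolding dtalong_def eqs
        by (simp add: diff_divide_distrib add_divide_distrib right_diff_distrib)
    qed
    ultimately have "\<bar>dtalong \<kappa> \<kappa>' v' m' x t - dtalong \<kappa> \<kappa>' v m x t\<bar> \<le> A * e + (A * e + (P * e + Q * e)) * R"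
      using 2[OF x, of t] by linarith
    then show ?thesis by (simp add: K_def algebra_simps)
  qed
  have eq: "along b v x t - along b v x s = integral {s..t} (dtalong \<kappa> \<kappa>' v m x)"
    if x: "x \<in> {0..1}" and st: "s \<le> t" for x s t
  proof -
    let ?E = "\<bar>(along b v x t - along b v x s) - integral {s..t} (dtalong \<kappa> \<kappa>' v m x)\<bar>"
    have "?E \<le> (2 + K * (t - s)) * e" if e: "e > 0" for e
    proof -
      obtain v' m' where v': "tC1 T v'" and m': "CT 0 T m'" and D': "Dir c v' m'"
        and ve: "\<And>x t. x \<in> {0..1} \<Longrightarrow> \<bar>v' x t - v x t\<bar> \<le> e"
        and me: "\<And>x t. x \<in> {0..1} \<Longrightarrow> \<bar>m' x t - m x t\<bar> \<le> e"
        using C.Dir_approx[OF v m D e] by blast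
      note v'0 = tC1_CT0[OF v']
      have "((\<lambda>r. dtalong \<kappa> \<kappa>' v' m' x r) has_integral along b v' x t - along b v' x s) {s..t}"
      proof (rule fundamental_theorem_of_calculus[OF st])
        fix r
        have dr: "dt (along b v') x r = dtalong \<kappa> \<kappa>' v' m' x r"
          by (rule dtalong_smooth[OF c v' m' D' \<kappa> \<kappa>bc x])
        have "((\<lambda>r. along b v' x r) has_real_derivative dtalong \<kappa> \<kappa>' v' m' x r) (at r)"
          using tC1_deriv[OF along_tC1(1)[OF v'] x, of r]
          unfolding dr .
        then show "((\<lambda>r. along b v' x r) has_vector_derivative dtalong \<kappa> \<kappa>' v' m' x r) (at r within {s..t})"
          by (auto simp: has_real_derivative_iff_has_vector_derivative[symmetric] intro: has_field_derivative_at_within)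
      qed
      then have 1: "along b v' x t - along b v' x s = integral {s..t} (dtalong \<kappa> \<kappa>' v' m' x)"
        by (simp add: has_integral_iff)
      have ci: "continuous_on {s..t} (dtalong \<kappa> \<kappa>' v' m' x)" "continuous_on {s..t} (dtalong \<kappa> \<kappa>' v m x)"
        by (rule CT0_slice[OF dtalong_CT0[OF \<kappa>(1,2) v'0 m'] x] CT0_slice[OF z x])+
      have "norm (integral {s..t} (\<lambda>r. dtalong \<kappa> \<kappa>' v' m' x r - dtalong \<kappa> \<kappa>' v m x r)) \<le> K * e * (t - s)"
        by (rule integral_bound[OF st continuous_on_diff[OF ci]])
          (use diff[OF v'0 m' x less_imp_le[OF e] ve me] in simp)
      then have 2: "\<bar>integral {s..t} (dtalong \<kappa> \<kappa>' v' m' x) - integral {s..t} (dtalong \<kappa> \<kappa>' v m x)\<bar> \<le> K * e * (t - s)"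
        using integrable_continuous_real[OF ci(1)] integrable_continuous_real[OF ci(2)]
        by (simp add: Henstock_Kurzweil_Integration.integral_diff)
      have 3: "\<bar>along b v' x r - along b v x r\<bar> \<le> e" for r
        unfolding along_diff[OF v'0 v x, symmetric]
        by (rule along_bound[OF CT0_diff[OF v'0 v] x ve])
      \<comment> \<open>The two values of \<open>along\<close> cost \<open>e\<close> each, and the
        integral over \<open>{s..t}\<close> costs \<open>K * e * (t - s)\<close>.\<close>
      have "?E \<le> e + e + K * e * (t - s)"
        using 1 2 3[of s] 3[of t] by linarith
      then show ?thesis by (simp add: algebra_simps)
    qed
    then have "?E \<le> 0 + e" if "e > 0" for e
    proof -
      have k: "2 + K * (t - s) > 0" using K st by (simp add: add_pos_nonneg)
      show ?thesis using \<open>\<And>e. e > 0 \<Longrightarrow> ?E \<le> (2 + K * (t - s)) * e\<close>[of "e / (2 + K * (t - s))"] k that by simp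
    qed
    then have "?E \<le> 0" by (rule field_le_epsilon)
    then show ?thesis by simp
  qed
  show "tC1 T (along b v)" by (rule tC1_from_integral(1)[OF along_CT0[OF v] z eq])
  show "x \<in> {0..1} \<Longrightarrow> dt (along b v) x t = dtalong \<kappa> \<kappa>' v m x t"
    by (rule tC1_from_integral(2)[OF along_CT0[OF v] z eq])
qed

end

section \<open>A linear functional equation on the circle\<close>

text \<open>Lifts to the line of circle maps of degree one, with their derivative.\<close>

definition cmap :: "real \<Rightarrow> (real \<Rightarrow> real) \<Rightarrow> (real \<Rightarrow> real) \<Rightarrow> bool" where
  "cmap T \<sigma> \<sigma>' \<longleftrightarrow> (\<forall>t. \<sigma> (t + T) = \<sigma> t + T) \<and> (\<forall>t. (\<sigma> has_real_derivative \<sigma>' t) (at t))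
     \<and> CT 0 T (\<lambda>x. \<sigma>')"

lemma cmap_continuous: "cmap T \<sigma> \<sigma>' \<Longrightarrow> continuous_on A \<sigma>"
  unfolding cmap_def by (intro continuous_at_imp_continuous_on) (blast intro: DERIV_isCont)

lemma CT0_compose_cmap:
  assumes g: "CT 0 T g" and c: "c \<in> {0..1}" and \<sigma>: "cmap T \<sigma> \<sigma>'"
  shows "CT 0 T (\<lambda>x t. g c (\<sigma> t))"
proof (rule CT0I)
  show "g c (\<sigma> (t + T)) = g c (\<sigma> t)" for t
    using \<sigma> CT0_periodic[OF g c] by (simp add: cmap_def)
  show "continuous_on strip (\<lambda>z. g c (\<sigma> (snd z)))"
    by (rule CT0_compose[OF g continuous_on_const
          continuous_on_compose2[OF cmap_continuous[OF \<sigma>, of UNIV] continuous_on_snd[OF continuous_on_id]]])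
      (use c in auto)
qed

lemma tC1_compose_cmap:
  assumes g: "tC1 T g" and c: "c \<in> {0..1}" and \<sigma>: "cmap T \<sigma> \<sigma>'"
  shows "tC1 T (\<lambda>x t. g c (\<sigma> t))"
proof (rule tC1I(1))
  show "CT 0 T (\<lambda>x t. g c (\<sigma> t))" by (rule CT0_compose_cmap[OF tC1_CT0[OF g] c \<sigma>])
  show "CT 0 T (\<lambda>x t. dt g c (\<sigma> t) * \<sigma>' t)"
    by (intro CT0_mult CT0_compose_cmap[OF tC1_CT0_dt[OF g] c \<sigma>]) (use \<sigma> in \<open>simp add: cmap_def\<close>)
  show "((\<lambda>s. g c (\<sigma> s)) has_real_derivative dt g c (\<sigma> t) * \<sigma>' t) (at t)" for t
    by (rule DERIV_chain2[OF tC1_deriv[OF g c]]) (use \<sigma> in \<open>simp add: cmap_def\<close>)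
qed

lemma cmap_compose:
  assumes "cmap T \<sigma> \<sigma>'" "cmap T \<rho> \<rho>'"
  shows "cmap T (\<lambda>t. \<sigma> (\<rho> t)) (\<lambda>t. \<sigma>' (\<rho> t) * \<rho>' t)"
  unfolding cmap_def
proof (intro conjI allI)
  show "\<sigma> (\<rho> (t + T)) = \<sigma> (\<rho> t) + T" for t using assms by (simp add: cmap_def)
  show "((\<lambda>t. \<sigma> (\<rho> t)) has_real_derivative \<sigma>' (\<rho> t) * \<rho>' t) (at t)" for t
    by (rule DERIV_chain2) (use assms in \<open>auto simp: cmap_def\<close>)
  show "CT 0 T (\<lambda>x t. \<sigma>' (\<rho> t) * \<rho>' t)"
    using assms by (intro CT0_mult CT0_compose_cmap[OF _ _ assms(2), where g = "\<lambda>x. \<sigma>'" and c = 0])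
      (auto simp: cmap_def)
qed

text \<open>Compactness of one period turns a strict pointwise bound into a uniform gap; the
  contraction rate below comes from here.\<close>

lemma CT0_uniform_less:
  assumes T: "T > 0" and g: "CT 0 T (\<lambda>x. g)" and less: "\<And>t. g t < c"
  obtains q where "q < c" "\<And>t. g t \<le> q"
proof -
  have "continuous_on {0..T} g" using CT0_slice[OF g, of 0] by simp
  moreover have "{0..T} \<noteq> {}" using T by simp
  ultimately obtain s where s: "\<And>t. t \<in> {0..T} \<Longrightarrow> g t \<le> g s"
    using continuous_attains_sup[OF compact_Icc, of 0 T g] by blast
  have "g t \<le> g s" for t
  proof -
    obtain n where n: "t + of_int n * T \<in> {0..T}" using shift_to_period[OF T] .
    have "g (t + of_int n * T) = g t"
      by (rule periodic_of_int) (use CT0_periodic[OF g, of 0] in simp)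
    then show ?thesis using s[OF n] by simp
  qed
  then show thesis using that less by blast
qed

lemma CT0_bounded_circle:
  assumes T: "T > 0" and g: "CT 0 T (\<lambda>x. g)"
  obtains M where "M \<ge> 0" "\<And>t. \<bar>g t\<bar> \<le> M"
proof -
  obtain M where M: "M \<ge> 0" "\<And>x t. x \<in> {0..1::real} \<Longrightarrow> \<bar>g t\<bar> \<le> M" using CT0_bounded[OF T g] by blast
  show thesis by (rule that[OF M(1)]) (use M(2)[of 0] in simp)
qed

lemma periodic_derivative:
  fixes g :: "real \<Rightarrow> real"
  assumes "\<And>t. g (t + T) = g t" "\<And>t. (g has_real_derivative g' t) (at t)"
  shows "g' (t + T) = g' t"
proof (rule DERIV_unique)
  show "((\<lambda>s. g (s + T)) has_real_derivative g' (t + T)) (at t)"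
    using assms(2)[of "t + T"] by (simp add: DERIV_shift)
  show "((\<lambda>s. g (s + T)) has_real_derivative g' t) (at t)"
    using assms by simp
qed

text \<open>Iterating the equation gives the series of the functions \<open>f n\<close>, each a
  product of \<open>n\<close> factors \<open>\<kappa>\<close> along the orbit with
  \<open>\<rho>\<close> at its end. The bound on \<open>\<kappa>\<close> makes it converge; the
  bound on \<open>\<kappa> * \<sigma>'\<close> makes the differentiated series converge uniformly,
  so it may be differentiated term by term.\<close>

lemma circle_equation_tC1_contracting:
  fixes \<phi> \<kappa> \<sigma> \<sigma>' \<rho> :: "real \<Rightarrow> real"
  assumes T: "T > 0" and \<kappa>: "tC1 T (\<lambda>x. \<kappa>)" and \<rho>: "tC1 T (\<lambda>x. \<rho>)" and \<sigma>: "cmap T \<sigma> \<sigma>'"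
    and \<phi>: "CT 0 T (\<lambda>x. \<phi>)" and eq: "\<And>t. \<phi> t = \<kappa> t * \<phi> (\<sigma> t) + \<rho> t"
    and \<kappa>1: "\<And>t. \<bar>\<kappa> t\<bar> < 1" and \<kappa>\<sigma>: "\<And>t. \<bar>\<kappa> t * \<sigma>' t\<bar> < 1"
  shows "tC1 T (\<lambda>x. \<phi>)"
proof -
  define \<kappa>' where "\<kappa>' = dt (\<lambda>x. \<kappa>) 0"
  define \<rho>' where "\<rho>' = dt (\<lambda>x. \<rho>) 0"
  have \<kappa>'0: "CT 0 T (\<lambda>x. \<kappa>')" and \<rho>'0: "CT 0 T (\<lambda>x. \<rho>')"
    using CT0_trace[OF tC1_CT0_dt[OF \<kappa>], of 0] CT0_trace[OF tC1_CT0_dt[OF \<rho>], of 0]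
    by (simp_all add: \<kappa>'_def \<rho>'_def)
  have d\<kappa>: "(\<kappa> has_real_derivative \<kappa>' t) (at t)" for t
    using tC1_deriv[OF \<kappa>, of 0 t] by (simp add: \<kappa>'_def)
  have d\<rho>: "(\<rho> has_real_derivative \<rho>' t) (at t)" for t
    using tC1_deriv[OF \<rho>, of 0 t] by (simp add: \<rho>'_def)
  have d\<sigma>: "(\<sigma> has_real_derivative \<sigma>' t) (at t)" for t using \<sigma> by (simp add: cmap_def)
  have \<sigma>'0: "CT 0 T (\<lambda>x. \<sigma>')" using \<sigma> by (simp add: cmap_def)
  have abs0: "CT 0 T (\<lambda>x t. \<bar>g t\<bar>)" if "CT 0 T (\<lambda>x. g)" for g
    by (rule CT0I[OF _ continuous_on_rabs[OF CT0_continuous[OF that]]])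
      (use CT0_periodic[OF that, of 0] in simp)
  obtain q1 where q1: "q1 < 1" "\<And>t. \<bar>\<kappa> t\<bar> \<le> q1"
    using CT0_uniform_less[OF T abs0[OF tC1_CT0[OF \<kappa>]] \<kappa>1] by blast
  obtain q2 where q2: "q2 < 1" "\<And>t. \<bar>\<kappa> t * \<sigma>' t\<bar> \<le> q2"
    using CT0_uniform_less[OF T abs0[OF CT0_mult[OF tC1_CT0[OF \<kappa>] \<sigma>'0]] \<kappa>\<sigma>] by blast
  define q where "q = max q1 q2"
  have q: "0 \<le> q" "q < 1" "\<And>t. \<bar>\<kappa> t\<bar> \<le> q" "\<And>t. \<bar>\<kappa> t * \<sigma>' t\<bar> \<le> q"
    using q1(1) q2(1) order_trans[OF abs_ge_zero q1(2)[of 0]] order_trans[OF q1(2) max.cobounded1]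
      order_trans[OF q2(2) max.cobounded2] by (simp_all add: q_def)
  \<comment> \<open>Besides the factor \<open>q\<close>, the recursion for \<open>f'\<close> has a
    source \<open>\<kappa>' * f n\<close> of size \<open>q ^ n\<close>; a rate strictly between
    \<open>q\<close> and 1 absorbs it.\<close>
  define r where "r = (1 + q) / 2"
  have r: "q < r" "r < 1" "0 \<le> r" using q by (auto simp: r_def)
  obtain A where A: "A \<ge> 0" "\<And>t. \<bar>\<rho> t\<bar> \<le> A"
    using CT0_bounded_circle[OF T tC1_CT0[OF \<rho>]] by blast
  obtain B where B: "B \<ge> 0" "\<And>t. \<bar>\<rho>' t\<bar> \<le> B"
    using CT0_bounded_circle[OF T \<rho>'0] by blast
  obtain M where M: "M \<ge> 0" "\<And>t. \<bar>\<kappa>' t\<bar> \<le> M"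
    using CT0_bounded_circle[OF T \<kappa>'0] by blast
  obtain F where F: "F \<ge> 0" "\<And>t. \<bar>\<phi> t\<bar> \<le> F"
    using CT0_bounded_circle[OF T \<phi>] by blast
  \<comment> \<open>Large enough for the start, \<open>B \<le> K\<close>, and for the induction
    step, \<open>M * A + q * K \<le> K * r\<close>.\<close>
  define K where "K = B + M * A / (r - q)"
  have "M * A / (r - q) \<ge> 0" using A(1) M(1) r(1) by simp
  then have K: "K \<ge> 0" "B \<le> K" using B(1) by (simp_all add: K_def)
  have "K * (r - q) = B * (r - q) + M * A" using r(1) by (simp add: K_def distrib_right)
  moreover have "B * (r - q) \<ge> 0" using B(1) r(1) by simp
  ultimately have K3: "M * A + q * K \<le> K * r" by (simp add: algebra_simps)
  define f where "f = rec_nat \<rho> (\<lambda>n f t. \<kappa> t * f (\<sigma> t))"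
  have f0: "f 0 = \<rho>" and fS: "f (Suc n) = (\<lambda>t. \<kappa> t * f n (\<sigma> t))" for n by (simp_all add: f_def)
  define f' where "f' = rec_nat \<rho>' (\<lambda>n g t. \<kappa>' t * f n (\<sigma> t) + \<kappa> t * (g (\<sigma> t) * \<sigma>' t))"
  have f'0: "f' 0 = \<rho>'" and f'S: "f' (Suc n) = (\<lambda>t. \<kappa>' t * f n (\<sigma> t) + \<kappa> t * (f' n (\<sigma> t) * \<sigma>' t))" for n
    by (simp_all add: f'_def)
  have df: "(f n has_real_derivative f' n t) (at t)" for n t
  proof (induction n arbitrary: t)
    case (Suc n)
    have "((\<lambda>t. f n (\<sigma> t)) has_real_derivative f' n (\<sigma> t) * \<sigma>' t) (at t)"
      by (rule DERIV_chain2[OF Suc d\<sigma>])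
    from DERIV_mult[OF d\<kappa> this] show ?case by (simp add: fS f'S algebra_simps)
  qed (simp add: f0 f'0 d\<rho>)
  have cf': "continuous_on UNIV (f' n)" for n
  proof (induction n)
    case 0
    show ?case using CT0_slice[OF \<rho>'0, of 0] by (simp add: f'0)
  next
    case (Suc n)
    have 1: "continuous_on UNIV \<kappa>" "continuous_on UNIV \<kappa>'" "continuous_on UNIV \<sigma>'"
      using CT0_slice[OF tC1_CT0[OF \<kappa>], of 0] CT0_slice[OF \<kappa>'0, of 0] CT0_slice[OF \<sigma>'0, of 0] by auto
    have fn: "continuous_on UNIV (f n)"
      by (rule continuous_at_imp_continuous_on) (rule ballI, rule DERIV_isCont[OF df])
    have 2: "continuous_on UNIV (\<lambda>t. f n (\<sigma> t))" "continuous_on UNIV (\<lambda>t. f' n (\<sigma> t))"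
      by (rule continuous_on_compose2[OF fn cmap_continuous[OF \<sigma>]]
          continuous_on_compose2[OF Suc cmap_continuous[OF \<sigma>]], simp)+
    show ?case unfolding f'S by (intro continuous_intros 1 2)
  qed
  have bf: "\<bar>f n t\<bar> \<le> A * q ^ n" for n t
  proof (induction n arbitrary: t)
    case (Suc n)
    have "\<bar>\<kappa> t\<bar> * \<bar>f n (\<sigma> t)\<bar> \<le> q * (A * q ^ n)"
      using q A(1) by (intro mult_mono Suc) auto
    then show ?case by (simp add: fS abs_mult mult_ac)
  qed (simp add: f0 A)
  have bf': "\<bar>f' n t\<bar> \<le> K * r ^ n" for n t
  proof (induction n arbitrary: t)
    case 0
    show ?case using B(2)[of t] K(2) by (simp add: f'0)
  next
    case (Suc n)
    have "\<bar>\<kappa>' t\<bar> * \<bar>f n (\<sigma> t)\<bar> \<le> M * (A * r ^ n)"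
    proof (rule mult_mono)
      have "A * q ^ n \<le> A * r ^ n" using A(1) q r by (intro mult_left_mono power_mono) auto
      then show "\<bar>f n (\<sigma> t)\<bar> \<le> A * r ^ n" using bf[of n "\<sigma> t"] by linarith
    qed (use M in auto)
    moreover have "\<bar>\<kappa> t * \<sigma>' t\<bar> * \<bar>f' n (\<sigma> t)\<bar> \<le> q * (K * r ^ n)"
      using q K by (intro mult_mono Suc) auto
    moreover have "\<bar>f' (Suc n) t\<bar> \<le> \<bar>\<kappa>' t\<bar> * \<bar>f n (\<sigma> t)\<bar> + \<bar>\<kappa> t * \<sigma>' t\<bar> * \<bar>f' n (\<sigma> t)\<bar>"
      unfolding f'S using abs_triangle_ineq[of "\<kappa>' t * f n (\<sigma> t)" "\<kappa> t * (f' n (\<sigma> t) * \<sigma>' t)"]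
      by (simp add: abs_mult mult_ac)
    moreover have "(M * A + q * K) * r ^ n \<le> (K * r) * r ^ n"
      using K3 r by (intro mult_right_mono) auto
    ultimately show ?case by (simp add: algebra_simps)
  qed
  have ul: "uniform_limit UNIV (\<lambda>n t. \<Sum>i<n. f' i t) (\<lambda>t. \<Sum>i. f' i t) sequentially"
  proof (rule Weierstrass_m_test)
    show "norm (f' n t) \<le> K * r ^ n" for n t
      unfolding real_norm_def by (rule bf')
    show "summable (\<lambda>n. K * r ^ n)" using r by (simp add: summable_mult summable_geometric)
  qed
  have sm: "summable (\<lambda>n. f n 0)"
  proof (rule summable_comparison_test')
    show "norm (f n 0) \<le> A * q ^ n" if "n \<ge> 0" for n
      unfolding real_norm_def by (rule bf)
    show "summable (\<lambda>n. A * q ^ n)" using q(1,2) by (simp add: summable_mult summable_geometric)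
  qed
  have "\<exists>g. \<forall>t\<in>UNIV. (\<lambda>n. f n t) sums g t \<and> (g has_real_derivative (\<Sum>i. f' i t)) (at t)"
    by (rule has_field_derivative_series[OF convex_UNIV df ul UNIV_I sm])
  then obtain g where "\<forall>t\<in>UNIV. (\<lambda>n. f n t) sums g t \<and> (g has_real_derivative (\<Sum>i. f' i t)) (at t)"
    by (rule exE)
  then have g: "\<And>t. (\<lambda>n. f n t) sums g t" "\<And>t. (g has_real_derivative (\<Sum>i. f' i t)) (at t)"
    by simp_all
  \<comment> \<open>After \<open>n\<close> substitutions the remainder is a product of
    \<open>n\<close> factors \<open>\<kappa>\<close> times a value of the bounded function
    \<open>\<phi>\<close>; hence \<open>\<phi>\<close> is the sum of the series.\<close>
  have rem: "\<bar>\<phi> t - (\<Sum>i<n. f i t)\<bar> \<le> F * q ^ n" for n t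
  proof (induction n arbitrary: t)
    case (Suc n)
    have "\<phi> t - (\<Sum>i<Suc n. f i t) = \<kappa> t * (\<phi> (\<sigma> t) - (\<Sum>i<n. f i (\<sigma> t)))"
      unfolding sum.lessThan_Suc_shift
      by (subst eq[of t]) (simp add: f0 fS sum_distrib_left right_diff_distrib)
    moreover have "\<bar>\<kappa> t\<bar> * \<bar>\<phi> (\<sigma> t) - (\<Sum>i<n. f i (\<sigma> t))\<bar> \<le> q * (F * q ^ n)"
      using q F(1) by (intro mult_mono Suc) auto
    ultimately show ?case by (simp add: abs_mult mult_ac)
  qed (simp add: F)
  have "\<phi> = g"
  proof
    fix t
    have "(\<lambda>n. q ^ n) \<longlonglongrightarrow> 0" using q(1,2) by (intro LIMSEQ_power_zero) simp
    from tendsto_mult[OF tendsto_const[of F] this]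
    have lim: "(\<lambda>n. F * q ^ n) \<longlonglongrightarrow> 0" by simp
    have "(\<lambda>n. \<phi> t - (\<Sum>i<n. f i t)) \<longlonglongrightarrow> 0"
      by (rule Lim_null_comparison[OF always_eventually lim]) (simp add: rem)
    moreover have "(\<lambda>n. \<phi> t - (\<Sum>i<n. f i t)) \<longlonglongrightarrow> \<phi> t - g t"
      by (rule tendsto_diff[OF tendsto_const g(1)[of t, unfolded sums_def]])
    ultimately have "0 = \<phi> t - g t" by (rule LIMSEQ_unique)
    then show "\<phi> t = g t" by simp
  qed
  then have d\<phi>: "(\<phi> has_real_derivative (\<Sum>i. f' i t)) (at t)" for t using g(2) by simp
  show ?thesis
  proof (rule tC1I(1)[OF \<phi> _ d\<phi>])
    have per: "(\<Sum>i. f' i (t + T)) = (\<Sum>i. f' i t)" for t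
      by (rule periodic_derivative[OF _ d\<phi>]) (use CT0_periodic[OF \<phi>, of 0] in simp)
    have "continuous_on UNIV (\<lambda>t. \<Sum>i. f' i t)"
      by (rule uniform_limit_theorem[OF always_eventually ul])
        (intro allI continuous_on_sum cf', simp)
    then have "continuous_on strip (\<lambda>z. \<Sum>i. f' i (snd z))"
      by (rule continuous_on_compose2[OF _ continuous_on_snd[OF continuous_on_id]]) simp
    then show "CT 0 T (\<lambda>x t. \<Sum>i. f' i t)" by (intro CT0I) (simp_all add: per)
  qed
qed

text \<open>In the expanding case the equation is solved for \<open>\<phi>\<close> at the image point, and
  the contracting case applies to the inverse map.\<close>

lemma circle_equation_tC1:
  fixes \<phi> \<kappa> \<sigma> \<sigma>' \<rho> :: "real \<Rightarrow> real"
  assumes T: "T > 0" and \<kappa>: "tC1 T (\<lambda>x. \<kappa>)" and \<rho>: "tC1 T (\<lambda>x. \<rho>)" and \<sigma>: "cmap T \<sigma> \<sigma>'"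
    and \<tau>: "cmap T \<tau> \<tau>'" "\<And>t. \<sigma> (\<tau> t) = t"
    and \<phi>: "CT 0 T (\<lambda>x. \<phi>)" and eq: "\<And>t. \<phi> t = \<kappa> t * \<phi> (\<sigma> t) + \<rho> t"
    and pos: "\<And>t. \<kappa> t > 0" "\<And>t. \<sigma>' t > 0"
    and cases: "(\<forall>t. \<kappa> t < 1 \<and> \<kappa> t * \<sigma>' t < 1) \<or> (\<forall>t. \<kappa> t > 1 \<and> \<kappa> t * \<sigma>' t > 1)"
  shows "tC1 T (\<lambda>x. \<phi>)"
  using cases
proof
  assume *: "\<forall>t. \<kappa> t < 1 \<and> \<kappa> t * \<sigma>' t < 1"
  show ?thesis
    by (rule circle_equation_tC1_contracting[OF T \<kappa> \<rho> \<sigma> \<phi> eq])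
      (use * pos in \<open>auto simp: abs_mult less_imp_le\<close>)
next
  assume *: "\<forall>t. \<kappa> t > 1 \<and> \<kappa> t * \<sigma>' t > 1"
  have "((\<lambda>t. \<sigma> (\<tau> t)) has_real_derivative \<sigma>' (\<tau> t) * \<tau>' t) (at t)" for t
    by (rule DERIV_chain2) (use \<sigma> \<tau> in \<open>auto simp: cmap_def\<close>)
  then have inv: "\<sigma>' (\<tau> t) * \<tau>' t = 1" for t
    unfolding \<tau>(2) by (rule DERIV_unique) (rule DERIV_ident)
  have \<kappa>\<tau>: "tC1 T (\<lambda>x t. \<kappa> (\<tau> t))" and \<rho>\<tau>: "tC1 T (\<lambda>x t. \<rho> (\<tau> t))"
    using tC1_compose_cmap[OF \<kappa> _ \<tau>(1), of 0] tC1_compose_cmap[OF \<rho> _ \<tau>(1), of 0] by auto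
  have nz: "\<kappa> t \<noteq> 0" for t using pos(1)[of t] by simp
  show ?thesis
  proof (rule circle_equation_tC1_contracting[OF T _ _ \<tau>(1) \<phi>])
    show "tC1 T (\<lambda>x t. 1 / \<kappa> (\<tau> t))" by (intro tC1_divide tC1_const \<kappa>\<tau> nz)
    show "tC1 T (\<lambda>x t. (-1) * (\<rho> (\<tau> t) / \<kappa> (\<tau> t)))" by (intro tC1_cmult(1) tC1_divide \<kappa>\<tau> \<rho>\<tau> nz)
    show "\<phi> t = 1 / \<kappa> (\<tau> t) * \<phi> (\<tau> t) + (-1) * (\<rho> (\<tau> t) / \<kappa> (\<tau> t))" for t
      using eq[of "\<tau> t"] nz[of "\<tau> t"] by (simp add: \<tau>(2) field_simps)
    show "\<bar>1 / \<kappa> (\<tau> t)\<bar> < 1" for t using * pos(1)[of "\<tau> t"] by simp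
    show "\<bar>1 / \<kappa> (\<tau> t) * \<tau>' t\<bar> < 1" for t
    proof -
      have "\<tau>' t = 1 / \<sigma>' (\<tau> t)" using inv[of t] pos(2)[of "\<tau> t"] by (simp add: field_simps)
      then have "1 / \<kappa> (\<tau> t) * \<tau>' t = 1 / (\<kappa> (\<tau> t) * \<sigma>' (\<tau> t))" by simp
      moreover have "\<kappa> (\<tau> t) * \<sigma>' (\<tau> t) > 1" using * by simp
      ultimately show ?thesis by simp
    qed
  qed
qed

section \<open>Calculus of \<open>C\<^sup>k\<close> functions on the strip\<close>

definition has_partials :: "(real \<Rightarrow> real \<Rightarrow> real) \<Rightarrow> (real \<Rightarrow> real \<Rightarrow> real) \<Rightarrow> (real \<Rightarrow> real \<Rightarrow> real) \<Rightarrow> bool" where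
  "has_partials g gx gt \<longleftrightarrow> (\<forall>x\<in>{0..1}. \<forall>t. ((\<lambda>z. g (fst z) (snd z)) has_derivative
      (\<lambda>h. gx x t * fst h + gt x t * snd h)) (at (x, t) within strip))"

lemma has_partialsI: "(\<And>x t. x \<in> {0..1} \<Longrightarrow> ((\<lambda>z. g (fst z) (snd z)) has_derivative
    (\<lambda>h. gx x t * fst h + gt x t * snd h)) (at (x, t) within strip)) \<Longrightarrow> has_partials g gx gt"
  by (simp add: has_partials_def)

lemma has_partialsD: "has_partials g gx gt \<Longrightarrow> x \<in> {0..1} \<Longrightarrow> ((\<lambda>z. g (fst z) (snd z)) has_derivative
    (\<lambda>h. gx x t * fst h + gt x t * snd h)) (at (x, t) within strip)"
  by (simp add: has_partials_def)

lemma has_partials_cong: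
  assumes "has_partials g gx gt" and eq: "\<And>x t. x \<in> {0..1} \<Longrightarrow> h x t = g x t"
  shows "has_partials h gx gt"
proof (rule has_partialsI, rule has_derivative_transform)
  fix x t :: real assume x: "x \<in> {0..1}"
  show "(x, t) \<in> strip" using x by (simp add: strip_def)
  show "h (fst z) (snd z) = g (fst z) (snd z)" if "z \<in> strip" for z
    by (rule eq) (use that in \<open>auto simp: strip_def\<close>)
  show "((\<lambda>z. g (fst z) (snd z)) has_derivative (\<lambda>h. gx x t * fst h + gt x t * snd h)) (at (x, t) within strip)"
    by (rule has_partialsD[OF assms(1) x])
qed

lemma Ck_Suc_iff: "Ck (Suc n) g \<longleftrightarrow> (\<exists>gx gt. has_partials g gx gt \<and> Ck n gx \<and> Ck n gt)"
  by (simp add: has_partials_def)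

lemma Ck_SucI: "has_partials g gx gt \<Longrightarrow> Ck n gx \<Longrightarrow> Ck n gt \<Longrightarrow> Ck (Suc n) g"
  unfolding Ck_Suc_iff by blast

lemma Ck_SucE:
  assumes "Ck (Suc n) g"
  obtains gx gt where "has_partials g gx gt" "Ck n gx" "Ck n gt"
  using assms unfolding Ck_Suc_iff by blast

lemma Ck_cong:
  assumes "Ck n g" "\<And>x t. x \<in> {0..1} \<Longrightarrow> h x t = g x t"
  shows "Ck n h"
proof (cases n)
  case 0
  have "continuous_on strip (\<lambda>z. h (fst z) (snd z)) \<longleftrightarrow> continuous_on strip (\<lambda>z. g (fst z) (snd z))"
    by (rule continuous_on_cong) (auto simp: strip_def assms(2))
  then show ?thesis using assms(1) 0 by simp
next
  case (Suc m)
  obtain gx gt where g: "has_partials g gx gt" "Ck m gx" "Ck m gt"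
    using assms(1) unfolding Suc by (rule Ck_SucE)
  show ?thesis unfolding Suc by (rule Ck_SucI[OF has_partials_cong[OF g(1) assms(2)] g(2,3)])
qed

lemma Ck_Suc_imp: "Ck (Suc n) g \<Longrightarrow> Ck n g"
proof (induction n arbitrary: g)
  case 0
  from 0 obtain gx gt where gp: "has_partials g gx gt" "Ck 0 gx" "Ck 0 gt"
    by (rule Ck_SucE)
  have "continuous_on strip (\<lambda>z. g (fst z) (snd z))"
  proof (rule has_derivative_continuous_on[where f' = "\<lambda>z h. gx (fst z) (snd z) * fst h + gt (fst z) (snd z) * snd h"])
    fix z assume "z \<in> strip"
    then have "fst z \<in> {0..1}" by (auto simp: strip_def)
    from has_partialsD[OF gp(1) this, of "snd z"]
    show "((\<lambda>z. g (fst z) (snd z)) has_derivative (\<lambda>h. gx (fst z) (snd z) * fst h + gt (fst z) (snd z) * snd h))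
        (at z within strip)" by simp
  qed
  then show ?case by simp
next
  case (Suc n)
  from Suc.prems obtain gx gt where g: "has_partials g gx gt" "Ck (Suc n) gx" "Ck (Suc n) gt"
    by (rule Ck_SucE)
  show ?case by (rule Ck_SucI[OF g(1) Suc.IH[OF g(2)] Suc.IH[OF g(3)]])
qed

lemma Ck_mono: "m \<le> n \<Longrightarrow> Ck n g \<Longrightarrow> Ck m g"
  by (induction n rule: dec_induct) (auto intro: Ck_Suc_imp simp del: Ck.simps)

lemma Ck_const: "Ck n (\<lambda>x t. c)"
proof (induction n arbitrary: c)
  case (Suc n)
  show ?case by (rule Ck_SucI[OF has_partialsI Suc[of 0] Suc[of 0]]) simp
qed simp

lemma Ck_add: "Ck n g \<Longrightarrow> Ck n h \<Longrightarrow> Ck n (\<lambda>x t. g x t + h x t)"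
proof (induction n arbitrary: g h)
  case 0
  then show ?case by (simp add: continuous_on_add)
next
  case (Suc n)
  from Suc.prems(1) obtain gx gt where g: "has_partials g gx gt" "Ck n gx" "Ck n gt"
    by (rule Ck_SucE)
  from Suc.prems(2) obtain hx ht where h: "has_partials h hx ht" "Ck n hx" "Ck n ht"
    by (rule Ck_SucE)
  show ?case
  proof (rule Ck_SucI[OF has_partialsI Suc.IH[OF g(2) h(2)] Suc.IH[OF g(3) h(3)]])
    fix x t :: real assume x: "x \<in> {0..1}"
    show "((\<lambda>z. g (fst z) (snd z) + h (fst z) (snd z)) has_derivative
        (\<lambda>k. (gx x t + hx x t) * fst k + (gt x t + ht x t) * snd k)) (at (x, t) within strip)"
      using has_derivative_add[OF has_partialsD[OF g(1) x] has_partialsD[OF h(1) x]] by (simp add: algebra_simps)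
  qed
qed

lemma Ck_mult: "Ck n g \<Longrightarrow> Ck n h \<Longrightarrow> Ck n (\<lambda>x t. g x t * h x t)"
proof (induction n arbitrary: g h)
  case 0
  then show ?case by (simp add: continuous_on_mult)
next
  case (Suc n)
  from Suc.prems(1) obtain gx gt where g: "has_partials g gx gt" "Ck n gx" "Ck n gt"
    by (rule Ck_SucE)
  from Suc.prems(2) obtain hx ht where h: "has_partials h hx ht" "Ck n hx" "Ck n ht"
    by (rule Ck_SucE)
  note g0 = Ck_Suc_imp[OF Suc.prems(1)] and h0 = Ck_Suc_imp[OF Suc.prems(2)]
  show ?case
  proof (rule Ck_SucI[OF has_partialsI Ck_add[OF Suc.IH[OF g(2) h0] Suc.IH[OF g0 h(2)]]
        Ck_add[OF Suc.IH[OF g(3) h0] Suc.IH[OF g0 h(3)]]])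
    fix x t :: real assume x: "x \<in> {0..1}"
    show "((\<lambda>z. g (fst z) (snd z) * h (fst z) (snd z)) has_derivative
        (\<lambda>k. (gx x t * h x t + g x t * hx x t) * fst k + (gt x t * h x t + g x t * ht x t) * snd k))
        (at (x, t) within strip)"
      using has_derivative_mult[OF has_partialsD[OF g(1) x] has_partialsD[OF h(1) x]] by (simp add: algebra_simps)
  qed
qed

lemma Ck_inverse:
  "Ck n g \<Longrightarrow> (\<And>x t. x \<in> {0..1} \<Longrightarrow> g x t \<noteq> 0) \<Longrightarrow> Ck n (\<lambda>x t. inverse (g x t))"
proof (induction n arbitrary: g)
  case 0
  then show ?case by (auto simp: strip_def intro!: continuous_on_inverse)
next
  case (Suc n)
  from Suc.prems(1) obtain gx gt where g: "has_partials g gx gt" "Ck n gx" "Ck n gt"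
    by (rule Ck_SucE)
  have i: "Ck n (\<lambda>x t. inverse (g x t))" by (rule Suc.IH[OF Ck_Suc_imp[OF Suc.prems(1)] Suc.prems(2)])
  have j: "Ck n (\<lambda>x t. (- 1) * (inverse (g x t) * inverse (g x t)))"
    by (intro Ck_mult Ck_const i)
  show ?case
  proof (rule Ck_SucI[OF has_partialsI Ck_mult[OF j g(2)] Ck_mult[OF j g(3)]])
    fix x t :: real assume x: "x \<in> {0..1}"
    show "((\<lambda>z. inverse (g (fst z) (snd z))) has_derivative
        (\<lambda>k. (- 1) * (inverse (g x t) * inverse (g x t)) * gx x t * fst k
           + (- 1) * (inverse (g x t) * inverse (g x t)) * gt x t * snd k)) (at (x, t) within strip)"
      using Deriv.has_derivative_inverse[OF _ has_partialsD[OF g(1) x]] Suc.prems(2)[OF x] by (simp add: algebra_simps)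
  qed
qed

lemma Ck_lift: "Ck1 n r \<Longrightarrow> Ck n (\<lambda>x t. r t)"
proof (induction n arbitrary: r)
  case 0
  then have "continuous_on UNIV r" by simp
  then have "continuous_on strip (\<lambda>z. r (snd z))"
    by (rule continuous_on_compose2[OF _ continuous_on_snd[OF continuous_on_id]]) simp
  then show ?case by simp
next
  case (Suc n)
  then obtain r' where r': "\<And>t. (r has_real_derivative r' t) (at t)" "Ck1 n r'" by auto
  show ?case
  proof (rule Ck_SucI[OF has_partialsI Ck_const[of n 0] Suc.IH[OF r'(2)]])
    fix x t :: real
    have "(r has_derivative (\<lambda>k. r' t * k)) (at (snd (x, t)))"
      using r'(1)[of t] by (simp add: has_field_derivative_def)
    from has_derivative_compose[OF has_derivative_snd[OF has_derivative_ident] this]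
    show "((\<lambda>z. r (snd z)) has_derivative (\<lambda>k. 0 * fst k + r' t * snd k)) (at (x, t) within strip)"
      by simp
  qed
qed

lemma has_derivative_trace:
  assumes g: "((\<lambda>z. g (fst z) (snd z)) has_derivative (\<lambda>h. gx * fst h + gt * snd h)) (at (c, t) within strip)"
    and c: "c \<in> {0..1}" and that: "snd z = t"
  shows "((\<lambda>z. g c (snd z)) has_derivative (\<lambda>h. gt * snd h)) (at z within S)"
proof -
  have "((\<lambda>z. (c, snd z)) has_derivative (\<lambda>h. (0, snd h))) (at z within S)"
    by (intro has_derivative_Pair has_derivative_const has_derivative_snd has_derivative_ident)
  moreover have "((\<lambda>z. g (fst z) (snd z)) has_derivative (\<lambda>h. gx * fst h + gt * snd h))
      (at (c, snd z) within (\<lambda>z. (c, snd z)) ` S)"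
    using g unfolding that by (rule has_derivative_subset) (use c in \<open>auto simp: strip_def\<close>)
  ultimately have "((\<lambda>z. g (fst (c, snd z)) (snd (c, snd z))) has_derivative
      (\<lambda>h. gx * fst (0, snd h) + gt * snd (0::real, snd h))) (at z within S)"
    by (rule has_derivative_in_compose)
  then show ?thesis by simp
qed

lemma Ck_trace:
  assumes c: "c \<in> {0..1}"
  shows "Ck n g \<Longrightarrow> Ck n (\<lambda>x t. g c t)"
proof (induction n arbitrary: g)
  case 0
  have "continuous_on strip (\<lambda>z. g c (snd z))"
    by (rule continuous_on_strip_compose[OF 0 continuous_on_const continuous_on_snd[OF continuous_on_id]])
      (use c in auto)
  then show ?case by simp
next
  case (Suc n)
  from Suc.prems(1) obtain gx gt where g: "has_partials g gx gt" "Ck n gx" "Ck n gt"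
    by (rule Ck_SucE)
  show ?case
  proof (rule Ck_SucI[OF has_partialsI Ck_const[of n 0] Suc.IH[OF g(3)]])
    fix x t :: real
    show "((\<lambda>z. g c (snd z)) has_derivative (\<lambda>h. 0 * fst h + gt c t * snd h)) (at (x, t) within strip)"
      using has_derivative_trace[OF has_partialsD[OF g(1) c, of t] c, of "(x, t)" strip] by simp
  qed
qed

section \<open>Periodic \<open>C\<^sup>k\<close> functions and their partial derivatives\<close>

lemma CT_iff: "CT n T g \<longleftrightarrow> (\<forall>x\<in>{0..1}. \<forall>t. g x (t + T) = g x t) \<and> Ck n g"
  by (simp add: CT_def periodicT_def)

lemma CT_periodic: "CT n T g \<Longrightarrow> x \<in> {0..1} \<Longrightarrow> g x (t + T) = g x t"
  by (simp add: CT_iff)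

lemma CT_cong: "CT n T g \<Longrightarrow> (\<And>x t. x \<in> {0..1} \<Longrightarrow> h x t = g x t) \<Longrightarrow> CT n T h"
  unfolding CT_iff by (auto intro: Ck_cong)

lemma CT_mono: "m \<le> n \<Longrightarrow> CT n T g \<Longrightarrow> CT m T g"
  unfolding CT_iff by (auto intro: Ck_mono)

lemma CT_const: "CT n T (\<lambda>x t. c)"
  by (simp add: CT_iff Ck_const)

lemma CT_add: "CT n T g \<Longrightarrow> CT n T h \<Longrightarrow> CT n T (\<lambda>x t. g x t + h x t)"
  by (simp add: CT_iff Ck_add)

lemma CT_mult: "CT n T g \<Longrightarrow> CT n T h \<Longrightarrow> CT n T (\<lambda>x t. g x t * h x t)"
  by (simp add: CT_iff Ck_mult)

lemma CT_minus: "CT n T g \<Longrightarrow> CT n T (\<lambda>x t. - g x t)"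
  using CT_mult[OF CT_const[of n T "-1"]] by simp

lemma CT_diff: "CT n T g \<Longrightarrow> CT n T h \<Longrightarrow> CT n T (\<lambda>x t. g x t - h x t)"
  using CT_add[OF _ CT_minus] by simp

lemma CT_divide:
  "CT n T g \<Longrightarrow> CT n T h \<Longrightarrow> (\<And>x t. x \<in> {0..1} \<Longrightarrow> h x t \<noteq> 0) \<Longrightarrow> CT n T (\<lambda>x t. g x t / h x t)"
  unfolding divide_inverse by (intro CT_mult) (auto simp: CT_iff intro: Ck_inverse)

lemma CT_trace: "CT n T g \<Longrightarrow> c \<in> {0..1} \<Longrightarrow> CT n T (\<lambda>x t. g c t)"
  by (simp add: CT_iff Ck_trace)

lemma CT_lift: "CT1 n T r \<Longrightarrow> CT n T (\<lambda>x t. r t)"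
  by (simp add: CT_iff CT1_def periodic1_def Ck_lift)

text \<open>In \<open>Ck\<close> partial derivatives are only asserted to exist. Restriction to the
  two lines through the point identifies them with \<open>dt\<close> and \<open>dx\<close>; at the
  end points of \<open>{0..1}\<close> the one-sided derivative is unique because the interval is
  nondegenerate.\<close>

lemma has_derivative_slices:
  assumes g: "((\<lambda>z. g (fst z) (snd z)) has_derivative (\<lambda>h. gx * fst h + gt * snd h)) (at (x, t) within strip)"
    and x: "x \<in> {0..1}"
  shows "(g x has_real_derivative gt) (at t)" and "dt g x t = gt" and "dx g x t = gx"
proof -
  have "((\<lambda>s. (x, s)) has_derivative (\<lambda>k. (0, k))) (at t)"
    by (intro has_derivative_Pair has_derivative_const has_derivative_ident)
  moreover have "((\<lambda>z. g (fst z) (snd z)) has_derivative (\<lambda>h. gx * fst h + gt * snd h))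
      (at (x, t) within range (\<lambda>s. (x, s)))"
    using g by (rule has_derivative_subset) (use x in \<open>auto simp: strip_def\<close>)
  ultimately have "((\<lambda>s. g (fst (x, s)) (snd (x, s))) has_derivative
      (\<lambda>k. gx * fst (0, k) + gt * snd (0::real, k))) (at t)"
    by (rule has_derivative_in_compose)
  then show d: "(g x has_real_derivative gt) (at t)" by (simp add: has_field_derivative_def)
  show "dt g x t = gt" unfolding dt_def by (rule DERIV_imp_deriv) (use d in simp)
  have "((\<lambda>y. (y, t)) has_derivative (\<lambda>k. (k, 0))) (at x within {0..1})"
    by (intro has_derivative_Pair has_derivative_const has_derivative_ident)
  moreover have "((\<lambda>z. g (fst z) (snd z)) has_derivative (\<lambda>h. gx * fst h + gt * snd h))
      (at (x, t) within (\<lambda>y. (y, t)) ` {0..1})"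
    using g by (rule has_derivative_subset) (auto simp: strip_def)
  ultimately have "((\<lambda>y. g (fst (y, t)) (snd (y, t))) has_derivative
      (\<lambda>k. gx * fst (k, 0::real) + gt * snd (k, 0))) (at x within {0..1})"
    by (rule has_derivative_in_compose)
  then have "((\<lambda>y. g y t) has_vector_derivative gx) (at x within cbox 0 1)"
    by (simp add: has_vector_derivative_def mult.commute)
  then show "dx g x t = gx"
    using x vector_derivative_within_cbox[of 0 1 x "\<lambda>y. g y t" gx] by (simp add: dx_def)
qed

lemma CT_Suc_deriv:
  assumes g: "CT (Suc n) T g"
  shows "CT n T (dt g)" and "CT n T (dx g)" and "tC1 T g"
    and "\<And>x t. x \<in> {0..1} \<Longrightarrow> ((\<lambda>z. g (fst z) (snd z)) has_derivative
      (\<lambda>h. dx g x t * fst h + dt g x t * snd h)) (at (x, t) within strip)"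
proof -
  have per: "g x (t + T) = g x t" if "x \<in> {0..1}" for x t by (rule CT_periodic[OF g that])
  have "Ck (Suc n) g" using g by (simp only: CT_iff)
  then obtain gx gt where h: "has_partials g gx gt" "Ck n gx" "Ck n gt"
    by (rule Ck_SucE)
  have s: "(g x has_real_derivative gt x t) (at t)" "dt g x t = gt x t" "dx g x t = gx x t"
    if "x \<in> {0..1}" for x t
    by (rule has_derivative_slices[OF has_partialsD[OF h(1) that] that])+
  have k: "Ck n (dt g)" "Ck n (dx g)"
    by (rule Ck_cong[OF h(3) s(2)] Ck_cong[OF h(2) s(3)], assumption)+
  have d: "(g x has_real_derivative dt g x t) (at t)" if "x \<in> {0..1}" for x t
    using s(1,2)[OF that] by simp
  have pt: "dt g x (t + T) = dt g x t" if "x \<in> {0..1}" for x t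
    by (rule periodic_derivative[OF per[OF that] d[OF that]])
  show D: "((\<lambda>z. g (fst z) (snd z)) has_derivative
      (\<lambda>h. dx g x t * fst h + dt g x t * snd h)) (at (x, t) within strip)" if "x \<in> {0..1}" for x t
    using has_partialsD[OF h(1) that] by (simp only: s(2,3)[OF that])
  \<comment> \<open>Periodicity of \<open>dx g\<close> comes from uniqueness: the shifted function
    equals \<open>g\<close> on the strip, so the total derivatives agree.\<close>
  have px: "dx g x (t + T) = dx g x t" if x: "x \<in> {0..1}" for x t
  proof -
    have "((\<lambda>z. (fst z, snd z + T)) has_derivative (\<lambda>h. (fst h, snd h))) (at (x, t) within strip)"
      by (auto intro!: derivative_eq_intros)
    moreover have "((\<lambda>z. g (fst z) (snd z)) has_derivative
        (\<lambda>h. dx g x (t + T) * fst h + dt g x (t + T) * snd h))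
        (at (fst (x, t), snd (x, t) + T) within (\<lambda>z. (fst z, snd z + T)) ` strip)"
      by (rule has_derivative_subset[of _ _ _ strip]) (use D[OF x] in simp, auto simp: strip_def)
    ultimately have "((\<lambda>z. g (fst (fst z, snd z + T)) (snd (fst z, snd z + T))) has_derivative
        (\<lambda>h. dx g x (t + T) * fst (fst h, snd h) + dt g x (t + T) * snd (fst h, snd h))) (at (x, t) within strip)"
      by (rule has_derivative_in_compose)
    note sh = this
    have "((\<lambda>z. g (fst z) (snd z)) has_derivative
        (\<lambda>h. dx g x (t + T) * fst h + dt g x (t + T) * snd h)) (at (x, t) within strip)"
    proof (rule has_derivative_transform)
      show "(x, t) \<in> strip" using x by (simp add: strip_def)
      show "g (fst z) (snd z) = g (fst z) (snd z + T)" if "z \<in> strip" for z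
        using that by (auto simp: strip_def per)
      show "((\<lambda>z. g (fst z) (snd z + T)) has_derivative
        (\<lambda>h. dx g x (t + T) * fst h + dt g x (t + T) * snd h)) (at (x, t) within strip)"
        using sh by simp
    qed
    then show ?thesis by (rule has_derivative_slices(3)[OF _ x, symmetric])
  qed
  show T: "CT n T (dt g)" and "CT n T (dx g)" using k pt px by (simp_all add: CT_iff)
  show "tC1 T g" unfolding tC1_def
    using CT_mono[OF _ g, of 0] CT_mono[OF _ T, of 0] d by simp
qed

lemma CT_Suc_Dir: "CT (Suc n) T g \<Longrightarrow> Dir b g (\<lambda>x t. dx g x t + b x t * dt g x t)"
  by (rule has_derivative_Dir) (rule CT_Suc_deriv(4))

lemma CT_SucI:
  assumes "CT 0 T g" "has_partials g gx gt" "CT n T gx" "CT n T gt"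
  shows "CT (Suc n) T g"
  unfolding CT_iff
proof (intro conjI)
  show "\<forall>x\<in>{0..1}. \<forall>t. g x (t + T) = g x t" using assms(1) by (simp add: CT_iff)
  show "Ck (Suc n) g" by (rule Ck_SucI[OF assms(2)]) (use assms(3,4) in \<open>simp_all only: CT_iff\<close>)
qed

text \<open>The x-derivative is \<open>m - b * dt u\<close>, so control of \<open>dt u\<close>
  brings that of all first derivatives.\<close>

lemma (in slope_field) CT_Suc_from_Dir:
  assumes u: "tC1 T u" and D: "Dir b u m" and "CT n T b" "CT n T m" "CT n T (dt u)"
  shows "CT (Suc n) T u"
  by (rule CT_SucI[OF tC1_CT0[OF u] has_partialsI[OF tC1_Dir_has_derivative[OF u D]]])
    (assumption, intro CT_diff CT_mult assms, rule assms)

section \<open>Regularity for the first-order system\<close>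

text \<open>Variation of constants with the factor \<open>E\<close>. The functions \<open>p\<close>
  and \<open>g\<close> have t-derivatives, but \<open>v\<close> is only continuous; its integral
  with weight \<open>s = q * E\<close> has a t-derivative by transversality, which asks for a
  derivative of \<open>s * v\<close> along \<open>c\<close>. Everything rough is thus left in the
  trace of \<open>u\<close> at x = 0.\<close>

lemma (in slope_field) transport_representation:
  assumes c: "slope_field T c" and \<kappa>: "CT 0 T \<kappa>" "CT 0 T \<kappa>'" "Dir b \<kappa> \<kappa>'"
    and \<kappa>bc: "\<And>x t. x \<in> {0..1} \<Longrightarrow> \<kappa> x t * (b x t - c x t) = 1"
    and p: "tC1 T p" and q: "CT (Suc 0) T q" and g: "tC1 T g"
    and u: "Dir b u (\<lambda>x t. p x t * u x t + q x t * v x t + g x t)"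
    and v: "CT 0 T v" and m: "CT 0 T m" and Dv: "Dir c v m"
  shows "\<exists>R. tC1 T R \<and> (\<forall>x\<in>{0..1}. \<forall>t. u x t = exp (along b p x t) * (u 0 (fl b 0 x t) + R x t))"
proof -
  interpret C: slope_field T c by (rule c)
  note p0 = tC1_CT0[OF p] and g0 = tC1_CT0[OF g] and q1 = CT_Suc_deriv(3)[OF q]
  define E where "E = (\<lambda>x t. exp ((- 1) * along b p x t))"
  have E: "tC1 T E" unfolding E_def by (rule tC1_exp[OF tC1_cmult(1)[OF along_tC1(1)[OF p]]])
  have DE: "Dir b E (\<lambda>x t. E x t * ((- 1) * p x t))"
    unfolding E_def by (rule Dir_exp[OF Dir_cmult[OF Dir_along[OF p0]]])
  \<comment> \<open>\<open>E\<close> is built along \<open>b\<close>; total differentiability gives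
    its derivative along \<open>c\<close>.\<close>
  have E_C: "Dir c E (\<lambda>x t. (E x t * ((- 1) * p x t) - b x t * dt E x t) + c x t * dt E x t)"
    by (rule has_derivative_Dir) (rule tC1_Dir_has_derivative[OF E DE])
  define s where "s = (\<lambda>x t. q x t * E x t)"
  define s' where "s' = (\<lambda>x t. (dx q x t + c x t * dt q x t) * E x t
    + q x t * ((E x t * ((- 1) * p x t) - b x t * dt E x t) + c x t * dt E x t))"
  have s: "CT 0 T s" "CT 0 T s'" unfolding s_def s'_def
    by (intro CT0_intros tC1_CT0[OF q1] tC1_CT0[OF E] tC1_CT0_dt[OF q1] tC1_CT0_dt[OF E]
        CT_Suc_deriv(2)[OF q] C.b_CT0 b_CT0 p0)+
  have Ds: "Dir c s s'" unfolding s_def s'_def by (rule Dir_mult[OF CT_Suc_Dir[OF q] E_C])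
  have sv: "CT 0 T (\<lambda>x t. s x t * v x t)" "CT 0 T (\<lambda>x t. s' x t * v x t + s x t * m x t)"
    by (intro CT0_intros s v m)+
  have gE: "tC1 T (\<lambda>x t. g x t * E x t)" by (rule tC1_mult(1)[OF g E])
  define R where "R = (\<lambda>x t. along b (\<lambda>x t. s x t * v x t) x t + along b (\<lambda>x t. g x t * E x t) x t)"
  show ?thesis
  proof (intro exI[of _ R] conjI ballI allI)
    show "tC1 T R" unfolding R_def
      by (rule tC1_add(1)[OF along_transversal_tC1(1)[OF c sv Dir_mult[OF Ds Dv] \<kappa> \<kappa>bc] along_tC1(1)[OF gE]])
    fix x t :: real assume x: "x \<in> {0..1}"
    have "u x t * E x t = u 0 (fl b 0 x t) * E 0 (fl b 0 x t) + R x t"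
    proof (rule Dir_unique[OF _ _ _ x, where u = "\<lambda>x t. u x t * E x t"
          and v = "\<lambda>x t. u 0 (fl b 0 x t) * E 0 (fl b 0 x t) + R x t"])
      show "Dir b (\<lambda>x t. u 0 (fl b 0 x t) * E 0 (fl b 0 x t) + R x t)
          (\<lambda>x t. 0 + (s x t * v x t + g x t * E x t))"
        unfolding R_def
        by (rule Dir_add[OF Dir_const_along[of "\<lambda>r. u 0 r * E 0 r"]
              Dir_add[OF Dir_along[OF sv(1)] Dir_along[OF tC1_CT0[OF gE]]]])
      show "Dir b (\<lambda>x t. u x t * E x t) (\<lambda>x t. 0 + (s x t * v x t + g x t * E x t))"
        by (rule Dir_cong[OF Dir_mult[OF u DE]]) (simp_all add: s_def algebra_simps)
      show "u 0 t * E 0 t = u 0 (fl b 0 0 t) * E 0 (fl b 0 0 t) + R 0 t" for t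
        by (simp add: R_def fl_same)
    qed
    moreover have "E 0 r = 1" for r by (simp add: E_def)
    ultimately have 1: "u x t * E x t = u 0 (fl b 0 x t) + R x t" by simp
    have "exp (along b p x t) * E x t = 1" by (simp add: E_def exp_minus)
    then have "u x t = u x t * (exp (along b p x t) * E x t)" by simp
    also have "... = exp (along b p x t) * (u x t * E x t)" by (simp only: mult_ac)
    finally show "u x t = exp (along b p x t) * (u 0 (fl b 0 x t) + R x t)" unfolding 1 .
  qed
qed

lemma tC1_diff: "tC1 T g \<Longrightarrow> tC1 T h \<Longrightarrow> tC1 T (\<lambda>x t. g x t - h x t)"
  using tC1_add(1)[OF _ tC1_cmult(1)[of T h "- 1"], of g] by simp

lemma (in slope_field) fl_cmap:
  assumes "x \<in> {0..1}" "\<xi> \<in> {0..1}"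
  shows "cmap T (fl b \<xi> x) (\<lambda>t. rho b \<xi> (fl b \<xi> x t) / rho b x t)"
  unfolding cmap_def
proof (intro conjI allI)
  show "fl b \<xi> x (t + T) = fl b \<xi> x t + T" for t by (rule fl_shift[OF assms])
  show "(fl b \<xi> x has_real_derivative rho b \<xi> (fl b \<xi> x t) / rho b x t) (at t)" for t
    by (rule fl_deriv[OF assms])
  show "CT 0 T (\<lambda>x' t. rho b \<xi> (fl b \<xi> x t) / rho b x t)"
  proof (rule CT0I)
    show "rho b \<xi> (fl b \<xi> x (t + T)) / rho b x (t + T) = rho b \<xi> (fl b \<xi> x t) / rho b x t" for t
      using CT0_periodic[OF rho_CT0 assms(1), of t] CT0_periodic[OF rho_CT0 assms(2), of "fl b \<xi> x t"]
      by (simp add: fl_shift[OF assms])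
    show "continuous_on strip (\<lambda>z. rho b \<xi> (fl b \<xi> x (snd z)) / rho b x (snd z))"
      using assms by (intro continuous_intros CT0_compose[OF rho_CT0] fl_continuous) auto
  qed
qed

text \<open>By \<open>Dir_dt\<close> each t-derivative adds \<open>- dt b\<close> to the zero-order
  coefficient; this is the coefficient in the equation of the \<open>l\<close>-th
  t-derivative.\<close>

definition level :: "nat \<Rightarrow> (real \<Rightarrow> real \<Rightarrow> real) \<Rightarrow> (real \<Rightarrow> real \<Rightarrow> real) \<Rightarrow> real \<Rightarrow> real \<Rightarrow> real" where
  "level l b p x t = p x t - real l * dt b x t"

text \<open>Logarithms of the factors by which a wave is amplified when it runs once around:
  observed at \<open>x = 1\<close> and at \<open>x = 0\<close>, respectively.\<close>

definition gain1 where
  "gain1 b1 b2 p1 p2 t = along b1 p1 1 t - along b2 p2 1 (fl b2 1 0 (fl b1 0 1 t))"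

definition gain0 where
  "gain0 b1 b2 p1 p2 t = along b1 p1 1 (fl b2 1 0 t) - along b2 p2 1 (fl b2 1 0 t)"

text \<open>The four alternatives of the theorem after taking logarithms: negative gain is
  contraction, positive gain expansion.\<close>

definition nonresonant where
  "nonresonant n b1 b2 p1 p2 \<longleftrightarrow>
     (\<forall>t. \<forall>l\<le>n. gain1 b1 b2 (level l b1 p1) (level l b2 p2) t < 0)
   \<or> (\<forall>t. \<forall>l\<le>n. gain1 b1 b2 (level l b1 p1) (level l b2 p2) t > 0)
   \<or> (\<forall>t. \<forall>l\<le>n. gain0 b1 b2 (level l b1 p1) (level l b2 p2) t < 0)
   \<or> (\<forall>t. \<forall>l\<le>n. gain0 b1 b2 (level l b1 p1) (level l b2 p2) t > 0)"

lemma level_0: "level 0 b p = p"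
  by (simp add: level_def fun_eq_iff)

lemma level_Suc: "level l b (level (Suc 0) b p) = level (Suc l) b p"
  by (simp add: level_def fun_eq_iff algebra_simps)

lemma nonresonant_mono: "m \<le> n \<Longrightarrow> nonresonant n b1 b2 p1 p2 \<Longrightarrow> nonresonant m b1 b2 p1 p2"
  unfolding nonresonant_def by (elim disjE; simp)

text \<open>Levels shift by one when the system is differentiated, so the alternative that holds up
  to \<open>Suc n\<close> is inherited by the t-derivatives up to \<open>n\<close>.\<close>

lemma nonresonant_Suc:
  assumes "nonresonant (Suc n) b1 b2 p1 p2"
  shows "nonresonant n b1 b2 (level (Suc 0) b1 p1) (level (Suc 0) b2 p2)"
  using assms unfolding nonresonant_def level_Suc by (elim disjE; simp)

text \<open>The data \<open>g1\<close>, \<open>g2\<close>, \<open>h0\<close>, \<open>h1\<close>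
  count as prescribed functions. In the application they contain \<open>F\<close> and
  \<open>G\<close>, hence the solution itself, but these are one derivative better and can be
  frozen.\<close>

definition boundary_system where
  "boundary_system T b1 b2 p1 q1 g1 h0 p2 q2 g2 h1 u1 u2 \<longleftrightarrow>
     CT 0 T u1 \<and> CT 0 T u2
   \<and> Dir b1 u1 (\<lambda>x t. p1 x t * u1 x t + q1 x t * u2 x t + g1 x t)
   \<and> Dir b2 u2 (\<lambda>x t. p2 x t * u2 x t + q2 x t * u1 x t + g2 x t)
   \<and> (\<forall>t. u1 0 t = u2 0 t + h0 t) \<and> (\<forall>t. u2 1 t = u1 1 t + h1 t)"

lemma boundary_systemD:
  assumes "boundary_system T b1 b2 p1 q1 g1 h0 p2 q2 g2 h1 u1 u2"
  shows "CT 0 T u1" "CT 0 T u2"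
    "Dir b1 u1 (\<lambda>x t. p1 x t * u1 x t + q1 x t * u2 x t + g1 x t)"
    "Dir b2 u2 (\<lambda>x t. p2 x t * u2 x t + q2 x t * u1 x t + g2 x t)"
    "u1 0 t = u2 0 t + h0 t" "u2 1 t = u1 1 t + h1 t"
  using assms unfolding boundary_system_def by (simp_all only: simp_thms)

section \<open>Two transversal families of characteristics\<close>

locale two_slopes = A: slope_field T b1 + B: slope_field T b2
  for T :: real and b1 b2 :: "real \<Rightarrow> real \<Rightarrow> real" +
  fixes k k1 k2 :: "real \<Rightarrow> real \<Rightarrow> real"
  assumes k0: "CT 0 T k" "CT 0 T k1" "CT 0 T k2"
    and Dk: "Dir b1 k k1" "Dir b2 k k2"
    and kb: "\<And>x t. x \<in> {0..1} \<Longrightarrow> k x t * (b1 x t - b2 x t) = 1"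
begin

text \<open>\<open>P1\<close> and \<open>P2\<close> carry a time at x = 1 along a characteristic to
  its time at x = 0; \<open>X1\<close> and \<open>X2\<close> are the inverse maps.\<close>

abbreviation "P1 \<equiv> fl b1 0 1"
abbreviation "X1 \<equiv> fl b1 1 0"
abbreviation "P2 \<equiv> fl b2 0 1"
abbreviation "X2 \<equiv> fl b2 1 0"

lemma inverses: "P1 (X1 t) = t" "X1 (P1 t) = t" "P2 (X2 t) = t" "X2 (P2 t) = t"
  by (simp_all add: A.fl_fl A.fl_same B.fl_fl B.fl_same)

lemma cmaps: "cmap T P1 (\<lambda>t. 1 / rho b1 1 t)" "cmap T X1 (\<lambda>t. rho b1 1 (X1 t))"
    "cmap T P2 (\<lambda>t. 1 / rho b2 1 t)" "cmap T X2 (\<lambda>t. rho b2 1 (X2 t))"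
  using A.fl_cmap[of 1 0] A.fl_cmap[of 0 1] B.fl_cmap[of 1 0] B.fl_cmap[of 0 1] by simp_all

lemma along_level:
  assumes "CT 0 T p1" "CT 0 T p2"
  shows "along b1 (level (Suc 0) b1 p1) 1 t = along b1 p1 1 t - along b1 (dt b1) 1 t"
    and "along b2 (level (Suc 0) b2 p2) 1 t = along b2 p2 1 t - along b2 (dt b2) 1 t"
  using A.along_diff[OF assms(1) A.bt_CT0, of 1 t] B.along_diff[OF assms(2) B.bt_CT0, of 1 t]
  by (simp_all add: level_def[abs_def])

text \<open>By \<open>transport_representation\<close> both components are regular as soon as the
  trace \<open>u2 0\<close> is, since the boundary condition at x = 0 then supplies
  \<open>u1 0\<close>. Going once around closes an equation for a single function of
  \<open>t\<close>.\<close>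

lemma boundary_system_tC1:
  assumes sys: "boundary_system T b1 b2 p1 q1 g1 h0 p2 q2 g2 h1 u1 u2"
    and p: "tC1 T p1" "tC1 T p2" and q: "CT (Suc 0) T q1" "CT (Suc 0) T q2"
    and g: "tC1 T g1" "tC1 T g2" and h: "tC1 T (\<lambda>x. h0)" "tC1 T (\<lambda>x. h1)"
    and nr: "nonresonant (Suc 0) b1 b2 p1 p2"
  shows "tC1 T u1" and "tC1 T u2"
proof -
  note u0 = boundary_systemD(1,2)[OF sys] and Du1 = boundary_systemD(3)[OF sys]
    and Du2 = boundary_systemD(4)[OF sys] and bc0 = boundary_systemD(5)[OF sys]
    and bc1 = boundary_systemD(6)[OF sys]
  note pq0 = tC1_CT0[OF p(1)] tC1_CT0[OF p(2)] tC1_CT0[OF CT_Suc_deriv(3)[OF q(1)]]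
    tC1_CT0[OF CT_Suc_deriv(3)[OF q(2)]] tC1_CT0[OF g(1)] tC1_CT0[OF g(2)]
  have m: "CT 0 T (\<lambda>x t. p1 x t * u1 x t + q1 x t * u2 x t + g1 x t)"
    "CT 0 T (\<lambda>x t. p2 x t * u2 x t + q2 x t * u1 x t + g2 x t)"
    by (intro CT0_intros pq0 u0)+
  obtain R1 where R1': "tC1 T R1 \<and> (\<forall>x\<in>{0..1}. \<forall>t. u1 x t = exp (along b1 p1 x t) * (u1 0 (fl b1 0 x t) + R1 x t))"
    using A.transport_representation[OF B.slope_field_axioms k0(1,2) Dk(1) kb p(1) q(1) g(1) Du1 u0(2) m(2) Du2]
    by (rule exE)
  have R1: "tC1 T R1"
    "\<And>x t. x \<in> {0..1} \<Longrightarrow> u1 x t = exp (along b1 p1 x t) * (u1 0 (fl b1 0 x t) + R1 x t)"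
    by (rule conjunct1[OF R1'] conjunct2[OF R1', THEN bspec, THEN spec], assumption?)+
  \<comment> \<open>The two families exchange roles, so the reciprocal of the difference of the
    slopes changes its sign.\<close>
  have nk: "CT 0 T (\<lambda>x t. (- 1) * k x t)" "CT 0 T (\<lambda>x t. (- 1) * k2 x t)" by (intro CT0_intros k0)+
  have nkb: "(- 1) * k x t * (b2 x t - b1 x t) = 1" if "x \<in> {0..1}" for x t
    using kb[OF that, of t] by (simp add: algebra_simps)
  obtain R2 where R2': "tC1 T R2 \<and> (\<forall>x\<in>{0..1}. \<forall>t. u2 x t = exp (along b2 p2 x t) * (u2 0 (fl b2 0 x t) + R2 x t))"
    using B.transport_representation[OF A.slope_field_axioms nk Dir_cmult[OF Dk(2)] nkb p(2) q(2) g(2) Du2 u0(1) m(1) Du1]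
    by (rule exE)
  have R2: "tC1 T R2"
    "\<And>x t. x \<in> {0..1} \<Longrightarrow> u2 x t = exp (along b2 p2 x t) * (u2 0 (fl b2 0 x t) + R2 x t)"
    by (rule conjunct1[OF R2'] conjunct2[OF R2', THEN bspec, THEN spec], assumption?)+
  define E1 where "E1 = (\<lambda>x t. exp (along b1 p1 x t))"
  define E2 where "E2 = (\<lambda>x t. exp (along b2 p2 x t))"
  have E: "tC1 T E1" "tC1 T E2"
    unfolding E1_def E2_def by (intro tC1_exp A.along_tC1(1) B.along_tC1(1) p)+
  have E2nz: "E2 x t \<noteq> 0" for x t by (simp add: E2_def)
  have one: "(1::real) \<in> {0..1}" and zero: "(0::real) \<in> {0..1}" by auto
  have u1_1: "u1 1 t = E1 1 t * (u1 0 (P1 t) + R1 1 t)" for t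
    using R1(2)[OF one] by (simp add: E1_def)
  have u2_1: "u2 1 t = E2 1 t * (u2 0 (P2 t) + R2 1 t)" for t
    using R2(2)[OF one] by (simp add: E2_def)
  \<comment> \<open>Waves of the second family enter at x = 1, but the representation is based at x
    = 0; it is solved for the trace at x = 0.\<close>
  have u2_0: "u2 0 s = (u1 1 (X2 s) + h1 (X2 s)) / E2 1 (X2 s) - R2 1 (X2 s)" for s
    using u2_1[of "X2 s"] bc1[of "X2 s"] E2nz[of 1 "X2 s"] by (simp add: inverses field_simps)
  note c = tC1_compose_cmap[OF E(1) one] tC1_compose_cmap[OF E(2) one] tC1_compose_cmap[OF R1(1) one]
    tC1_compose_cmap[OF R2(1) one] tC1_compose_cmap[OF h(1) zero] tC1_compose_cmap[OF h(2) zero]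
  have erho: "exp (along b1 (dt b1) x t) = rho b1 x t" "exp (along b2 (dt b2) x t) = rho b2 x t" for x t
    by (simp_all add: rho_def)
  note lv = along_level[OF pq0(1,2)]
  have u20: "tC1 T (\<lambda>x. u2 0)"
  proof -
    have "((\<forall>t. \<forall>l\<le>Suc 0. gain1 b1 b2 (level l b1 p1) (level l b2 p2) t < 0) \<or>
        (\<forall>t. \<forall>l\<le>Suc 0. gain1 b1 b2 (level l b1 p1) (level l b2 p2) t > 0)) \<or>
        ((\<forall>t. \<forall>l\<le>Suc 0. gain0 b1 b2 (level l b1 p1) (level l b2 p2) t < 0) \<or>
        (\<forall>t. \<forall>l\<le>Suc 0. gain0 b1 b2 (level l b1 p1) (level l b2 p2) t > 0))"
      using nr unfolding nonresonant_def disj_assoc .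
    then consider "(\<forall>t. \<forall>l\<le>Suc 0. gain1 b1 b2 (level l b1 p1) (level l b2 p2) t < 0) \<or>
        (\<forall>t. \<forall>l\<le>Suc 0. gain1 b1 b2 (level l b1 p1) (level l b2 p2) t > 0)"
      | "(\<forall>t. \<forall>l\<le>Suc 0. gain0 b1 b2 (level l b1 p1) (level l b2 p2) t < 0) \<or>
        (\<forall>t. \<forall>l\<le>Suc 0. gain0 b1 b2 (level l b1 p1) (level l b2 p2) t > 0)"
      by (rule disjE)
    then show ?thesis
    proof cases
      case 1
      \<comment> \<open>From x = 1 along the first family to x = 0, then along the second family
        back to x = 1.\<close>
      define \<sigma> where "\<sigma> = (\<lambda>t. X2 (P1 t))"
      define \<kappa> where "\<kappa> = (\<lambda>t. E1 1 t / E2 1 (\<sigma> t))"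
      define \<sigma>' where "\<sigma>' = (\<lambda>t. rho b2 1 (X2 (P1 t)) * (1 / rho b1 1 t))"
      have \<sigma>: "cmap T \<sigma> \<sigma>'" unfolding \<sigma>_def \<sigma>'_def by (rule cmap_compose[OF cmaps(4,1)])
      have \<tau>: "cmap T (\<lambda>t. X1 (P2 t)) (\<lambda>t. rho b1 1 (X1 (P2 t)) * (1 / rho b2 1 t))"
        by (rule cmap_compose[OF cmaps(2,3)])
      have \<kappa>: "tC1 T (\<lambda>x. \<kappa>)" unfolding \<kappa>_def by (rule tC1_divide[OF tC1_trace[OF E(1) one] c(2)[OF \<sigma>] E2nz])
      have \<rho>: "tC1 T (\<lambda>x t. \<kappa> t * h1 (\<sigma> t) + E1 1 t * (h0 (P1 t) + R1 1 t - R2 1 (\<sigma> t)))"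
        by (rule tC1_add(1)[OF tC1_mult(1)[OF \<kappa> c(6)[OF \<sigma>]] tC1_mult(1)[OF tC1_trace[OF E(1) one]
              tC1_diff[OF tC1_add(1)[OF c(5)[OF cmaps(1)] tC1_trace[OF R1(1) one]] c(4)[OF \<sigma>]]]])
      have g0: "\<kappa> t = exp (gain1 b1 b2 (level 0 b1 p1) (level 0 b2 p2) t)" for t
        by (simp add: \<kappa>_def \<sigma>_def E1_def E2_def gain1_def level_0 exp_diff)
      \<comment> \<open>\<open>\<sigma>'\<close> is a quotient of values of \<open>rho\<close>,
        which are exponentials of integrals of \<open>dt b\<close>. Multiplication by it subtracts
        these integrals from those of \<open>p1\<close> and \<open>p2\<close>, which is the passage
        from level 0 to level 1.\<close>
      have g1: "\<kappa> t * \<sigma>' t = exp (gain1 b1 b2 (level (Suc 0) b1 p1) (level (Suc 0) b2 p2) t)" for t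
        by (simp add: \<kappa>_def \<sigma>_def \<sigma>'_def E1_def E2_def gain1_def lv exp_diff exp_add erho field_simps)
      have "tC1 T (\<lambda>x. u1 1)"
      proof (rule circle_equation_tC1[OF A.T_pos \<kappa> \<rho> \<sigma> \<tau>])
        show "\<sigma> (X1 (P2 t)) = t" for t by (simp add: \<sigma>_def inverses)
        show "CT 0 T (\<lambda>x. u1 1)" by (rule CT0_trace[OF u0(1) one])
        show "u1 1 t = \<kappa> t * u1 1 (\<sigma> t) + (\<kappa> t * h1 (\<sigma> t) + E1 1 t * (h0 (P1 t) + R1 1 t - R2 1 (\<sigma> t)))" for t
          unfolding u1_1[of t] bc0[of "P1 t"] u2_0[of "P1 t"] \<kappa>_def \<sigma>_def
          by (simp add: add_divide_distrib algebra_simps)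
        show "\<kappa> t > 0" for t unfolding g0 by simp
        show "\<sigma>' t > 0" for t unfolding \<sigma>'_def using A.rho_pos[of 1 t] B.rho_pos[of 1 "X2 (P1 t)"] by simp
        show "(\<forall>t. \<kappa> t < 1 \<and> \<kappa> t * \<sigma>' t < 1) \<or> (\<forall>t. \<kappa> t > 1 \<and> \<kappa> t * \<sigma>' t > 1)"
          unfolding g1 unfolding g0 exp_less_one_iff one_less_exp_iff using 1 by (elim disjE) simp_all
      qed
      \<comment> \<open>Back from the trace at x = 1 to the trace at x = 0 by
        \<open>u2_0\<close>.\<close>
      from tC1_diff[OF tC1_divide[OF tC1_add(1)[OF tC1_compose_cmap[OF this zero cmaps(4)] c(6)[OF cmaps(4)]]
            c(2)[OF cmaps(4)] E2nz] c(4)[OF cmaps(4)]]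
      show ?thesis by (rule tC1_cong(1)) (rule u2_0)
    next
      case 2
      \<comment> \<open>The same loop observed at x = 0, which gives an equation for
        \<open>u2 0\<close> directly.\<close>
      define \<sigma> where "\<sigma> = (\<lambda>t. P1 (X2 t))"
      define \<kappa> where "\<kappa> = (\<lambda>t. E1 1 (X2 t) / E2 1 (X2 t))"
      define \<sigma>' where "\<sigma>' = (\<lambda>t. 1 / rho b1 1 (X2 t) * rho b2 1 (X2 t))"
      have \<sigma>: "cmap T \<sigma> \<sigma>'" unfolding \<sigma>_def \<sigma>'_def by (rule cmap_compose[OF cmaps(1,4)])
      have \<tau>: "cmap T (\<lambda>t. P2 (X1 t)) (\<lambda>t. 1 / rho b2 1 (X1 t) * rho b1 1 (X1 t))"
        by (rule cmap_compose[OF cmaps(3,2)])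
      have \<kappa>: "tC1 T (\<lambda>x. \<kappa>)" unfolding \<kappa>_def by (rule tC1_divide[OF c(1)[OF cmaps(4)] c(2)[OF cmaps(4)] E2nz])
      have \<rho>: "tC1 T (\<lambda>x t. \<kappa> t * (h0 (\<sigma> t) + R1 1 (X2 t)) + h1 (X2 t) / E2 1 (X2 t) - R2 1 (X2 t))"
        by (rule tC1_diff[OF tC1_add(1)[OF tC1_mult(1)[OF \<kappa> tC1_add(1)[OF c(5)[OF \<sigma>] c(3)[OF cmaps(4)]]]
              tC1_divide[OF c(6)[OF cmaps(4)] c(2)[OF cmaps(4)] E2nz]] c(4)[OF cmaps(4)]])
      have g0: "\<kappa> t = exp (gain0 b1 b2 (level 0 b1 p1) (level 0 b2 p2) t)" for t
        by (simp add: \<kappa>_def E1_def E2_def gain0_def level_0 exp_diff)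
      have g1: "\<kappa> t * \<sigma>' t = exp (gain0 b1 b2 (level (Suc 0) b1 p1) (level (Suc 0) b2 p2) t)" for t
        by (simp add: \<kappa>_def \<sigma>'_def E1_def E2_def gain0_def lv exp_diff exp_add erho field_simps)
      show ?thesis
      proof (rule circle_equation_tC1[OF A.T_pos \<kappa> \<rho> \<sigma> \<tau>])
        show "\<sigma> (P2 (X1 t)) = t" for t by (simp add: \<sigma>_def inverses)
        show "CT 0 T (\<lambda>x. u2 0)" by (rule CT0_trace[OF u0(2) zero])
        show "u2 0 t = \<kappa> t * u2 0 (\<sigma> t) + (\<kappa> t * (h0 (\<sigma> t) + R1 1 (X2 t)) + h1 (X2 t) / E2 1 (X2 t) - R2 1 (X2 t))" for t
          unfolding u2_0[of t] u1_1 bc0 \<kappa>_def \<sigma>_def by (simp add: add_divide_distrib algebra_simps)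
        show "\<kappa> t > 0" for t unfolding g0 by simp
        show "\<sigma>' t > 0" for t unfolding \<sigma>'_def using A.rho_pos[of 1 "X2 t"] B.rho_pos[of 1 "X2 t"] by simp
        show "(\<forall>t. \<kappa> t < 1 \<and> \<kappa> t * \<sigma>' t < 1) \<or> (\<forall>t. \<kappa> t > 1 \<and> \<kappa> t * \<sigma>' t > 1)"
          unfolding g1 unfolding g0 exp_less_one_iff one_less_exp_iff using 2 by (elim disjE) simp_all
      qed
    qed
  qed
  have u10: "tC1 T (\<lambda>x. u1 0)"
    by (rule tC1_cong(1)[OF tC1_add(1)[OF u20 h(1)]]) (rule bc0)
  show "tC1 T u1"
    by (rule tC1_cong(1)[OF tC1_mult(1)[OF E(1) tC1_add(1)[OF A.compose_fl_tC1(1)[OF u10] R1(1)]]])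
      (unfold E1_def, rule R1(2))
  show "tC1 T u2"
    by (rule tC1_cong(1)[OF tC1_mult(1)[OF E(2) tC1_add(1)[OF B.compose_fl_tC1(1)[OF u20] R2(1)]]])
      (unfold E2_def, rule R2(2))
qed

text \<open>The induction runs over all systems at once, because the t-derivatives solve a different
  one: its zero-order coefficients are one level higher, and its sources contain \<open>u1\<close>
  and \<open>u2\<close> multiplied by t-derivatives of the coefficients.\<close>

lemma boundary_system_regularity:
  assumes "boundary_system T b1 b2 p1 q1 g1 h0 p2 q2 g2 h1 u1 u2"
    and "CT (Suc n) T b1" "CT (Suc n) T b2"
    and "CT n T p1" "CT n T p2" "CT n T q1" "CT n T q2" "CT n T g1" "CT n T g2"
    and "CT n T (\<lambda>x. h0)" "CT n T (\<lambda>x. h1)"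
    and "nonresonant n b1 b2 p1 p2"
  shows "CT n T u1 \<and> CT n T u2"
  using assms
proof (induction n arbitrary: p1 q1 g1 h0 p2 q2 g2 h1 u1 u2)
  case 0
  show ?case using boundary_systemD(1,2)[OF 0(1)] by (rule conjI)
next
  case (Suc n)
  note sys = Suc.prems(1)
  note b = CT_mono[OF le_SucI[OF order_refl] Suc.prems(2)] CT_mono[OF le_SucI[OF order_refl] Suc.prems(3)]
  note low = CT_mono[OF le_SucI[OF order_refl]]
  note one = CT_mono[OF Suc_le_mono[THEN iffD2, OF le0]]
  \<comment> \<open>First use of the induction hypothesis, for the system itself: it puts the
    undifferentiated \<open>u1\<close> and \<open>u2\<close> in the sources \<open>?G1\<close> and
    \<open>?G2\<close> into class \<open>n\<close>.\<close>
  have ih: "CT n T u1 \<and> CT n T u2"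
    by (rule Suc.IH[OF sys b low[OF Suc.prems(4)] low[OF Suc.prems(5)] low[OF Suc.prems(6)]
          low[OF Suc.prems(7)] low[OF Suc.prems(8)] low[OF Suc.prems(9)] low[OF Suc.prems(10)]
          low[OF Suc.prems(11)] nonresonant_mono[OF le_SucI[OF order_refl] Suc.prems(12)]])
  then have un: "CT n T u1" "CT n T u2" by blast+
  note p1 = CT_Suc_deriv(1,3)[OF Suc.prems(4)] low[OF Suc.prems(4)]
  note p2 = CT_Suc_deriv(1,3)[OF Suc.prems(5)] low[OF Suc.prems(5)]
  note q1 = CT_Suc_deriv(1,3)[OF Suc.prems(6)] low[OF Suc.prems(6)]
  note q2 = CT_Suc_deriv(1,3)[OF Suc.prems(7)] low[OF Suc.prems(7)]
  note g1 = CT_Suc_deriv(1,3)[OF Suc.prems(8)] low[OF Suc.prems(8)]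
  note g2 = CT_Suc_deriv(1,3)[OF Suc.prems(9)] low[OF Suc.prems(9)]
  note h0 = CT_Suc_deriv(1,3)[OF Suc.prems(10)] low[OF Suc.prems(10)]
  note h1 = CT_Suc_deriv(1,3)[OF Suc.prems(11)] low[OF Suc.prems(11)]
  have nr1: "nonresonant (Suc 0) b1 b2 p1 p2"
    by (rule nonresonant_mono[OF _ Suc.prems(12)]) simp
  note u = boundary_system_tC1[OF sys p1(2) p2(2) one[OF Suc.prems(6)] one[OF Suc.prems(7)]
      g1(2) g2(2) h0(2) h1(2) nr1]
  note D1 = boundary_systemD(3)[OF sys] and D2 = boundary_systemD(4)[OF sys]
    and bc = boundary_systemD(5,6)[OF sys]
  note n1 = tC1_add[OF tC1_add(1)[OF tC1_mult(1)[OF p1(2) u(1)] tC1_mult(1)[OF q1(2) u(2)]] g1(2)]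
  note n2 = tC1_add[OF tC1_add(1)[OF tC1_mult(1)[OF p2(2) u(2)] tC1_mult(1)[OF q2(2) u(1)]] g2(2)]
  let ?G1 = "\<lambda>x t. dt p1 x t * u1 x t + dt q1 x t * u2 x t + dt g1 x t"
  let ?G2 = "\<lambda>x t. dt p2 x t * u2 x t + dt q2 x t * u1 x t + dt g2 x t"
  have sys': "boundary_system T b1 b2 (level (Suc 0) b1 p1) q1 ?G1 (dt (\<lambda>x. h0) 0)
      (level (Suc 0) b2 p2) q2 ?G2 (dt (\<lambda>x. h1) 0) (dt u1) (dt u2)"
    unfolding boundary_system_def
  proof (intro conjI allI)
    show "CT 0 T (dt u1)" "CT 0 T (dt u2)" by (rule tC1_CT0_dt[OF u(1)] tC1_CT0_dt[OF u(2)])+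
    show "Dir b1 (dt u1) (\<lambda>x t. level (Suc 0) b1 p1 x t * dt u1 x t + q1 x t * dt u2 x t + ?G1 x t)"
    proof (rule Dir_cong[OF A.Dir_dt[OF u(1) n1(1) D1] refl])
      fix x t :: real assume x: "x \<in> {0..1}"
      show "level (Suc 0) b1 p1 x t * dt u1 x t + q1 x t * dt u2 x t + ?G1 x t
        = dt (\<lambda>x t. p1 x t * u1 x t + q1 x t * u2 x t + g1 x t) x t - dt b1 x t * dt u1 x t"
        unfolding n1(2)[OF x] tC1_add(2)[OF tC1_mult(1)[OF p1(2) u(1)] tC1_mult(1)[OF q1(2) u(2)] x]
          tC1_mult(2)[OF p1(2) u(1) x] tC1_mult(2)[OF q1(2) u(2) x]
        by (simp add: level_def algebra_simps)
    qed
    show "Dir b2 (dt u2) (\<lambda>x t. level (Suc 0) b2 p2 x t * dt u2 x t + q2 x t * dt u1 x t + ?G2 x t)"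
    proof (rule Dir_cong[OF B.Dir_dt[OF u(2) n2(1) D2] refl])
      fix x t :: real assume x: "x \<in> {0..1}"
      show "level (Suc 0) b2 p2 x t * dt u2 x t + q2 x t * dt u1 x t + ?G2 x t
        = dt (\<lambda>x t. p2 x t * u2 x t + q2 x t * u1 x t + g2 x t) x t - dt b2 x t * dt u2 x t"
        unfolding n2(2)[OF x] tC1_add(2)[OF tC1_mult(1)[OF p2(2) u(2)] tC1_mult(1)[OF q2(2) u(1)] x]
          tC1_mult(2)[OF p2(2) u(2) x] tC1_mult(2)[OF q2(2) u(1) x]
        by (simp add: level_def algebra_simps)
    qed
    have zero: "(0::real) \<in> {0..1}" and one1: "(1::real) \<in> {0..1}" by auto
    fix t
    have "((\<lambda>s. u2 0 s + h0 s) has_real_derivative dt u2 0 t + dt (\<lambda>x. h0) 0 t) (at t)"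
      by (rule DERIV_add[OF tC1_deriv[OF u(2) zero] tC1_deriv[OF h0(2) zero]])
    then show "dt u1 0 t = dt u2 0 t + dt (\<lambda>x. h0) 0 t"
      unfolding dt_def[of u1] bc(1) by (rule DERIV_imp_deriv)
    have "((\<lambda>s. u1 1 s + h1 s) has_real_derivative dt u1 1 t + dt (\<lambda>x. h1) 0 t) (at t)"
      by (rule DERIV_add[OF tC1_deriv[OF u(1) one1] tC1_deriv[OF h1(2) zero]])
    then show "dt u2 1 t = dt u1 1 t + dt (\<lambda>x. h1) 0 t"
      unfolding dt_def[of u2] bc(2) by (rule DERIV_imp_deriv)
  qed
  have lv: "CT n T (level (Suc 0) b1 p1)" "CT n T (level (Suc 0) b2 p2)"
    unfolding level_def[abs_def]
    by (intro CT_diff CT_mult CT_const p1(3) p2(3) CT_Suc_deriv(1)[OF b(1)] CT_Suc_deriv(1)[OF b(2)])+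
  have G: "CT n T ?G1" "CT n T ?G2" by (intro CT_add CT_mult p1(1) p2(1) q1(1) q2(1) g1(1) g2(1) un)+
  \<comment> \<open>Second use of the induction hypothesis, for the differentiated system.\<close>
  have "CT n T (dt u1) \<and> CT n T (dt u2)"
    by (rule Suc.IH[OF sys' b lv q1(3) q2(3) G CT_trace[OF h0(1)] CT_trace[OF h1(1)]
          nonresonant_Suc[OF Suc.prems(12)]]) simp_all
  then have du: "CT n T (dt u1)" "CT n T (dt u2)" by blast+
  have nn: "CT n T (\<lambda>x t. p1 x t * u1 x t + q1 x t * u2 x t + g1 x t)"
    "CT n T (\<lambda>x t. p2 x t * u2 x t + q2 x t * u1 x t + g2 x t)"
    by (intro CT_add CT_mult p1(3) p2(3) q1(3) q2(3) g1(3) g2(3) un)+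
  show ?case
    using A.CT_Suc_from_Dir[OF u(1) D1 low[OF b(1)] nn(1) du(1)]
      B.CT_Suc_from_Dir[OF u(2) D2 low[OF b(2)] nn(2) du(2)] by (rule conjI)
qed

end

section \<open>Weak solutions\<close>

lemma oint_eq:
  assumes "continuous_on {0..1} g" "p \<in> {0..1}" "q \<in> {0..1}"
  shows "oint p q g = integral {0..q} g - integral {0..p} g"
proof -
  have i: "g integrable_on {x..y}" if "0 \<le> x" "y \<le> 1" for x y
    by (rule integrable_continuous_real[OF continuous_on_subset[OF assms(1)]]) (use that in auto)
  show ?thesis
  proof (cases "p \<le> q")
    case True
    then have "integral {0..p} g + integral {p..q} g = integral {0..q} g"
      using assms(2,3) by (intro Henstock_Kurzweil_Integration.integral_combine i) auto
    then show ?thesis using True by (simp add: oint_def)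
  next
    case False
    then have "integral {0..q} g + integral {q..p} g = integral {0..p} g"
      using assms(2,3) by (intro Henstock_Kurzweil_Integration.integral_combine i) auto
    then show ?thesis using False by (simp add: oint_def)
  qed
qed

lemma oint_cong:
  assumes "\<And>x. x \<in> {0..1} \<Longrightarrow> g x = h x" "p \<in> {0..1}" "q \<in> {0..1}"
  shows "oint p q g = oint p q h"
proof -
  have "integral {x..y} g = integral {x..y} h" if "0 \<le> x" "y \<le> 1" for x y
    by (rule Henstock_Kurzweil_Integration.integral_cong) (use that assms(1) in auto)
  then show ?thesis using assms(2,3) by (simp add: oint_def)
qed

lemma oint_mult: "oint p q (\<lambda>x. c * g x) = c * oint p q g"
  by (simp add: oint_def)

lemma oint_diff:
  assumes g: "continuous_on {0..1} g" and h: "continuous_on {0..1} h" and "p \<in> {0..1}" "q \<in> {0..1}"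
  shows "oint p q (\<lambda>x. g x - h x) = oint p q g - oint p q h"
proof -
  have "integral {0..y} (\<lambda>x. g x - h x) = integral {0..y} g - integral {0..y} h" if "y \<in> {0..1}" for y
    using that by (intro Henstock_Kurzweil_Integration.integral_diff integrable_continuous_real
        continuous_on_subset[OF g] continuous_on_subset[OF h]) auto
  then show ?thesis
    using assms by (simp add: oint_eq[OF continuous_on_diff[OF g h]] oint_eq[OF g] oint_eq[OF h])
qed

text \<open>Along a fixed curve the exponent of the weight is a difference
  \<open>P y - P \<xi>\<close>, and the foot point at \<open>c\<close> is fixed, so \<open>K\<close>
  contributes a constant. Then \<open>u\<close> is \<open>exp (P y)\<close> times the sum of a
  constant and \<open>N y\<close>, and the product rule applies.\<close>

lemma (in slope_field) duhamel_Dir: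
  assumes p: "CT 0 T p" and n: "CT 0 T n" and c: "c \<in> {0..1}"
    and u: "\<And>x t. x \<in> {0..1} \<Longrightarrow> u x t = exp (oint x c (\<lambda>\<eta>. - p \<eta> (fl b \<eta> x t))) * K (fl b c x t)
      + oint c x (\<lambda>\<xi>. exp (oint x \<xi> (\<lambda>\<eta>. - p \<eta> (fl b \<eta> x t))) * n \<xi> (fl b \<xi> x t))"
  shows "Dir b u (\<lambda>x t. p x t * u x t + n x t)"
proof (rule DirI)
  fix \<tau> x assume \<tau>: "sol b \<tau>" and x: "x \<in> {0..1::real}"
  define P where "P = (\<lambda>\<xi>. integral {0..\<xi>} (\<lambda>\<eta>. p \<eta> (\<tau> \<eta>)))"
  define N where "N = (\<lambda>\<xi>. integral {0..\<xi>} (\<lambda>\<eta>. exp (- P \<eta>) * n \<eta> (\<tau> \<eta>)))"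
  note cp = curve_continuous[OF p \<tau>] and cn = curve_continuous[OF n \<tau>]
  have dP: "(P has_real_derivative p \<xi> (\<tau> \<xi>)) (at \<xi> within {0..1})" if "\<xi> \<in> {0..1}" for \<xi>
    unfolding P_def by (rule integral_has_real_derivative[OF cp that])
  have cP: "continuous_on {0..1} P"
    unfolding continuous_on_eq_continuous_within by (rule ballI, rule DERIV_continuous[OF dP])
  have ce: "continuous_on {0..1} (\<lambda>\<eta>. exp (- P \<eta>) * n \<eta> (\<tau> \<eta>))" by (intro continuous_intros cP cn)
  have dN: "(N has_real_derivative exp (- P \<xi>) * n \<xi> (\<tau> \<xi>)) (at \<xi> within {0..1})" if "\<xi> \<in> {0..1}" for \<xi>
    unfolding N_def by (rule integral_has_real_derivative[OF ce that])
  have P: "oint y \<xi> (\<lambda>\<eta>. - p \<eta> (fl b \<eta> y (\<tau> y))) = P y - P \<xi>" if "y \<in> {0..1}" "\<xi> \<in> {0..1}" for y \<xi>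
  proof -
    have "oint y \<xi> (\<lambda>\<eta>. - p \<eta> (fl b \<eta> y (\<tau> y))) = oint y \<xi> (\<lambda>\<eta>. (- 1) * p \<eta> (\<tau> \<eta>))"
      by (rule oint_cong) (use that in \<open>simp_all add: fl_eq[OF \<tau>]\<close>)
    also have "... = P y - P \<xi>" unfolding oint_mult using oint_eq[OF cp that] by (simp add: P_def)
    finally show ?thesis .
  qed
  have uy: "u y (\<tau> y) = exp (P y) * (exp (- P c) * K (\<tau> c) + (N y - N c))" if y: "y \<in> {0..1}" for y
  proof -
    have "oint c y (\<lambda>\<xi>. exp (oint y \<xi> (\<lambda>\<eta>. - p \<eta> (fl b \<eta> y (\<tau> y)))) * n \<xi> (fl b \<xi> y (\<tau> y)))
        = oint c y (\<lambda>\<xi>. exp (P y) * (exp (- P \<xi>) * n \<xi> (\<tau> \<xi>)))"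
      by (rule oint_cong) (use y c in \<open>simp_all add: P fl_eq[OF \<tau>] exp_diff exp_minus field_simps\<close>)
    also have "... = exp (P y) * (N y - N c)" unfolding oint_mult using oint_eq[OF ce c y] by (simp add: N_def)
    finally have "u y (\<tau> y) = exp (P y - P c) * K (\<tau> c) + exp (P y) * (N y - N c)"
      using u[OF y, of "\<tau> y"] P[OF y c] fl_eq[OF \<tau> y c] by simp
    then show ?thesis by (simp add: exp_diff exp_minus field_simps)
  qed
  have "((\<lambda>y. exp (P y) * (exp (- P c) * K (\<tau> c) + (N y - N c))) has_real_derivative
      exp (P x) * p x (\<tau> x) * (exp (- P c) * K (\<tau> c) + (N x - N c)) + exp (P x) * (exp (- P x) * n x (\<tau> x)))
      (at x within {0..1})"
  proof -
    have 1: "((\<lambda>y. exp (P y)) has_real_derivative exp (P x) * p x (\<tau> x)) (at x within {0..1})"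
      using DERIV_chain'[OF dP[OF x] DERIV_exp] by (simp add: mult.commute)
    have 2: "((\<lambda>y. exp (- P c) * K (\<tau> c) + (N y - N c)) has_real_derivative exp (- P x) * n x (\<tau> x)) (at x within {0..1})"
      using DERIV_add[OF DERIV_const DERIV_diff[OF dN[OF x] DERIV_const]] by simp
    show ?thesis using DERIV_mult[OF 1 2] by (simp add: algebra_simps)
  qed
  moreover have "exp (P x) * p x (\<tau> x) * (exp (- P c) * K (\<tau> c) + (N x - N c)) + exp (P x) * (exp (- P x) * n x (\<tau> x))
      = p x (\<tau> x) * u x (\<tau> x) + n x (\<tau> x)"
    unfolding uy[OF x] by (simp add: exp_minus algebra_simps)
  ultimately have D: "((\<lambda>y. exp (P y) * (exp (- P c) * K (\<tau> c) + (N y - N c))) has_real_derivative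
      p x (\<tau> x) * u x (\<tau> x) + n x (\<tau> x)) (at x within {0..1})" by simp
  show "((\<lambda>\<xi>. u \<xi> (\<tau> \<xi>)) has_real_derivative p x (\<tau> x) * u x (\<tau> x) + n x (\<tau> x)) (at x within {0..1})"
    by (rule has_real_derivative_transform[OF x _ D]) (rule uy)
qed

section \<open>Integration in x as the case of zero slope\<close>

lemma slope_field_zero: "(T::real) > 0 \<Longrightarrow> slope_field T (\<lambda>_ _. 0)"
  by unfold_locales (simp_all add: tC1_const)

lemma fl_zero:
  assumes "(T::real) > 0" "x \<in> {0..1}" "\<xi> \<in> {0..1}"
  shows "fl (\<lambda>_ _. 0) \<xi> x t = t"
proof -
  interpret slope_field T "\<lambda>_ _. 0" by (rule slope_field_zero[OF assms(1)])
  have "sol (\<lambda>_ _. 0) (\<lambda>_. t)" by (simp add: sol_def)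
  from fl_eq[OF this assms(2,3)] show ?thesis .
qed

lemma dt_zero: "dt (\<lambda>_ _. 0) = (\<lambda>_ _. 0)"
  by (simp add: dt_def fun_eq_iff)

lemma rho_zero: "rho (\<lambda>_ _. 0) x t = 1"
  by (simp add: rho_def along_def dt_zero)

lemma along_zero_CT:
  assumes T: "(T::real) > 0"
  shows "CT n T g \<Longrightarrow> CT n T (along (\<lambda>_ _. 0) g)"
proof (induction n arbitrary: g)
  case 0
  interpret slope_field T "\<lambda>_ _. 0" by (rule slope_field_zero[OF T])
  show ?case by (rule along_CT0[OF 0])
next
  case (Suc n)
  interpret slope_field T "\<lambda>_ _. 0" by (rule slope_field_zero[OF T])
  note g = CT_Suc_deriv(1,3)[OF Suc.prems]
  have g0: "CT 0 T g" by (rule CT_mono[OF le0 Suc.prems])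
  have "CT n T (dt (along (\<lambda>_ _. 0) g))"
    by (rule CT_cong[OF Suc.IH[OF g(1)]]) (simp add: along_tC1(2)[OF g(2)] rho_zero)
  then show ?case
    by (intro CT_Suc_from_Dir[OF along_tC1(1)[OF g(2)] Dir_along[OF g0] CT_const] CT_mono[OF _ Suc.prems]) simp_all
qed

text \<open>For zero slope \<open>dtalong\<close> involves only \<open>v\<close>, \<open>m\<close>,
  \<open>\<kappa>\<close>, the x-derivative of \<open>\<kappa>\<close> and an integral in x, all of
  class \<open>n\<close>, and the x-derivative of the integral of \<open>v\<close> is
  \<open>v\<close>; so both first derivatives are of class \<open>n\<close>.\<close>

lemma along_zero_transversal_CT:
  assumes c: "slope_field T c" and v: "CT n T v" and m: "CT n T m" and D: "Dir c v m"
    and \<kappa>: "CT (Suc n) T \<kappa>" and \<kappa>c: "\<And>x t. x \<in> {0..1} \<Longrightarrow> \<kappa> x t * (0 - c x t) = 1"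
  shows "CT (Suc n) T (along (\<lambda>_ _. 0) v)"
proof -
  have T: "T > 0" using c by (simp add: slope_field_def)
  interpret slope_field T "\<lambda>_ _. 0" by (rule slope_field_zero[OF T])
  note z = CT_mono[OF le0]
  have \<kappa>n: "CT n T \<kappa>" by (rule CT_mono[OF _ \<kappa>]) simp
  have \<kappa>': "CT n T (\<lambda>x t. dx \<kappa> x t + 0 * dt \<kappa> x t)"
    by (intro CT_add CT_mult CT_const CT_Suc_deriv[OF \<kappa>])
  note tr = along_transversal_tC1[OF c z[OF v] z[OF m] D z[OF \<kappa>] z[OF \<kappa>'] CT_Suc_Dir[OF \<kappa>] \<kappa>c]
  have d: "dt (along (\<lambda>_ _. 0) v) x t = dtalong \<kappa> (\<lambda>x t. dx \<kappa> x t + 0 * dt \<kappa> x t) v m x t"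
    if "x \<in> {0..1}" for x t
    by (rule along_transversal_tC1(2)[OF c z[OF v] z[OF m] D z[OF \<kappa>] z[OF \<kappa>'] CT_Suc_Dir[OF \<kappa>] \<kappa>c that])
  have w: "CT n T (\<lambda>x t. \<kappa> x t * m x t + (dx \<kappa> x t + 0 * dt \<kappa> x t + \<kappa> x t * 0) * v x t)"
    by (intro CT_add CT_mult CT_const \<kappa>n m v \<kappa>')
  have "CT n T (\<lambda>x t. \<kappa> x t * v x t - (\<kappa> 0 t * v 0 t
      + along (\<lambda>_ _. 0) (\<lambda>x t. \<kappa> x t * m x t + (dx \<kappa> x t + 0 * dt \<kappa> x t + \<kappa> x t * 0) * v x t) x t))"
    by (rule CT_diff[OF CT_mult[OF \<kappa>n v] CT_add[OF CT_mult[OF CT_trace[OF \<kappa>n] CT_trace[OF v]]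
          along_zero_CT[OF T w]]]) simp_all
  then have "CT n T (dt (along (\<lambda>_ _. 0) v))"
    by (rule CT_cong) (simp add: d dtalong_def rho_zero fl_zero[OF T] dt_zero)
  then show ?thesis
    by (intro CT_Suc_from_Dir[OF tr(1) Dir_along[OF z[OF v]] CT_const v])
qed

lemma CT_Suc_circle:
  assumes "\<And>t. g (t + T) = g t" "\<And>t. (g has_real_derivative g' t) (at t)" "CT n T (\<lambda>x. g')"
  shows "CT (Suc n) T (\<lambda>x. g)"
proof -
  have c: "continuous_on UNIV g"
    by (rule continuous_at_imp_continuous_on) (rule ballI, rule DERIV_isCont[OF assms(2)])
  show ?thesis
  proof (rule CT_SucI[OF CT0I has_partialsI CT_const[of n T 0] assms(3)])
    show "continuous_on strip (\<lambda>z. g (snd z))"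
      by (rule continuous_on_compose2[OF c continuous_on_snd[OF continuous_on_id]]) simp
    fix x t :: real
    have "(g has_derivative (\<lambda>k. g' t * k)) (at (snd (x, t)))"
      using assms(2)[of t] by (simp add: has_field_derivative_def)
    from has_derivative_compose[OF has_derivative_snd[OF has_derivative_ident] this]
    show "((\<lambda>z. g (snd z)) has_derivative (\<lambda>k. 0 * fst k + g' t * snd k)) (at (x, t) within strip)"
      by simp
  qed (rule assms(1))
qed

section \<open>Coefficients of the wave equation\<close>

definition slope :: "(real \<Rightarrow> real \<Rightarrow> real) \<Rightarrow> nat \<Rightarrow> real \<Rightarrow> real \<Rightarrow> real" where
  "slope a j x t = (-1) ^ j / a x t"

lemma tau_eq_fl: "tau a j = fl (slope a j)"
  by (simp add: tau_def fl_def sol_def slope_def fun_eq_iff)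

text \<open>The coefficient of the j-th component in its own equation along characteristics. The
  sign is opposite to that in \<open>cl\<close>, where the integral runs from \<open>x\<close> to
  \<open>\<xi>\<close>, against the transport from \<open>\<xi>\<close> to \<open>x\<close>.\<close>

definition damping where
  "damping a a1 a2 j x t = - ((-1) ^ j * (bjj a a1 a2 j x t / a x t))"

locale wave_coefficients =
  fixes T :: real and a a1 a2 :: "real \<Rightarrow> real \<Rightarrow> real" and n :: nat
  assumes T_pos: "T > 0" and a: "CT (Suc n) T a" and a12: "CT n T a1" "CT n T a2"
    and a_pos: "\<And>x t. x \<in> {0..1} \<Longrightarrow> a x t > 0"
begin

lemma a_nz: "x \<in> {0..1} \<Longrightarrow> a x t \<noteq> 0"
  using a_pos[of x t] by simp

lemma a_n: "CT n T a" by (rule CT_mono[OF _ a]) simp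

lemma slope_CT: "CT (Suc n) T (slope a j)"
  unfolding slope_def[abs_def] by (intro CT_divide CT_const a a_nz)

lemma slope_field_slope: "slope_field T (slope a j)"
  by unfold_locales (rule T_pos, rule CT_Suc_deriv(3)[OF slope_CT])

lemma bij_CT: "CT n T (b11 a a1 a2)" "CT n T (b12 a a1 a2)" "CT n T (b21 a a1 a2)" "CT n T (b22 a a1 a2)"
  unfolding b11_def[abs_def] b12_def[abs_def] b21_def[abs_def] b22_def[abs_def]
  by (intro CT_add CT_diff CT_divide CT_mult CT_const a12 a_n CT_Suc_deriv(1,2)[OF a];
      simp add: a_nz)+

lemma damping_CT: "CT n T (damping a a1 a2 j)"
  unfolding damping_def[abs_def] bjj_def
  by (intro CT_minus CT_mult CT_const CT_divide a_n a_nz) (simp add: bij_CT)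

lemma dt_slope:
  assumes "x \<in> {0..1}"
  shows "dt (slope a j) x t = - ((-1) ^ j * dt a x t / (a x t)^2)"
proof -
  have "((\<lambda>s. (-1) ^ j / a x s) has_real_derivative (0 * a x t - (-1) ^ j * dt a x t) / (a x t * a x t)) (at t)"
    by (rule DERIV_divide[OF DERIV_const tC1_deriv[OF CT_Suc_deriv(3)[OF a] assms] a_nz[OF assms]])
  then have "dt (slope a j) x t = (0 * a x t - (-1) ^ j * dt a x t) / (a x t * a x t)"
    unfolding dt_def slope_def by (rule DERIV_imp_deriv)
  then show ?thesis by (simp add: power2_eq_square)
qed

text \<open>By \<open>dt_slope\<close> the term with \<open>dt a\<close> in \<open>cl\<close> is
  \<open>l\<close> times the t-derivative of the slope, so \<open>cl\<close> with index
  \<open>l\<close> is the transport factor of the \<open>l\<close>-th t-derivative.\<close>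

lemma cl_eq:
  assumes "x \<in> {0..1}" "\<xi> \<in> {0..1}"
  shows "cl a a1 a2 j l \<xi> x t
    = exp (oint x \<xi> (\<lambda>\<eta>. - level l (slope a j) (damping a a1 a2 j) \<eta> (fl (slope a j) \<eta> x t)))"
  unfolding cl_def tau_eq_fl
  by (rule arg_cong[where f = exp], rule oint_cong)
    (use assms in \<open>simp_all add: level_def damping_def dt_slope algebra_simps\<close>)

lemma cl_1: "cl a a1 a2 j l 0 1 t = exp (along (slope a j) (level l (slope a j) (damping a a1 a2 j)) 1 t)"
  unfolding cl_eq[of 1 0, simplified] along_def by (simp add: oint_def)

end

context wave_coefficients begin

abbreviation "lev l j \<equiv> level l (slope a j) (damping a a1 a2 j)"

lemma cl_0: "cl a a1 a2 j l 1 0 t = exp (- along (slope a j) (lev l j) 1 (fl (slope a j) 1 0 t))"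
proof -
  interpret S: slope_field T "slope a j" by (rule slope_field_slope)
  have "integral {0..1} (\<lambda>\<eta>. lev l j \<eta> (fl (slope a j) \<eta> 0 t))
      = integral {0..1} (\<lambda>\<eta>. lev l j \<eta> (fl (slope a j) \<eta> 1 (fl (slope a j) 1 0 t)))"
    by (rule Henstock_Kurzweil_Integration.integral_cong) (simp add: S.fl_fl)
  then show ?thesis using cl_eq[of 0 1 j l t] by (simp add: along_def oint_def)
qed

lemma cl_product_1: "cl a a1 a2 1 l 0 1 t * cl a a1 a2 2 l 1 0 (tau a 1 0 1 t)
    = exp (gain1 (slope a 1) (slope a 2) (lev l 1) (lev l 2) t)"
  unfolding cl_0 cl_1 gain1_def tau_eq_fl by (simp add: exp_diff exp_minus field_simps)

lemma cl_product_0: "cl a a1 a2 2 l 1 0 t * cl a a1 a2 1 l 0 1 (tau a 2 1 0 t)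
    = exp (gain0 (slope a 1) (slope a 2) (lev l 1) (lev l 2) t)"
  unfolding cl_0 cl_1 gain0_def tau_eq_fl by (simp add: exp_diff exp_minus field_simps)

lemma nonresonantI:
  assumes "(\<forall>t. \<forall>l\<le>n. cl a a1 a2 1 l 0 1 t * cl a a1 a2 2 l 1 0 (tau a 1 0 1 t) < 1)
        \<or> (\<forall>t. \<forall>l\<le>n. cl a a1 a2 1 l 0 1 t * cl a a1 a2 2 l 1 0 (tau a 1 0 1 t) > 1)
        \<or> (\<forall>t. \<forall>l\<le>n. cl a a1 a2 2 l 1 0 t * cl a a1 a2 1 l 0 1 (tau a 2 1 0 t) < 1)
        \<or> (\<forall>t. \<forall>l\<le>n. cl a a1 a2 2 l 1 0 t * cl a a1 a2 1 l 0 1 (tau a 2 1 0 t) > 1)"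
  shows "nonresonant n (slope a 1) (slope a 2) (damping a a1 a2 1) (damping a a1 a2 2)"
  using assms unfolding cl_product_1 cl_product_0 exp_less_one_iff one_less_exp_iff nonresonant_def .

lemma two_slopes_slope:
  "\<exists>k k1 k2. two_slopes T (slope a 1) (slope a 2) k k1 k2"
proof -
  \<comment> \<open>The slopes are \<open>- 1 / a\<close> and \<open>1 / a\<close>, so the
    reciprocal of their difference is \<open>- a / 2\<close>.\<close>
  define k where "k = (\<lambda>x t. (- 1 / 2) * a x t)"
  have k: "CT (Suc n) T k" unfolding k_def by (intro CT_mult CT_const a)
  note s = CT_mono[OF le0 slope_CT]
  have "two_slopes T (slope a 1) (slope a 2) k (\<lambda>x t. dx k x t + slope a 1 x t * dt k x t)
      (\<lambda>x t. dx k x t + slope a 2 x t * dt k x t)"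
  proof (intro two_slopes.intro two_slopes_axioms.intro slope_field_slope)
    show "CT 0 T k" by (rule CT_mono[OF le0 k])
    show "CT 0 T (\<lambda>x t. dx k x t + slope a 1 x t * dt k x t)" "CT 0 T (\<lambda>x t. dx k x t + slope a 2 x t * dt k x t)"
      by (intro CT0_add CT0_mult CT_mono[OF le0 CT_Suc_deriv(1)[OF k]] CT_mono[OF le0 CT_Suc_deriv(2)[OF k]] s)+
    show "Dir (slope a 1) k (\<lambda>x t. dx k x t + slope a 1 x t * dt k x t)"
      "Dir (slope a 2) k (\<lambda>x t. dx k x t + slope a 2 x t * dt k x t)" by (rule CT_Suc_Dir[OF k])+
    show "k x t * (slope a 1 x t - slope a 2 x t) = 1" if "x \<in> {0..1}" for x t
      using a_nz[OF that, of t] by (simp add: k_def slope_def field_simps)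
  qed
  then show ?thesis by blast
qed

end

text \<open>The weak formulation keeps coupling and source in separate integrals; continuity of the
  weight allows them to be merged.\<close>

lemma (in slope_field) duhamel_Dir_two_sources:
  assumes p: "CT 0 T p" and m: "CT 0 T m" and n: "CT 0 T n" and c: "c \<in> {0..1}"
    and u: "\<And>x t. x \<in> {0..1} \<Longrightarrow> u x t = exp (oint x c (\<lambda>\<eta>. - p \<eta> (fl b \<eta> x t))) * K (fl b c x t)
      - oint c x (\<lambda>\<xi>. exp (oint x \<xi> (\<lambda>\<eta>. - p \<eta> (fl b \<eta> x t))) * m \<xi> (fl b \<xi> x t))
      + oint c x (\<lambda>\<xi>. exp (oint x \<xi> (\<lambda>\<eta>. - p \<eta> (fl b \<eta> x t))) * n \<xi> (fl b \<xi> x t))"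
  shows "Dir b u (\<lambda>x t. p x t * u x t + (n x t - m x t))"
proof (rule duhamel_Dir[OF p CT0_diff[OF n m] c, where K = K])
  fix x t :: real assume x: "x \<in> {0..1}"
  define e where "e = (\<lambda>\<xi>. exp (oint x \<xi> (\<lambda>\<eta>. - p \<eta> (fl b \<eta> x t))))"
  have cp: "continuous_on {0..1} (\<lambda>\<eta>. - p \<eta> (fl b \<eta> x t))"
    by (rule continuous_on_minus[OF curve_continuous[OF p fl_sol[OF x]]])
  have "continuous_on {0..1} (\<lambda>\<xi>. exp (integral {0..\<xi>} (\<lambda>\<eta>. - p \<eta> (fl b \<eta> x t)) - integral {0..x} (\<lambda>\<eta>. - p \<eta> (fl b \<eta> x t))))"
    by (intro continuous_intros indefinite_integral_continuous_1 integrable_continuous_real cp)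
  then have e: "continuous_on {0..1} e"
    by (rule continuous_on_eq) (simp add: e_def oint_eq[OF cp x])
  note en = continuous_on_mult[OF e curve_continuous[OF n fl_sol[OF x, of t]]]
    and em = continuous_on_mult[OF e curve_continuous[OF m fl_sol[OF x, of t]]]
  show "u x t = exp (oint x c (\<lambda>\<eta>. - p \<eta> (fl b \<eta> x t))) * K (fl b c x t)
      + oint c x (\<lambda>\<xi>. exp (oint x \<xi> (\<lambda>\<eta>. - p \<eta> (fl b \<eta> x t))) * (n \<xi> (fl b \<xi> x t) - m \<xi> (fl b \<xi> x t)))"
    using oint_diff[OF en em c x] u[OF x, of t] unfolding e_def by (simp add: right_diff_distrib)
qed

section \<open>The weak solution and its nonlocal terms\<close>

locale weak_solution = wave_coefficients +
  fixes a3 f :: "real \<Rightarrow> real \<Rightarrow> real" and r0 r1 :: "real \<Rightarrow> real" and u1 u2 :: "real \<Rightarrow> real \<Rightarrow> real"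
  assumes a3: "CT n T a3" and f: "CT n T f" and r0: "CT1 n T r0" and r1: "CT1 n T r1"
    and C_nz: "integral {0..T} (\<lambda>t. a 0 t * r0 t) \<noteq> 0"
    and weak: "weak_sys T a a1 a2 a3 f r0 r1 u1 u2"
begin

sublocale S1: slope_field T "slope a 1" by (rule slope_field_slope)
sublocale S2: slope_field T "slope a 2" by (rule slope_field_slope)

abbreviation "G \<equiv> Gop T a r0 u1 u2"
abbreviation "F \<equiv> Fop T a r0 u1 u2"

lemma u_CT0: "CT 0 T u1" "CT 0 T u2"
  by (rule weak[unfolded weak_sys_def, THEN conjunct1]
      weak[unfolded weak_sys_def, THEN conjunct2, THEN conjunct1])+

lemma
  assumes x: "x \<in> {0..1}"
  shows u1_eq: "u1 x t = cl a a1 a2 1 0 0 x t *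
            (u2 0 (fl (slope a 1) 0 x t) + 2 * a 0 (fl (slope a 1) 0 x t) * r0 (fl (slope a 1) 0 x t)
                * G (fl (slope a 1) 0 x t))
          - oint 0 x (\<lambda>\<xi>. dj a a1 a2 1 \<xi> x t * b12 a a1 a2 \<xi> (fl (slope a 1) \<xi> x t)
                * u2 \<xi> (fl (slope a 1) \<xi> x t))
          + oint 0 x (\<lambda>\<xi>. dj a a1 a2 1 \<xi> x t *
                (f \<xi> (fl (slope a 1) \<xi> x t) - a3 \<xi> (fl (slope a 1) \<xi> x t)
                   * F \<xi> (fl (slope a 1) \<xi> x t)))" (is ?U1)
    and u2_eq: "u2 x t = cl a a1 a2 2 0 1 x t *
            (u1 1 (fl (slope a 2) 1 x t) - 2 * a 1 (fl (slope a 2) 1 x t) * r1 (fl (slope a 2) 1 x t)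
                * F 1 (fl (slope a 2) 1 x t))
          - oint 1 x (\<lambda>\<xi>. dj a a1 a2 2 \<xi> x t * b21 a a1 a2 \<xi> (fl (slope a 2) \<xi> x t)
                * u1 \<xi> (fl (slope a 2) \<xi> x t))
          + oint 1 x (\<lambda>\<xi>. dj a a1 a2 2 \<xi> x t *
                (f \<xi> (fl (slope a 2) \<xi> x t) - a3 \<xi> (fl (slope a 2) \<xi> x t)
                   * F \<xi> (fl (slope a 2) \<xi> x t)))" (is ?U2)
proof -
  note w = weak[unfolded weak_sys_def tau_eq_fl, THEN conjunct2, THEN conjunct2, THEN bspec, OF x, THEN spec, of t]
  from w[THEN conjunct1] show ?U1 .
  from w[THEN conjunct2] show ?U2 .
qed

lemma oint_same: "oint c c g = 0"
  by (simp add: oint_def)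

lemma cl_same: "cl a a1 a2 j l c c t = 1"
  by (simp add: cl_def oint_same)

text \<open>At x = 0 the integrals vanish and \<open>cl\<close> is 1, so the integral equation
  reduces to its boundary term.\<close>

lemma boundary_0: "u1 0 t = u2 0 t + 2 * a 0 t * r0 t * G t"
  using u1_eq[of 0 t] by (simp add: oint_same cl_same S1.fl_same del: One_nat_def)

lemma boundary_1: "u2 1 t = u1 1 t + (- (2 * a 1 t * r1 t * F 1 t))"
  using u2_eq[of 1 t] by (simp add: oint_same cl_same S2.fl_same del: One_nat_def)

lemma G_deriv: "(G has_real_derivative (u1 0 t + u2 0 t) / 2) (at t)"
proof -
  have "continuous_on UNIV (\<lambda>s. (u1 0 s + u2 0 s) / 2)"
    by (intro continuous_intros CT0_slice[OF u_CT0(1)] CT0_slice[OF u_CT0(2)]) auto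
  from DERIV_add[OF oint_has_real_derivative[OF this] DERIV_const]
  show ?thesis by (simp add: Gop_def[abs_def] Iop_def[abs_def])
qed

text \<open>\<open>G\<close> has a periodic derivative, so it grows by a constant over each period; the boundary
  condition at \<open>x = 0\<close> makes this constant vanish wherever \<open>r\<^sub>0\<close> does not.\<close>

lemma G_periodic: "G (t + T) = G t"
proof -
  have zero: "(0::real) \<in> {0..1}" by simp
  define D where "D = (\<lambda>t. G (t + T) - G t)"
  have "(D has_real_derivative 0) (at t)" for t
  proof -
    have "((\<lambda>s. s + T) has_real_derivative 1) (at t)" by (auto intro!: derivative_eq_intros)
    from DERIV_diff[OF DERIV_chain2[OF G_deriv this] G_deriv]
    have "(D has_real_derivative (u1 0 (t + T) + u2 0 (t + T)) / 2 * 1 - (u1 0 t + u2 0 t) / 2) (at t)"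
      by (simp add: D_def)
    then show ?thesis
      by (simp add: CT0_periodic[OF u_CT0(1) zero] CT0_periodic[OF u_CT0(2) zero])
  qed
  then have const: "D s = D s'" for s s' by (intro DERIV_isconst_all allI)
  have "\<exists>t. a 0 t * r0 t \<noteq> 0"
  proof (rule ccontr)
    assume "\<nexists>t. a 0 t * r0 t \<noteq> 0"
    then have "(\<lambda>t. a 0 t * r0 t) = (\<lambda>t. 0)" by (simp add: fun_eq_iff)
    then show False using C_nz by simp
  qed
  then obtain s where s: "a 0 s * r0 s \<noteq> 0" by blast
  have "2 * a 0 s * r0 s * G (s + T) = 2 * a 0 s * r0 s * G s"
    using boundary_0[of "s + T"] boundary_0[of s] r0
    by (auto simp: CT0_periodic[OF u_CT0(1) zero] CT0_periodic[OF u_CT0(2) zero]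
        CT_periodic[OF a zero] CT1_def periodic1_def)
  then have "D s = 0" using s by (simp add: D_def)
  then have "D t = 0" using const[of t s] by simp
  then show ?thesis by (simp add: D_def)
qed

lemma G_CT:
  assumes "CT m T u1" "CT m T u2"
  shows "CT (Suc m) T (\<lambda>x. G)"
proof (rule CT_Suc_circle[OF G_periodic G_deriv])
  have zero: "(0::real) \<in> {0..1}" by simp
  show "CT m T (\<lambda>x t. (u1 0 t + u2 0 t) / 2)"
    by (rule CT_divide[OF CT_add[OF CT_trace[OF assms(1) zero] CT_trace[OF assms(2) zero]] CT_const]) simp
qed

abbreviation "hw \<equiv> (\<lambda>x t. 1 / (2 * a x t))"

lemma hw_CT: "CT (Suc n) T hw"
  by (intro CT_divide CT_mult CT_const a) (simp add: a_nz)

text \<open>\<open>u1\<close> and \<open>u2\<close> are differentiable along different families, so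
  their integrals are separated before transversality is applied to each.\<close>

lemma F_eq:
  assumes x: "x \<in> {0..1}"
  shows "F x t = G t + (along (\<lambda>_ _. 0) (\<lambda>x t. u1 x t * hw x t) x t - along (\<lambda>_ _. 0) (\<lambda>x t. u2 x t * hw x t) x t)"
proof -
  interpret Z: slope_field T "\<lambda>_ _. 0" by (rule slope_field_zero[OF T_pos])
  have c: "CT 0 T (\<lambda>x t. u1 x t * hw x t)" "CT 0 T (\<lambda>x t. u2 x t * hw x t)"
    by (intro CT0_mult u_CT0 CT_mono[OF le0 hw_CT])+
  have "Jop a u1 u2 x t = along (\<lambda>_ _. 0) (\<lambda>x t. u1 x t * hw x t - u2 x t * hw x t) x t"
    unfolding Jop_def along_def using x
    by (simp add: oint_def) (rule Henstock_Kurzweil_Integration.integral_cong,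
        simp add: fl_zero[OF T_pos] diff_divide_distrib)
  note J = this
  show ?thesis unfolding Fop_def J Z.along_diff[OF c x] ..
qed

text \<open>A statement without gain comes first, because the derivatives of \<open>u1\<close> and
  \<open>u2\<close> along characteristics themselves contain \<open>F\<close>.\<close>

lemma F_CT:
  assumes "CT m T u1" "CT m T u2" "m \<le> n"
  shows "CT m T F"
proof (rule CT_cong[OF _ F_eq])
  have h: "CT m T hw" by (rule CT_mono[OF _ hw_CT]) (use assms(3) in simp)
  show "CT m T (\<lambda>x t. G t + (along (\<lambda>_ _. 0) (\<lambda>x t. u1 x t * hw x t) x t
      - along (\<lambda>_ _. 0) (\<lambda>x t. u2 x t * hw x t) x t))"
    by (rule CT_add[OF CT_mono[OF _ G_CT[OF assms(1,2)]] CT_diff[OF along_zero_CT[OF T_pos CT_mult[OF assms(1) h]]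
          along_zero_CT[OF T_pos CT_mult[OF assms(2) h]]]]) simp
qed

abbreviation "p1 \<equiv> damping a a1 a2 1"
abbreviation "p2 \<equiv> damping a a1 a2 2"
abbreviation "q1 \<equiv> (\<lambda>x t. - (slope a 1 x t * b12 a a1 a2 x t))"
abbreviation "q2 \<equiv> (\<lambda>x t. - (slope a 2 x t * b21 a a1 a2 x t))"
abbreviation "g1 \<equiv> (\<lambda>x t. slope a 1 x t * (f x t - a3 x t * F x t))"
abbreviation "g2 \<equiv> (\<lambda>x t. slope a 2 x t * (f x t - a3 x t * F x t))"

lemma dj_eq:
  assumes "x \<in> {0..1}" "\<xi> \<in> {0..1}"
  shows "dj a a1 a2 j \<xi> x t = exp (oint x \<xi> (\<lambda>\<eta>. - damping a a1 a2 j \<eta> (fl (slope a j) \<eta> x t)))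
    * slope a j \<xi> (fl (slope a j) \<xi> x t)"
  unfolding dj_def cl_eq[OF assms] level_0 tau_eq_fl slope_def by simp

lemma n_CT0: "CT 0 T (b12 a a1 a2)" "CT 0 T (b21 a a1 a2)" "CT 0 T (slope a j)" "CT 0 T (damping a a1 a2 j)"
  "CT 0 T (\<lambda>x t. f x t - a3 x t * F x t)"
  by (intro CT_mono[OF le0 bij_CT(2)] CT_mono[OF le0 bij_CT(3)] CT_mono[OF le0 slope_CT]
      CT_mono[OF le0 damping_CT] CT_diff CT_mult CT_mono[OF le0 f] CT_mono[OF le0 a3] F_CT u_CT0 le0)+

lemma Dir_u1: "Dir (slope a 1) u1 (\<lambda>x t. p1 x t * u1 x t + q1 x t * u2 x t + g1 x t)"
proof -
  have "Dir (slope a 1) u1 (\<lambda>x t. p1 x t * u1 x t + (g1 x t - slope a 1 x t * (b12 a a1 a2 x t * u2 x t)))"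
  proof (rule S1.duhamel_Dir_two_sources[where c = 0 and K = "\<lambda>s. u2 0 s + 2 * a 0 s * r0 s * G s"], goal_cases)
    case (5 x t)
    note x = this
    have zero: "(0::real) \<in> {0..1}" by simp
    show ?case
      unfolding u1_eq[OF x, of t] cl_eq[OF x zero] level_0
      by (intro arg_cong2[where f = "(+)"] arg_cong2[where f = "(-)"] refl oint_cong)
        (use x in \<open>simp_all add: dj_eq mult.assoc\<close>)
  qed (intro CT0_mult n_CT0 u_CT0 | simp)+
  then show ?thesis by (rule Dir_cong) (simp_all add: algebra_simps)
qed

lemma Dir_u2: "Dir (slope a 2) u2 (\<lambda>x t. p2 x t * u2 x t + q2 x t * u1 x t + g2 x t)"
proof -
  have "Dir (slope a 2) u2 (\<lambda>x t. p2 x t * u2 x t + (g2 x t - slope a 2 x t * (b21 a a1 a2 x t * u1 x t)))"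
  proof (rule S2.duhamel_Dir_two_sources[where c = 1 and K = "\<lambda>s. u1 1 s - 2 * a 1 s * r1 s * F 1 s"], goal_cases)
    case (5 x t)
    note x = this
    have one: "(1::real) \<in> {0..1}" by simp
    show ?case
      unfolding u2_eq[OF x, of t] cl_eq[OF x one] level_0
      by (intro arg_cong2[where f = "(+)"] arg_cong2[where f = "(-)"] refl oint_cong)
        (use x in \<open>simp_all add: dj_eq mult.assoc\<close>)
  qed (intro CT0_mult n_CT0 u_CT0 | simp)+
  then show ?thesis by (rule Dir_cong) (simp_all add: algebra_simps)
qed

lemma weak_boundary_system:
  "boundary_system T (slope a 1) (slope a 2) p1 q1 g1 (\<lambda>t. 2 * a 0 t * r0 t * G t)
     p2 q2 g2 (\<lambda>t. - (2 * a 1 t * r1 t * F 1 t)) u1 u2"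
  unfolding boundary_system_def
  by (intro conjI allI u_CT0 Dir_u1 Dir_u2 boundary_0 boundary_1)

text \<open>The differences of the zero slope with \<open>- 1 / a\<close> and \<open>1 / a\<close>
  have the reciprocals \<open>a\<close> and \<open>- a\<close>, which serve as
  \<open>\<kappa>\<close> for the integrals of \<open>u1\<close> and \<open>u2\<close>.\<close>

lemma F_gain:
  assumes u: "CT m T u1" "CT m T u2" and m: "m \<le> n"
  shows "CT (Suc m) T F"
proof (rule CT_cong[OF _ F_eq])
  note mn = CT_mono[OF m] and mS = CT_mono[OF Suc_leI[OF le_imp_less_Suc[OF m]]]
    and mn' = CT_mono[OF le_SucI[OF m]]
  have D: "CT m T (\<lambda>x t. p1 x t * u1 x t + q1 x t * u2 x t + g1 x t)"
    "CT m T (\<lambda>x t. p2 x t * u2 x t + q2 x t * u1 x t + g2 x t)"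
    by (intro CT_add CT_mult CT_minus CT_diff u mn[OF damping_CT] mn[OF bij_CT(2)] mn[OF bij_CT(3)]
        mn'[OF slope_CT] mn[OF f] mn[OF a3] F_CT m)+
  have Dh: "CT m T (\<lambda>x t. dx hw x t + slope a j x t * dt hw x t)" for j
    by (intro CT_add CT_mult mn'[OF slope_CT] mn[OF CT_Suc_deriv(1)[OF hw_CT]] mn[OF CT_Suc_deriv(2)[OF hw_CT]])
  have h: "CT m T hw" by (rule mn'[OF hw_CT])
  have aS: "CT (Suc m) T a" "CT (Suc m) T (\<lambda>x t. - a x t)" by (intro CT_minus mS a)+
  have "CT (Suc m) T (along (\<lambda>_ _. 0) (\<lambda>x t. u1 x t * hw x t))"
  proof (rule along_zero_transversal_CT[OF slope_field_slope[of 1] CT_mult[OF u(1) h] _ Dir_mult[OF Dir_u1 CT_Suc_Dir[OF hw_CT]] aS(1)])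
    show "CT m T (\<lambda>x t. (p1 x t * u1 x t + q1 x t * u2 x t + g1 x t) * hw x t
        + u1 x t * (dx hw x t + slope a 1 x t * dt hw x t))"
      by (intro CT_add[OF CT_mult[OF D(1) h] CT_mult[OF u(1) Dh]])
    show "a x t * (0 - slope a 1 x t) = 1" if "x \<in> {0..1}" for x t
      using a_nz[OF that, of t] by (simp add: slope_def)
  qed
  moreover have "CT (Suc m) T (along (\<lambda>_ _. 0) (\<lambda>x t. u2 x t * hw x t))"
  proof (rule along_zero_transversal_CT[OF slope_field_slope[of 2] CT_mult[OF u(2) h] _ Dir_mult[OF Dir_u2 CT_Suc_Dir[OF hw_CT]] aS(2)])
    show "CT m T (\<lambda>x t. (p2 x t * u2 x t + q2 x t * u1 x t + g2 x t) * hw x t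
        + u2 x t * (dx hw x t + slope a 2 x t * dt hw x t))"
      by (intro CT_add[OF CT_mult[OF D(2) h] CT_mult[OF u(2) Dh]])
    show "- a x t * (0 - slope a 2 x t) = 1" if "x \<in> {0..1}" for x t
      using a_nz[OF that, of t] by (simp add: slope_def)
  qed
  ultimately show "CT (Suc m) T (\<lambda>x t. G t + (along (\<lambda>_ _. 0) (\<lambda>x t. u1 x t * hw x t) x t
      - along (\<lambda>_ _. 0) (\<lambda>x t. u2 x t * hw x t) x t))"
    by (rule CT_add[OF G_CT[OF u] CT_diff])
qed

text \<open>Once \<open>u1\<close> and \<open>u2\<close> are of class \<open>m\<close>, the nonlocal
  terms in the sources and boundary data are of class \<open>Suc m\<close>; frozen, they leave a
  local problem to which \<open>boundary_system_regularity\<close> applies at order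
  \<open>Suc m\<close>.\<close>

lemma u_regular:
  assumes nr: "nonresonant n (slope a 1) (slope a 2) p1 p2"
  shows "m \<le> n \<Longrightarrow> CT m T u1 \<and> CT m T u2"
proof (induction m)
  case 0
  show ?case using u_CT0 by (rule conjI)
next
  case (Suc m)
  then have u: "CT m T u1" "CT m T u2" and m: "m \<le> n" by simp_all
  note F = F_gain[OF u m]
  note mn = CT_mono[OF Suc.prems] and mn' = CT_mono[OF le_SucI[OF Suc.prems]]
  have zero: "(0::real) \<in> {0..1}" and one: "(1::real) \<in> {0..1}" by auto
  obtain k k1 k2 where "two_slopes T (slope a 1) (slope a 2) k k1 k2" using two_slopes_slope by blast
  then interpret two_slopes T "slope a 1" "slope a 2" k k1 k2 .
  have sl: "CT (Suc (Suc m)) T (slope a j)" for j by (rule CT_mono[OF _ slope_CT]) (use Suc.prems in simp)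
  show ?case
  proof (rule boundary_system_regularity[OF weak_boundary_system sl sl mn[OF damping_CT] mn[OF damping_CT]])
    show "CT (Suc m) T q1" "CT (Suc m) T q2" "CT (Suc m) T g1" "CT (Suc m) T g2"
      by (intro CT_minus CT_mult CT_diff mn'[OF slope_CT] mn[OF bij_CT(2)] mn[OF bij_CT(3)] mn[OF f] mn[OF a3] F)+
    show "CT (Suc m) T (\<lambda>x t. 2 * a 0 t * r0 t * G t)"
      by (rule CT_mult[OF CT_mult[OF CT_mult[OF CT_const CT_trace[OF mn'[OF a] zero]] mn[OF CT_lift[OF r0]]] G_CT[OF u]])
    show "CT (Suc m) T (\<lambda>x t. - (2 * a 1 t * r1 t * F 1 t))"
      by (rule CT_minus[OF CT_mult[OF CT_mult[OF CT_mult[OF CT_const CT_trace[OF mn'[OF a] one]] mn[OF CT_lift[OF r1]]]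
            CT_trace[OF F one]]])
    show "nonresonant (Suc m) (slope a 1) (slope a 2) p1 p2" by (rule nonresonant_mono[OF Suc.prems nr])
  qed
qed

text \<open>The weak solution is \<open>F\<close> itself, so its last derivative comes from
  \<open>F_gain\<close> while \<open>u1\<close> and \<open>u2\<close> are used in class
  \<open>n\<close>.\<close>

lemma wsol_CT:
  assumes nr: "nonresonant n (slope a 1) (slope a 2) p1 p2"
  shows "CT (Suc n) T (wsol T a r0 u1 u2)"
proof (rule CT_cong)
  show "CT (Suc n) T F" using u_regular[OF nr order_refl] by (intro F_gain) simp_all
  show "wsol T a r0 u1 u2 x t = F x t" for x t by (simp add: wsol_def Fop_def Gop_def)
qed

end

section \<open>Wave speeds independent of time\<close>

lemma nonvanishing_sign:
  fixes g :: "real \<Rightarrow> real"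
  assumes c: "continuous_on UNIV g" and nz: "\<And>t. g t \<noteq> 0"
  shows "(\<forall>t. g t < 0) \<or> (\<forall>t. g t > 0)"
proof (rule ccontr)
  assume "\<not> ?thesis"
  then obtain s t where "g s \<ge> 0" "g t \<le> 0" by (auto simp: not_less)
  moreover have "connected (range g)" using connected_continuous_image[OF c connected_UNIV] .
  ultimately have "0 \<in> range g" using connectedD_interval[of "range g" "g t" "g s" 0] by blast
  then show False using nz by auto
qed

context wave_coefficients begin

text \<open>When \<open>a\<close> does not depend on \<open>t\<close>, reversing time turns a
  characteristic of the second family into one of the first; the constant
  \<open>\<sigma> 1 + \<sigma> 0\<close> in \<open>\<tau>\<close> makes the end values change
  places.\<close>

lemma opposite_slopes_inverse:
  assumes aut: "\<And>x t s. x \<in> {0..1} \<Longrightarrow> a x t = a x s"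
  shows "fl (slope a 1) 0 1 (fl (slope a 2) 0 1 t) = t"
proof -
  interpret S1: slope_field T "slope a 1" by (rule slope_field_slope)
  interpret S2: slope_field T "slope a 2" by (rule slope_field_slope)
  have one: "(1::real) \<in> {0..1}" and zero: "(0::real) \<in> {0..1}" by auto
  define \<sigma> where "\<sigma> = (\<lambda>\<xi>. fl (slope a 2) \<xi> 1 t)"
  have \<sigma>: "sol (slope a 2) \<sigma>" unfolding \<sigma>_def by (rule S2.fl_sol[OF one])
  define \<tau> where "\<tau> = (\<lambda>\<xi>. - \<sigma> \<xi> + (\<sigma> 1 + \<sigma> 0))"
  have "sol (slope a 1) \<tau>" unfolding sol_def
  proof
    fix x :: real assume x: "x \<in> {0..1}"
    have "(\<sigma> has_real_derivative slope a 2 x (\<sigma> x)) (at x within {0..1})"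
      using \<sigma> x unfolding sol_def by (rule bspec)
    from DERIV_add[OF DERIV_minus[OF this] DERIV_const[of "\<sigma> 1 + \<sigma> 0"]]
    have "(\<tau> has_real_derivative - slope a 2 x (\<sigma> x) + 0) (at x within {0..1})" unfolding \<tau>_def .
    moreover have "- slope a 2 x (\<sigma> x) + 0 = slope a 1 x (\<tau> x)"
      by (simp add: slope_def aut[OF x, of "\<sigma> x" "\<tau> x"])
    ultimately show "(\<tau> has_real_derivative slope a 1 x (\<tau> x)) (at x within {0..1})" by simp
  qed
  from S1.fl_eq[OF this one zero] have "fl (slope a 1) 0 1 (\<sigma> 0) = \<sigma> 1" by (simp add: \<tau>_def)
  then show ?thesis by (simp add: \<sigma>_def S2.fl_same[OF one])
qed

text \<open>The dampings of the two families carry opposite signs, so the difference in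
  \<open>gain1\<close> becomes the sum of \<open>b11 / a\<close> and \<open>b22 / a\<close>.\<close>

lemma gain1_integral:
  "gain1 (slope a 1) (slope a 2) (damping a a1 a2 1) (damping a a1 a2 2) t
    = integral {0..1} (\<lambda>\<eta>. b11 a a1 a2 \<eta> (tau a 1 \<eta> 1 t) / a \<eta> (tau a 1 \<eta> 1 t)
      + b22 a a1 a2 \<eta> (tau a 2 \<eta> 0 (tau a 1 0 1 t)) / a \<eta> (tau a 2 \<eta> 0 (tau a 1 0 1 t)))"
proof -
  interpret S1: slope_field T "slope a 1" by (rule slope_field_slope)
  interpret S2: slope_field T "slope a 2" by (rule slope_field_slope)
  have one: "(1::real) \<in> {0..1}" and zero: "(0::real) \<in> {0..1}" by auto
  define s where "s = fl (slope a 1) 0 1 t"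
  note d0 = CT_mono[OF le0 damping_CT]
  have i: "(\<lambda>\<eta>. damping a a1 a2 1 \<eta> (fl (slope a 1) \<eta> 1 t)) integrable_on {0..1}"
    "(\<lambda>\<eta>. damping a a1 a2 2 \<eta> (fl (slope a 2) \<eta> 0 s)) integrable_on {0..1}"
    by (rule integrable_continuous_real S1.curve_continuous[OF d0 S1.fl_sol[OF one]]
        S2.curve_continuous[OF d0 S2.fl_sol[OF zero]])+
  have "integral {0..1} (\<lambda>\<eta>. damping a a1 a2 2 \<eta> (fl (slope a 2) \<eta> 1 (fl (slope a 2) 1 0 s)))
      = integral {0..1} (\<lambda>\<eta>. damping a a1 a2 2 \<eta> (fl (slope a 2) \<eta> 0 s))"
    by (rule Henstock_Kurzweil_Integration.integral_cong) (simp add: S2.fl_fl)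
  then have "gain1 (slope a 1) (slope a 2) (damping a a1 a2 1) (damping a a1 a2 2) t
      = integral {0..1} (\<lambda>\<eta>. damping a a1 a2 1 \<eta> (fl (slope a 1) \<eta> 1 t))
        - integral {0..1} (\<lambda>\<eta>. damping a a1 a2 2 \<eta> (fl (slope a 2) \<eta> 0 s))"
    by (simp only: gain1_def along_def s_def)
  also have "... = integral {0..1} (\<lambda>\<eta>. damping a a1 a2 1 \<eta> (fl (slope a 1) \<eta> 1 t)
      - damping a a1 a2 2 \<eta> (fl (slope a 2) \<eta> 0 s))"
    by (rule Henstock_Kurzweil_Integration.integral_diff[OF i, symmetric])
  also have "... = integral {0..1} (\<lambda>\<eta>. b11 a a1 a2 \<eta> (tau a 1 \<eta> 1 t) / a \<eta> (tau a 1 \<eta> 1 t)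
      + b22 a a1 a2 \<eta> (tau a 2 \<eta> 0 (tau a 1 0 1 t)) / a \<eta> (tau a 2 \<eta> 0 (tau a 1 0 1 t)))"
    unfolding tau_eq_fl s_def by (simp add: damping_def bjj_def)
  finally show ?thesis .
qed

lemma autonomous_level:
  assumes aut: "\<And>x t s. x \<in> {0..1} \<Longrightarrow> a x t = a x s"
  shows "gain1 (slope a 1) (slope a 2) (lev l 1) (lev l 2) t
    = gain1 (slope a 1) (slope a 2) (damping a a1 a2 1) (damping a a1 a2 2) t"
proof -
  have "lev l j x t = damping a a1 a2 j x t" if x: "x \<in> {0..1}" for j x t
  proof -
    have "a x = (\<lambda>s. a x 0)" using aut[OF x] by (intro ext)
    then have "dt a x t = 0" unfolding dt_def by (metis deriv_const)
    then show ?thesis by (simp add: level_def dt_slope[OF x])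
  qed
  then have "along (slope a j) (lev l j) 1 s = along (slope a j) (damping a a1 a2 j) 1 s" for j s
    unfolding along_def by (intro Henstock_Kurzweil_Integration.integral_cong) simp
  then show ?thesis by (simp only: gain1_def)
qed

lemma gain1_continuous:
  "continuous_on UNIV (gain1 (slope a 1) (slope a 2) (damping a a1 a2 1) (damping a a1 a2 2))"
proof -
  interpret S1: slope_field T "slope a 1" by (rule slope_field_slope)
  interpret S2: slope_field T "slope a 2" by (rule slope_field_slope)
  note d0 = CT_mono[OF le0 damping_CT]
  show ?thesis unfolding gain1_def[abs_def]
    by (intro continuous_on_diff S1.along_compose_continuous[OF d0] S2.along_compose_continuous[OF d0]
        S1.fl_continuous S2.fl_continuous continuous_on_const continuous_on_id) auto
qed

lemma autonomous_nonresonant: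
  assumes aut: "\<And>x t s. x \<in> {0..1} \<Longrightarrow> a x t = a x s"
    and cond: "(\<forall>t. integral {0..1} (\<lambda>\<eta>.
              b11 a a1 a2 \<eta> (tau a 1 \<eta> 1 t) / a \<eta> (tau a 1 \<eta> 1 t)
            + b22 a a1 a2 \<eta> (tau a 2 \<eta> 0 (tau a 1 0 1 t)) / a \<eta> (tau a 2 \<eta> 0 (tau a 1 0 1 t))) \<noteq> 0)
        \<or> (\<forall>t. integral {0..1} (\<lambda>\<eta>.
              b22 a a1 a2 \<eta> (tau a 2 \<eta> 0 t) / a \<eta> (tau a 2 \<eta> 0 t)
            + b11 a a1 a2 \<eta> (tau a 1 \<eta> 1 (tau a 2 0 1 t)) / a \<eta> (tau a 1 \<eta> 1 (tau a 2 0 1 t))) \<noteq> 0)"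
  shows "nonresonant n (slope a 1) (slope a 2) (damping a a1 a2 1) (damping a a1 a2 2)"
proof -
  interpret S2: slope_field T "slope a 2" by (rule slope_field_slope)
  let ?g = "gain1 (slope a 1) (slope a 2) (damping a a1 a2 1) (damping a a1 a2 2)"
  have "?g t \<noteq> 0" for t
    using cond
  proof
    assume "\<forall>t. integral {0..1} (\<lambda>\<eta>.
              b11 a a1 a2 \<eta> (tau a 1 \<eta> 1 t) / a \<eta> (tau a 1 \<eta> 1 t)
            + b22 a a1 a2 \<eta> (tau a 2 \<eta> 0 (tau a 1 0 1 t)) / a \<eta> (tau a 2 \<eta> 0 (tau a 1 0 1 t))) \<noteq> 0"
    then show ?thesis unfolding gain1_integral by (rule spec)
  next
    assume 2: "\<forall>t. integral {0..1} (\<lambda>\<eta>.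
              b22 a a1 a2 \<eta> (tau a 2 \<eta> 0 t) / a \<eta> (tau a 2 \<eta> 0 t)
            + b11 a a1 a2 \<eta> (tau a 1 \<eta> 1 (tau a 2 0 1 t)) / a \<eta> (tau a 1 \<eta> 1 (tau a 2 0 1 t))) \<noteq> 0"
    \<comment> \<open>The first condition at \<open>t\<close> is the second one at this
      \<open>s\<close>: the second family joins \<open>s\<close> at x = 1 to \<open>t\<close> at x =
      0, and the first family joins \<open>t\<close> at x = 1 to \<open>s\<close> at x = 0.\<close>
    define s where "s = fl (slope a 2) 1 0 t"
    have t: "tau a 2 0 1 s = t" by (simp add: tau_eq_fl s_def S2.fl_fl S2.fl_same)
    have s: "tau a 1 0 1 t = s"
      using opposite_slopes_inverse[OF aut, of s] t by (simp only: tau_eq_fl)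
    show ?thesis unfolding gain1_integral s using 2[THEN spec, of s] unfolding t
      by (simp only: add.commute not_False_eq_True)
  qed
  moreover have lv: "gain1 (slope a 1) (slope a 2) (lev l 1) (lev l 2) t = ?g t" for l t
    by (rule autonomous_level[OF aut])
  ultimately show ?thesis
    using nonvanishing_sign[OF gain1_continuous] unfolding nonresonant_def lv by blast
qed

end

theorem theorem1p2:
  fixes T :: real and a a1 a2 a3 f :: "real \<Rightarrow> real \<Rightarrow> real" and r0 r1 :: "real \<Rightarrow> real"
  assumes T_pos: "T > 0"
    and per: "periodicT T a" "periodicT T a1" "periodicT T a2" "periodicT T a3" "periodicT T f"
    and per_r: "periodic1 T r0" "periodic1 T r1"
    and a_pos: "\<forall>x\<in>{0..1}. \<forall>t. a x t > 0"
    and C_nz: "integral {0..T} (\<lambda>t. a 0 t * r0 t) \<noteq> 0"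
  shows
   "(\<forall>k::nat. k \<ge> 1 \<longrightarrow>
       CT (k + 1) T a \<longrightarrow> CT k T a1 \<longrightarrow> CT k T a2 \<longrightarrow> CT k T a3 \<longrightarrow> CT k T f \<longrightarrow>
       CT1 k T r0 \<longrightarrow> CT1 k T r1 \<longrightarrow>
       ((\<forall>t. \<forall>l\<le>k. cl a a1 a2 1 l 0 1 t * cl a a1 a2 2 l 1 0 (tau a 1 0 1 t) < 1)
        \<or> (\<forall>t. \<forall>l\<le>k. cl a a1 a2 1 l 0 1 t * cl a a1 a2 2 l 1 0 (tau a 1 0 1 t) > 1)
        \<or> (\<forall>t. \<forall>l\<le>k. cl a a1 a2 2 l 1 0 t * cl a a1 a2 1 l 0 1 (tau a 2 1 0 t) < 1)
        \<or> (\<forall>t. \<forall>l\<le>k. cl a a1 a2 2 l 1 0 t * cl a a1 a2 1 l 0 1 (tau a 2 1 0 t) > 1)) \<longrightarrow>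
       (\<forall>u1 u2. weak_sys T a a1 a2 a3 f r0 r1 u1 u2 \<longrightarrow> CT (k + 1) T (wsol T a r0 u1 u2)))
    \<and>
    ((\<forall>x\<in>{0..1}. \<forall>t s. a x t = a x s) \<longrightarrow>
       CTinf T a \<longrightarrow> CTinf T a1 \<longrightarrow> CTinf T a2 \<longrightarrow> CTinf T a3 \<longrightarrow> CTinf T f \<longrightarrow>
       CT1inf T r0 \<longrightarrow> CT1inf T r1 \<longrightarrow>
       ((\<forall>t. integral {0..1} (\<lambda>\<eta>.
              b11 a a1 a2 \<eta> (tau a 1 \<eta> 1 t) / a \<eta> (tau a 1 \<eta> 1 t)
            + b22 a a1 a2 \<eta> (tau a 2 \<eta> 0 (tau a 1 0 1 t)) / a \<eta> (tau a 2 \<eta> 0 (tau a 1 0 1 t))) \<noteq> 0)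
        \<or> (\<forall>t. integral {0..1} (\<lambda>\<eta>.
              b22 a a1 a2 \<eta> (tau a 2 \<eta> 0 t) / a \<eta> (tau a 2 \<eta> 0 t)
            + b11 a a1 a2 \<eta> (tau a 1 \<eta> 1 (tau a 2 0 1 t)) / a \<eta> (tau a 1 \<eta> 1 (tau a 2 0 1 t))) \<noteq> 0)) \<longrightarrow>
       (\<forall>u1 u2. weak_sys T a a1 a2 a3 f r0 r1 u1 u2 \<longrightarrow> CTinf T (wsol T a r0 u1 u2)))"
proof (intro conjI allI impI, goal_cases)
  case (1 k u1 u2)
  interpret weak_solution T a a1 a2 k a3 f r0 r1 u1 u2
    by unfold_locales (use T_pos a_pos C_nz 1(2-8,10) in auto)
  show ?case using wsol_CT[OF nonresonantI[OF 1(9)]] by simp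
next
  case (2 u1 u2)
  \<comment> \<open>Every finite order is admissible, since without dependence on \<open>t\<close>
    the gains are the same for all \<open>l\<close>.\<close>
  have "CT (Suc k) T (wsol T a r0 u1 u2)" for k
  proof -
    have CT: "CT k T g" if "CTinf T g" for g k using that by (simp only: CTinf_def CT_def simp_thms)
    have CT1: "CT1 k T r" if "CT1inf T r" for r k using that by (simp only: CT1inf_def CT1_def simp_thms)
    interpret weak_solution T a a1 a2 k a3 f r0 r1 u1 u2
      by unfold_locales (use T_pos a_pos C_nz 2(2-8,10) in \<open>auto intro: CT CT1\<close>)
    have "a x t = a x s" if "x \<in> {0..1}" for x t s using 2(1) that by blast
    from wsol_CT[OF autonomous_nonresonant[OF this 2(9)]] show ?thesis by simp
  qed
  then show ?case unfolding CTinf_def CT_def by (blast intro: Ck_Suc_imp)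
qed

end
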